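(* Let the class of weights be $\mathcal W=\{w(t-x):w\in\mathcal V\}$, where $\mathcal V=\{w=\phi[\zeta]:\zeta\in\mathbb Z\}$, $\mathbb Z$ a totally bounded subset of a metric space $(\mathfrak Z,\mathrm d)$, and let Assumptions (W1), (W4) and (L) (stated in the context) hold. Let $q\ge1$ and $u_\epsilon=2^\epsilon(1+\epsilon)$. (i) If $s\in[1,2)$, then for all $n\ge1$, $z\ge[\sqrt{37}/2]\,n^{1/2-1/s}$ and $\epsilon\in(0,1]$ $$\mathbb E\sup_{w\in\mathcal W}\big[\|\xi_w\|_s-4u_\epsilon(1+z)n^{1/s}\|w\|_s\big]_+^q\le T_{3,\epsilon}\,n^{q/s}\exp\Big\{-\frac{2z^2}{37}n^{(2/s)-1}\Big\}.$$ (ii) If $s=2$ and $f\in\mathcal F$, then for all $n\ge1$, $z\ge\sqrt{8[\mu_*\mathrm f_\infty^2+4n^{-1/2}]}$ and $\epsilon\in(0,1]$ $$\mathbb E\sup_{w\in\mathcal W}\big[\|\xi_w\|_2-u_\epsilon(1+z+z^2/12)\sqrt n\,\|w\|_2\big]_+^q\le T_{4,\epsilon}\,n^{q/2}\exp\Big\{-\frac{z^2}{16[\mathrm f_\infty^2\mu_*+4n^{-1/2}]}\Big\}.$$ Here $$T_{3,\epsilon}=\frac{2^{q(\epsilon+1)}u_\epsilon^q}{2^{q\epsilon}-1}\Gamma(q+1)N_{\mathbb Z,\mathrm d}(\epsilon/8)\big[1+L^{(\epsilon)}_{\exp}\big]\big[4\bar{\mathrm w}_s(1+4n^{1/2-1/s})\big]^q,$$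 $$T_{4,\epsilon}=\frac{2^{q(\epsilon+1)}u_\epsilon^q}{2^{q\epsilon}-1}\Gamma(q+1)N_{\mathbb Z,\mathrm d}(\epsilon/8)\big[1+L^{(\epsilon)}_{\exp}\big]\,\bar{\mathrm w}_2^q\Big\{1+2\sqrt{2\mu_*\mathrm f_\infty^2+8n^{-1/2}}+(8/3)n^{-1/2}\Big\}^q.$$
   Context: Setting. $\mathcal T=\mathcal X=\mathbb R^d$ with Lebesgue measure; $\|\cdot\|_p$ is the $\mathbb L_p(\mathbb R^d)$-norm. $X$ is a random vector in $\mathbb R^d$ with Lebesgue density $f$; $X_1,\dots,X_n$ are independent copies. $\mathcal V$ is a set of measurable $d$-variate functions; a function $w\in\mathcal V$ is identified with the weight $(t,x)\mapsto w(t-x)$, and $\xi_w(t)=\sum_{i=1}^n[w(t-X_i)-\mathbb Ew(t-X)]$. Standing assumption (A1) for each $w\in\mathcal V$: there is a countable dense $\bar{\mathcal X}\subset\mathbb R^d$ such that for any $\delta>0$ and $x\in\mathbb R^d$ there is $\bar x\in\bar{\mathcal X}$ with $\|w(\cdot-x)-w(\cdot-\bar x)\|_s\le\delta$. $\mathcal F$ is the class of all probability densities on $\mathbb R^d$ uniformly bounded by a constant $\mathrm f_\infty<\infty$, by convention $\mathrm f_\infty\ge1$. $N_{\mathbb Z,\mathrm d}(\delta)$ is the minimal number of $\mathrm d$-balls of radius $\delta$ needed to cover $\mathbb Z$, $\mathcal E_{\mathbb Z,\mathrm d}=\ln N_{\mathbb Z,\mathrm d}$, $L^{(\epsilon)}_{\exp}=\sum_{k\ge1}\exp\{2\mathcal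 E_{\mathbb Z,\mathrm d}(\epsilon2^{-k})-(9/16)2^kk^{-2}\}$. For $p\ge1$: $\underline{\mathrm w}_p:=n^{1/p}\inf_{w\in\mathcal V}\|w\|_p$, $\bar{\mathrm w}_p:=n^{1/p}\sup_{w\in\mathcal V}\|w\|_p$, assumed to satisfy $0<\underline{\mathrm w}_p\le\bar{\mathrm w}_p<\infty$ (for $p=s$), and $\mathbb Z_p(b):=\{\zeta\in\mathbb Z:n^{1/p}\|\phi[\zeta]\|_p\le b\}$, $b\in[\underline{\mathrm w}_p,\bar{\mathrm w}_p]$. (W1) $\mu_*:=\sup_{w\in\mathcal V}\mathrm{mes}\{\mathrm{supp}(w)\}<\infty$ ($\mathrm{mes}$ is Lebesgue measure). (W4) There is $\beta\in(0,1)$ such that $C_{\mathbb Z}(\beta):=\sup_{\delta\in(0,1)}\{\ln N_{\mathbb Z,\mathrm d}(\delta)-\delta^{-\beta}\}<\infty$. (L) If $s\in[1,2)$: $\sup_{\zeta_1\ne\zeta_2\in\mathbb Z_s(b)}\frac{n^{1/s}\|\phi[\zeta_1]-\phi[\zeta_2]\|_s}{\mathrm d(\zeta_1,\zeta_2)}\le b$ for all $b\in[\underline{\mathrm w}_s,\bar{\mathrm w}_s]$. If $s\ge2$: $\sup_{\zeta_1\ne\zeta_2\in\mathbb Z_2(b)}\frac{\sqrt n\|\phi[\zeta_1]-\phi[\zeta_2]\|_2}{\mathrm d(\zeta_1,\zeta_2)}\le b$ for all $b\in[\underline{\mathrm w}_2,\bar{\mathrm w}_2]$. *)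

theory Defs
  imports "HOL-Probability.Probability"
begin

definition epowr :: "ennreal \<Rightarrow> real \<Rightarrow> ennreal" where
  "epowr a r = (if a = \<infinity> then \<infinity> else ennreal (enn2real a powr r))"
  \<comment> \<open>only used with an exponent \<open>r > 0\<close>\<close>

text \<open>
  The norm takes the value \<open>\<infinity>\<close> on functions outside of \<open>L\<^sub>p\<close>, so finiteness is never implicit.
\<close>

definition Lp_norm :: "real \<Rightarrow> (real ^ 'd \<Rightarrow> real) \<Rightarrow> ennreal" where
  "Lp_norm p g = epowr (\<integral>\<^sup>+x. ennreal (\<bar>g x\<bar> powr p) \<partial>lborel) (1 / p)"

text \<open>
  The expectation is a Bochner integral. For \<open>w\<close> in \<open>L\<^sub>s\<close>, \<open>s \<ge> 1\<close>, and \<open>X\<close> with a Lebesgue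
  density it exists for almost every \<open>t\<close>; its default value 0 for the other \<open>t\<close>
  does not affect norms of \<open>xi\<close>.
\<close>

definition xi ::
  "'o measure \<Rightarrow> ('o \<Rightarrow> real ^ 'd) \<Rightarrow> (nat \<Rightarrow> 'o \<Rightarrow> real ^ 'd) \<Rightarrow> nat
    \<Rightarrow> (real ^ 'd \<Rightarrow> real) \<Rightarrow> 'o \<Rightarrow> real ^ 'd \<Rightarrow> real" where
  "xi M X Xs n w \<omega> t = (\<Sum>i=1..n. w (t - Xs i \<omega>) - (\<integral>\<omega>'. w (t - X \<omega>') \<partial>M))"

definition bounded_densities :: "real \<Rightarrow> (real ^ 'd \<Rightarrow> real) set" where
  "bounded_densities finf =
     {f. f \<in> borel_measurable borel \<and> (\<forall>x. 0 \<le> f x \<and> f x \<le> finf) \<and>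
         (\<integral>\<^sup>+x. ennreal (f x) \<partial>lborel) = 1}"

text \<open>
  Covering by closed balls of the ambient metric space (the type), so centres need not lie in \<open>Z\<close>.
\<close>

definition covering_number :: "'z::metric_space set \<Rightarrow> real \<Rightarrow> nat" where
  "covering_number Z \<delta> =
     (LEAST k. \<exists>C. finite C \<and> card C = k \<and> Z \<subseteq> (\<Union>c\<in>C. cball c \<delta>))"

definition metric_entropy :: "'z::metric_space set \<Rightarrow> real \<Rightarrow> real" where
  "metric_entropy Z \<delta> = ln (real (covering_number Z \<delta>))"

text \<open>The series below converges, for every \<open>\<epsilon>\<close> in \<open>(0,1]\<close>, under \<open>entropy_condition\<close>.\<close>

definition L_exp :: "'z::metric_space set \<Rightarrow> real \<Rightarrow> real" where
  "L_exp Z \<epsilon> =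
     (\<Sum>\<^sub>\<infinity>k\<in>{1::nat..}. exp (2 * metric_entropy Z (\<epsilon> * 2 powr (- real k))
                            - (9/16) * 2 ^ k * real k powr (-2)))"

definition w_lower :: "nat \<Rightarrow> real \<Rightarrow> (real ^ 'd \<Rightarrow> real) set \<Rightarrow> ennreal" where
  "w_lower n p V = ennreal (real n powr (1 / p)) * (INF w\<in>V. Lp_norm p w)"

definition w_upper :: "nat \<Rightarrow> real \<Rightarrow> (real ^ 'd \<Rightarrow> real) set \<Rightarrow> ennreal" where
  "w_upper n p V = ennreal (real n powr (1 / p)) * (SUP w\<in>V. Lp_norm p w)"

definition slice ::
  "nat \<Rightarrow> real \<Rightarrow> ('z \<Rightarrow> real ^ 'd \<Rightarrow> real) \<Rightarrow> 'z set \<Rightarrow> ennreal \<Rightarrow> 'z set" where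
  "slice n p \<phi> Z b = {\<zeta>\<in>Z. ennreal (real n powr (1 / p)) * Lp_norm p (\<phi> \<zeta>) \<le> b}"

definition translation_separable :: "real \<Rightarrow> (real ^ 'd \<Rightarrow> real) set \<Rightarrow> bool" where
  "translation_separable s V \<longleftrightarrow>
     (\<forall>w\<in>V. \<exists>D. countable D \<and> closure D = UNIV \<and>
        (\<forall>\<delta>>0. \<forall>x. \<exists>y\<in>D. Lp_norm s (\<lambda>t. w (t - x) - w (t - y)) \<le> ennreal \<delta>))"

definition mu_star :: "(real ^ 'd \<Rightarrow> real) set \<Rightarrow> ennreal" where
  "mu_star V = (SUP w\<in>V. emeasure lborel (closure (support_on UNIV w)))"

definition entropy_condition :: "'z::metric_space set \<Rightarrow> bool" where
  "entropy_condition Z \<longleftrightarrow>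
     (\<exists>\<beta>\<in>{0<..<1}. bdd_above
        ((\<lambda>\<delta>. ln (real (covering_number Z \<delta>)) - \<delta> powr (- \<beta>)) ` {0<..<1::real}))"

definition lipschitz_slices ::
  "nat \<Rightarrow> real \<Rightarrow> ('z::metric_space \<Rightarrow> real ^ 'd \<Rightarrow> real) \<Rightarrow> 'z set \<Rightarrow> bool" where
  "lipschitz_slices n p \<phi> Z \<longleftrightarrow>
     (\<forall>b\<in>{w_lower n p (\<phi> ` Z)..w_upper n p (\<phi> ` Z)}.
        (SUP (\<zeta>1, \<zeta>2)\<in>{(\<zeta>1, \<zeta>2). \<zeta>1 \<in> slice n p \<phi> Z b \<and> \<zeta>2 \<in> slice n p \<phi> Z b \<and> \<zeta>1 \<noteq> \<zeta>2}.
           ennreal (real n powr (1 / p)) * Lp_norm p (\<lambda>x. \<phi> \<zeta>1 x - \<phi> \<zeta>2 x)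
             / ennreal (dist \<zeta>1 \<zeta>2)) \<le> b)"

definition lipschitz_condition ::
  "nat \<Rightarrow> real \<Rightarrow> ('z::metric_space \<Rightarrow> real ^ 'd \<Rightarrow> real) \<Rightarrow> 'z set \<Rightarrow> bool" where
  "lipschitz_condition n s \<phi> Z \<longleftrightarrow>
     (1 \<le> s \<and> s < 2 \<longrightarrow> lipschitz_slices n s \<phi> Z) \<and>
     (2 \<le> s \<longrightarrow> lipschitz_slices n 2 \<phi> Z)"

definition u_eps :: "real \<Rightarrow> real" where
  "u_eps \<epsilon> = 2 powr \<epsilon> * (1 + \<epsilon>)"

definition T_common :: "real \<Rightarrow> 'z::metric_space set \<Rightarrow> real \<Rightarrow> real" where
  "T_common q Z \<epsilon> =
     2 powr (q * (\<epsilon> + 1)) * u_eps \<epsilon> powr q / (2 powr (q * \<epsilon>) - 1)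
       * Gamma (q + 1) * real (covering_number Z (\<epsilon> / 8)) * (1 + L_exp Z \<epsilon>)"

definition T3 ::
  "nat \<Rightarrow> real \<Rightarrow> real \<Rightarrow> ('z::metric_space \<Rightarrow> real ^ 'd \<Rightarrow> real) \<Rightarrow> 'z set \<Rightarrow> real \<Rightarrow> real" where
  "T3 n s q \<phi> Z \<epsilon> =
     T_common q Z \<epsilon> *
       (4 * enn2real (w_upper n s (\<phi> ` Z)) * (1 + 4 * real n powr (1/2 - 1/s))) powr q"

definition T4 ::
  "nat \<Rightarrow> real \<Rightarrow> real \<Rightarrow> ('z::metric_space \<Rightarrow> real ^ 'd \<Rightarrow> real) \<Rightarrow> 'z set \<Rightarrow> real \<Rightarrow> real" where
  "T4 n finf q \<phi> Z \<epsilon> =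
     T_common q Z \<epsilon> * enn2real (w_upper n 2 (\<phi> ` Z)) powr q *
       (1 + 2 * sqrt (2 * enn2real (mu_star (\<phi> ` Z)) * finf\<^sup>2 + 8 * real n powr (-1/2))
          + (8/3) * real n powr (-1/2)) powr q"

text \<open>
  Expectation of the \<open>q\<close>-th power of the supremum over \<open>w \<in> V\<close> of the positive part of
  \<open>\<parallel>xi w\<parallel>\<^sub>s - c \<parallel>w\<parallel>\<^sub>s\<close>. Subtraction on \<open>ennreal\<close> is truncated at 0, i.e. it is the positive part.
\<close>

definition excess_moment ::
  "'o measure \<Rightarrow> ('o \<Rightarrow> real ^ 'd) \<Rightarrow> (nat \<Rightarrow> 'o \<Rightarrow> real ^ 'd) \<Rightarrow> nat
    \<Rightarrow> real \<Rightarrow> real \<Rightarrow> real \<Rightarrow> (real ^ 'd \<Rightarrow> real) set \<Rightarrow> ennreal" where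
  "excess_moment M X Xs n s q c V =
     (\<integral>\<^sup>+\<omega>. (SUP w\<in>V. epowr (Lp_norm s (xi M X Xs n w \<omega>) - ennreal c * Lp_norm s w) q) \<partial>M)"

end

(*
Both bounds come from an exponential moment estimate for a single weight, followed by chaining
and peeling.

For a single weight w let S_k be the sum of the first k centred translates and B >= |w|_s.  The
quantity R_k = (|S_k|_s^s + (n - k) K)^(1/s) interpolates between (n K)^(1/s) and |S_n|_s, and for
suitable K one has R_k <= R_{k-1} + D_k, where D_k is linear in the k-th centred translate, hence
has conditional mean zero.  For s <= 2 this follows from
|a + b|^s <= |a|^s + s sgn(a) |a|^(s-1) b + 2 |b|^s with K = (4B)^s, for s = 2 from expanding the
square around the mean function with K = B^2, followed by concavity of the s-th root.  Hoelder's
inequality bounds D_k, so Hoeffding's lemma applies.  For s = 2 and a bounded density the conditional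
variance of D_k is at most 2 f_inf mes(supp w) B^2 by a Young type inequality for convolutions, so a
Bernstein bound applies; this replaces a concentration inequality for suprema of empirical
processes.

On a slice of weights of comparable norm, finite nets of radius eps 2^(-k-2) are chained; the remainder
beyond a large level is controlled deterministically, because |xi_w|_s <= 2 n |w|_s.  Geometric
slices with ratio 2^eps are finite in number since the norms are bounded away from 0.
*)
theory Submission
  imports Defs "HOL-Real_Asymp.Real_Asymp"
begin

text \<open>The reserve added inside the s-th root has two effects. It pays for the second-order
  terms of the observations still to come, and it keeps the base point R of the tangent to the root
  away from 0 and above the norm of the partial sum, so that the linear term divided by
  \<open>R powr (s - 1)\<close> stays bounded.

  The estimates for a single weight are of order \<open>exp (- 2 * y\<^sup>2 * \<tau>)\<close>,
  twice the rate wanted in the end. With y = \<open>chain_weight k * z\<close> this splits into the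
  final \<open>exp (- z\<^sup>2 * \<tau>)\<close> and a rest that pays for the number of links at
  depth k, as soon as \<open>z\<^sup>2 * \<tau> \<ge> 1/2\<close>. The lower bounds on z in both
  parts express exactly this inequality, for \<open>\<tau>\<close> equal to 2/37 n^(2/s - 1) and to
  1 / (16 [finf^2 mu_star + 4 n^(-1/2)]).\<close>

section \<open>Power-integral bounds\<close>

text \<open>A real upper bound for the \<open>L\<^sub>s\<close> norm bundled with measurability.
  Working with bounds instead of norms carries finiteness along and avoids taking roots.\<close>

definition lp_le :: "'a measure \<Rightarrow> real \<Rightarrow> ('a \<Rightarrow> real) \<Rightarrow> real \<Rightarrow> bool" where
  "lp_le M s g A \<longleftrightarrow>
     g \<in> borel_measurable M \<and> 0 \<le> A \<and> (\<integral>\<^sup>+x. ennreal (\<bar>g x\<bar> powr s) \<partial>M) \<le> ennreal (A powr s)"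

lemma lp_le_measurable [measurable_dest]: "lp_le M s g A \<Longrightarrow> g \<in> borel_measurable M"
  by (simp add: lp_le_def)

lemma lp_le_mono: "lp_le M s g A \<Longrightarrow> A \<le> B \<Longrightarrow> 0 \<le> s \<Longrightarrow> lp_le M s g B"
  unfolding lp_le_def using ennreal_leI[OF powr_mono2[of s A B]] by (auto intro: order_trans)

lemma lp_le_uminus: "lp_le M s g A \<Longrightarrow> lp_le M s (\<lambda>x. - g x) A"
  by (auto simp: lp_le_def)

lemma lp_le_zero: "0 \<le> A \<Longrightarrow> lp_le M s (\<lambda>x. 0) A"
  by (auto simp: lp_le_def)

lemma lp_le_AE_cong:
  assumes "lp_le M s g A" "AE x in M. h x = g x" "h \<in> borel_measurable M"
  shows "lp_le M s h A"
proof -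
  have "(\<integral>\<^sup>+x. ennreal (\<bar>h x\<bar> powr s) \<partial>M) = (\<integral>\<^sup>+x. ennreal (\<bar>g x\<bar> powr s) \<partial>M)"
    using assms(2) by (intro nn_integral_cong_AE) auto
  with assms show ?thesis by (simp add: lp_le_def)
qed

text \<open>Serves the degenerate case of Minkowski's inequality, where one cannot normalise by the
  bound.\<close>

lemma lp_le_0_AE:
  assumes "lp_le M s g 0" shows "AE x in M. g x = 0"
proof -
  have [measurable]: "g \<in> borel_measurable M" using assms by (simp add: lp_le_def)
  have "(\<integral>\<^sup>+x. ennreal (\<bar>g x\<bar> powr s) \<partial>M) = 0" using assms by (simp add: lp_le_def)
  then have "AE x in M. ennreal (\<bar>g x\<bar> powr s) = 0" by (subst (asm) nn_integral_0_iff_AE) auto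
  then show ?thesis by eventually_elim (auto simp: ennreal_eq_0_iff)
qed

section \<open>Minkowski, Young and Hoelder inequalities\<close>

lemma abs_powr_convex:
  assumes s: "(s::real) \<ge> 1" and t: "0 \<le> t" "t \<le> 1"
  shows "\<bar>(1 - t) * a + t * b\<bar> powr s \<le> (1 - t) * \<bar>a\<bar> powr s + t * \<bar>b\<bar> powr s"
proof -
  \<comment> \<open>Convexity of the power is applied at positive arguments; if one argument
    vanishes, \<open>u powr s \<le> u\<close> on the unit interval gives the claim.\<close>
  have pos: "((1 - t) * x + t * y) powr s \<le> (1 - t) * x powr s + t * y powr s"
    if xy: "0 \<le> x" "0 \<le> y" for x y
  proof -
    have z: "u powr s \<le> u" if "0 \<le> u" "u \<le> 1" for u :: real
      using that s powr_mono'[of 1 s u] by (cases "u = 0") auto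
    consider "x = 0" | "y = 0" | "x > 0" "y > 0" using xy unfolding less_eq_real_def by blast
    then show ?thesis
    proof cases
      case 1
      then show ?thesis using z[of t] t xy by (auto simp: powr_mult intro!: mult_right_mono)
    next
      case 2
      then show ?thesis using z[of "1-t"] t xy by (auto simp: powr_mult intro!: mult_right_mono)
    next
      case 3
      then show ?thesis using convex_onD[OF powr_convex[OF s], of t x y] t by auto
    qed
  qed
  have "\<bar>(1 - t) * a + t * b\<bar> powr s \<le> ((1 - t) * \<bar>a\<bar> + t * \<bar>b\<bar>) powr s"
    using s t by (intro powr_mono2) (auto intro!: order_trans[OF abs_triangle_ineq] simp: abs_mult)
  also have "\<dots> \<le> (1 - t) * \<bar>a\<bar> powr s + t * \<bar>b\<bar> powr s" by (rule pos) auto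
  finally show ?thesis .
qed

text \<open>Minkowski's inequality: (f + g) / (A + B) is the convex combination of f / A and g / B
  with weights A / (A + B) and B / (A + B), so convexity of the s-th power applies
  pointwise.\<close>

lemma lp_le_add:
  assumes s: "s \<ge> 1" and f: "lp_le M s f A" and g: "lp_le M s g B"
  shows "lp_le M s (\<lambda>x. f x + g x) (A + B)"
proof -
  have [measurable]: "f \<in> borel_measurable M" "g \<in> borel_measurable M" and AB: "0 \<le> A" "0 \<le> B"
    using f g by (auto simp: lp_le_def)
  consider "A = 0" | "B = 0" | "A > 0" "B > 0" using AB unfolding less_eq_real_def by blast
  then show ?thesis
  proof cases
    case 1
    show ?thesis using 1 lp_le_0_AE[of M s f] f
      by (intro lp_le_AE_cong[OF g, THEN lp_le_mono]) (use s in auto)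
  next
    case 2
    show ?thesis using 2 lp_le_0_AE[of M s g] g
      by (intro lp_le_AE_cong[OF f, THEN lp_le_mono]) (use s in auto)
  next
    case 3
    define t where "t = B / (A + B)"
    have t: "0 \<le> t" "t \<le> 1" "1 - t = A / (A + B)" using 3 by (auto simp: t_def field_simps)
    define a where "a = (1 - t) / A powr s"
    define b where "b = t / B powr s"
    have ab: "a \<ge> 0" "b \<ge> 0" using t(1,2) by (auto simp: a_def b_def)
    have pw: "\<bar>f x + g x\<bar> powr s \<le> (A+B) powr s * (a * \<bar>f x\<bar> powr s + b * \<bar>g x\<bar> powr s)" for x
    proof -
      have "f x + g x = (A+B) * ((1-t) * (f x / A) + t * (g x / B))"
      proof -
        have "(1-t) * (f x / A) = f x / (A+B)" "t * (g x / B) = g x / (A+B)"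
          unfolding t(3) using 3 by (simp_all add: t_def)
        then show ?thesis using 3 by (simp add: distrib_left)
      qed
      then have "\<bar>f x + g x\<bar> powr s = (A+B) powr s * \<bar>(1-t) * (f x / A) + t * (g x / B)\<bar> powr s"
        using 3 by (simp add: abs_mult powr_mult)
      also have "\<dots> \<le> (A+B) powr s * ((1-t) * \<bar>f x / A\<bar> powr s + t * \<bar>g x / B\<bar> powr s)"
        by (intro mult_left_mono abs_powr_convex s t) auto
      also have "\<dots> = (A+B) powr s * (a * \<bar>f x\<bar> powr s + b * \<bar>g x\<bar> powr s)"
        using 3 by (simp add: powr_divide a_def b_def)
      finally show ?thesis .
    qed
    have "(\<integral>\<^sup>+x. ennreal (\<bar>f x + g x\<bar> powr s) \<partial>M)
      \<le> (\<integral>\<^sup>+x. ennreal ((A+B) powr s) * (ennreal a * ennreal (\<bar>f x\<bar> powr s)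
            + ennreal b * ennreal (\<bar>g x\<bar> powr s)) \<partial>M)"
      using ab by (intro nn_integral_mono) (auto simp: ennreal_mult[symmetric] ennreal_plus[symmetric]
          intro!: ennreal_leI pw simp del: ennreal_plus)
    also have "\<dots> = ennreal ((A+B) powr s) * (ennreal a * (\<integral>\<^sup>+x. ennreal (\<bar>f x\<bar> powr s) \<partial>M)
            + ennreal b * (\<integral>\<^sup>+x. ennreal (\<bar>g x\<bar> powr s) \<partial>M))"
      by (simp add: nn_integral_cmult nn_integral_add)
    also have "\<dots> \<le> ennreal ((A+B) powr s) * (ennreal a * ennreal (A powr s)
            + ennreal b * ennreal (B powr s))"
      using f g by (intro mult_left_mono add_mono) (auto simp: lp_le_def)
    also have "\<dots> = ennreal ((A+B) powr s)"
    proof -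
      have "a * A powr s + b * B powr s = 1" using 3 by (simp add: a_def b_def)
      then show ?thesis using ab
        by (simp add: ennreal_mult[symmetric] ennreal_plus[symmetric] del: ennreal_plus)
    qed
    finally show ?thesis using AB by (simp add: lp_le_def)
  qed
qed

lemma lp_le_diff:
  assumes "s \<ge> 1" "lp_le M s f A" "lp_le M s g B"
  shows "lp_le M s (\<lambda>x. f x - g x) (A + B)"
  using lp_le_add[OF assms(1,2) lp_le_uminus[OF assms(3)]] by simp

lemma lp_le_sum:
  assumes s: "s \<ge> 1" and "finite I" and "\<And>i. i \<in> I \<Longrightarrow> lp_le M s (f i) (A i)"
  shows "lp_le M s (\<lambda>x. \<Sum>i\<in>I. f i x) (\<Sum>i\<in>I. A i)"
  using assms(2,3) by (induction I) (auto intro!: lp_le_zero lp_le_add s)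

text \<open>Young's inequality for the exponents s / (s - 1) and s, multiplied out so that s = 1,
  where the conjugate exponent is infinite, is included.\<close>

lemma young_powr:
  assumes s: "(s::real) \<ge> 1" and x: "x \<ge> 0" "y \<ge> 0"
  shows "x powr (s - 1) * y \<le> (s - 1) / s * x powr s + 1 / s * y powr s"
proof (cases "s = 1")
  case True then show ?thesis using x by (cases "x = 0") auto
next
  case False
  then have s1: "s > 1" using s by simp
  have "x powr (s-1) * y \<le> (x powr (s-1)) powr (s/(s-1)) / (s/(s-1)) + y powr s / s"
    by (rule Youngs_inequality) (use s1 x in \<open>auto simp: field_simps\<close>)
  also have "(x powr (s-1)) powr (s/(s-1)) = x powr s" using s1 by (simp add: powr_powr)
  finally show ?thesis by (simp add: field_simps)
qed

text \<open>Hoelder's inequality with the dual function written as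
  \<open>\<bar>g x\<bar> powr (s - 1)\<close>, which again includes s = 1. It is Young's inequality
  for |g| / A and |h| / B, integrated.\<close>

lemma holder_nn_integral:
  assumes s: "s \<ge> 1" and g: "lp_le M s g A" and h: "lp_le M s h B" and pos: "A > 0" "B > 0"
  shows "(\<integral>\<^sup>+x. ennreal (\<bar>g x\<bar> powr (s - 1) * \<bar>h x\<bar>) \<partial>M) \<le> ennreal (A powr (s - 1) * B)"
proof -
  have [measurable]: "g \<in> borel_measurable M" "h \<in> borel_measurable M"
    using g h by (auto simp: lp_le_def)
  define a where "a = (s-1)/s * (A powr (s-1) * B) / A powr s"
  define b where "b = 1/s * (A powr (s-1) * B) / B powr s"
  have ab: "a \<ge> 0" "b \<ge> 0" using s pos by (auto simp: a_def b_def)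
  have pw: "\<bar>g x\<bar> powr (s - 1) * \<bar>h x\<bar> \<le> a * \<bar>g x\<bar> powr s + b * \<bar>h x\<bar> powr s" for x
  proof -
    have "(\<bar>g x\<bar> / A) powr (s-1) * (\<bar>h x\<bar> / B) \<le> (s-1)/s * (\<bar>g x\<bar>/A) powr s + 1/s * (\<bar>h x\<bar>/B) powr s"
      by (rule young_powr) (use s pos in auto)
    from mult_left_mono[OF this, of "A powr (s-1) * B"] show ?thesis
      using pos by (simp add: powr_divide a_def b_def field_simps)
  qed
  have "(\<integral>\<^sup>+x. ennreal (\<bar>g x\<bar> powr (s - 1) * \<bar>h x\<bar>) \<partial>M)
     \<le> (\<integral>\<^sup>+x. ennreal a * ennreal (\<bar>g x\<bar> powr s) + ennreal b * ennreal (\<bar>h x\<bar> powr s) \<partial>M)"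
    using ab by (intro nn_integral_mono) (auto simp: ennreal_mult[symmetric] ennreal_plus[symmetric]
          intro!: ennreal_leI pw simp del: ennreal_plus)
  also have "\<dots> = ennreal a * (\<integral>\<^sup>+x. ennreal (\<bar>g x\<bar> powr s) \<partial>M) + ennreal b * (\<integral>\<^sup>+x. ennreal (\<bar>h x\<bar> powr s) \<partial>M)"
    by (simp add: nn_integral_cmult nn_integral_add)
  also have "\<dots> \<le> ennreal a * ennreal (A powr s) + ennreal b * ennreal (B powr s)"
    using g h by (intro mult_left_mono add_mono) (auto simp: lp_le_def)
  also have "\<dots> = ennreal (A powr (s - 1) * B)"
  proof -
    have "a * A powr s + b * B powr s = (s-1)/s * (A powr (s-1) * B) + 1/s * (A powr (s-1) * B)"
      using pos by (simp add: a_def b_def)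
    also have "\<dots> = A powr (s-1) * B" using s by (simp add: distrib_right[symmetric] add_divide_distrib[symmetric] del: times_divide_eq_left)
    finally show ?thesis using ab
      by (simp add: ennreal_mult[symmetric] ennreal_plus[symmetric] del: ennreal_plus)
  qed
  finally show ?thesis .
qed

lemma holder_integral:
  assumes s: "s \<ge> 1" and g: "lp_le M s g A" and h: "lp_le M s h B" and pos: "A > 0" "B > 0"
    and k: "k \<in> borel_measurable M" "\<And>x. \<bar>k x\<bar> \<le> \<bar>g x\<bar> powr (s - 1)"
  shows "integrable M (\<lambda>x. k x * h x)" "\<bar>\<integral>x. k x * h x \<partial>M\<bar> \<le> A powr (s - 1) * B"
    "(\<integral>x. \<bar>k x * h x\<bar> \<partial>M) \<le> A powr (s - 1) * B"
proof -
  have [measurable]: "g \<in> borel_measurable M" "h \<in> borel_measurable M" "k \<in> borel_measurable M"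
    using g h k by (auto simp: lp_le_def)
  have *: "(\<integral>\<^sup>+x. ennreal (norm (k x * h x)) \<partial>M) \<le> ennreal (A powr (s - 1) * B)"
    by (rule order_trans[OF nn_integral_mono holder_nn_integral[OF s g h pos]])
       (auto simp: abs_mult intro!: ennreal_leI mult_right_mono k)
  then show i: "integrable M (\<lambda>x. k x * h x)"
    by (intro integrableI_bounded) (auto simp: less_top[symmetric] top_unique)
  show **: "(\<integral>x. \<bar>k x * h x\<bar> \<partial>M) \<le> A powr (s - 1) * B"
    using * i pos by (subst (asm) nn_integral_eq_integral) (auto simp: ennreal_le_iff)
  show "\<bar>\<integral>x. k x * h x \<partial>M\<bar> \<le> A powr (s - 1) * B"
    by (rule order_trans[OF integral_abs_bound **])
qed

lemma lp_le_integral: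
  assumes "lp_le M s g A"
  shows "integrable M (\<lambda>x. \<bar>g x\<bar> powr s)" "(\<integral>x. \<bar>g x\<bar> powr s \<partial>M) \<le> A powr s"
proof -
  have [measurable]: "g \<in> borel_measurable M" using assms by (auto simp: lp_le_def)
  have *: "(\<integral>\<^sup>+x. ennreal (norm (\<bar>g x\<bar> powr s)) \<partial>M) \<le> ennreal (A powr s)" using assms by (auto simp: lp_le_def)
  then show i: "integrable M (\<lambda>x. \<bar>g x\<bar> powr s)"
    by (intro integrableI_bounded) (auto simp: less_top[symmetric] top_unique)
  show "(\<integral>x. \<bar>g x\<bar> powr s \<partial>M) \<le> A powr s"
    using * i by (subst (asm) nn_integral_eq_integral) (auto simp: ennreal_le_iff)
qed

lemma lp_leI_integral:
  assumes [measurable]: "g \<in> borel_measurable M" and i: "integrable M (\<lambda>x. \<bar>g x\<bar> powr s)"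
    and "(\<integral>x. \<bar>g x\<bar> powr s \<partial>M) \<le> A powr s" "0 \<le> A"
  shows "lp_le M s g A"
  unfolding lp_le_def using assms
  by (subst nn_integral_eq_integral) (auto simp: ennreal_le_iff)

section \<open>Comparison with the extended norm \<open>Lp_norm\<close>\<close>

lemma Lp_norm_le_iff:
  assumes g: "g \<in> borel_measurable borel" and s: "s > 0" and A: "0 \<le> A"
  shows "Lp_norm s g \<le> ennreal A \<longleftrightarrow> lp_le lborel s g A"
proof (cases "(\<integral>\<^sup>+x. ennreal (\<bar>g x\<bar> powr s) \<partial>lborel) = \<infinity>")
  case True then show ?thesis using assms by (auto simp: Lp_norm_def epowr_def lp_le_def top_unique)
next
  case False
  then obtain I where I: "(\<integral>\<^sup>+x. ennreal (\<bar>g x\<bar> powr s) \<partial>lborel) = ennreal I" "I \<ge> 0"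
    by (cases "\<integral>\<^sup>+x. ennreal (\<bar>g x\<bar> powr s) \<partial>lborel") auto
  have "I powr (1/s) \<le> A \<longleftrightarrow> I \<le> A powr s"
  proof
    assume "I powr (1/s) \<le> A"
    from powr_mono2[OF _ _ this, of s] show "I \<le> A powr s" using s I by (simp add: powr_powr)
  next
    assume "I \<le> A powr s"
    from powr_mono2[OF _ _ this, of "1/s"] show "I powr (1/s) \<le> A" using s I A by (simp add: powr_powr)
  qed
  then show ?thesis using assms I by (auto simp: Lp_norm_def epowr_def lp_le_def ennreal_le_iff)
qed

lemma Lp_norm_eq:
  assumes "lp_le lborel s g A"
  shows "Lp_norm s g = ennreal ((\<integral>x. \<bar>g x\<bar> powr s \<partial>lborel) powr (1/s))"
proof -
  have "(\<integral>\<^sup>+x. ennreal (\<bar>g x\<bar> powr s) \<partial>lborel) = ennreal (\<integral>x. \<bar>g x\<bar> powr s \<partial>lborel)"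
    using lp_le_integral[OF assms] by (intro nn_integral_eq_integral) auto
  then show ?thesis by (simp add: Lp_norm_def epowr_def)
qed

section \<open>Centred random translates\<close>

lemma nn_integral_lborel_translate:
  fixes x :: "'a::euclidean_space"
  assumes [measurable]: "h \<in> borel_measurable borel"
  shows "(\<integral>\<^sup>+t. h (t - x) \<partial>lborel) = (\<integral>\<^sup>+t. h t \<partial>lborel)"
proof -
  have "(\<integral>\<^sup>+t. h t \<partial>lborel) = (\<integral>\<^sup>+t. h t \<partial>distr lborel borel ((+) (- x)))"
    by (simp add: lborel_distr_plus)
  also have "\<dots> = (\<integral>\<^sup>+t. h (t - x) \<partial>lborel)"
    by (subst nn_integral_distr) simp_all
  finally show ?thesis by simp
qed

lemma nn_integral_lborel_reflect:
  fixes t :: "'a::euclidean_space"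
  assumes [measurable]: "h \<in> borel_measurable borel"
  shows "(\<integral>\<^sup>+x. h (t - x) \<partial>lborel) = (\<integral>\<^sup>+x. h x \<partial>lborel)"
proof -
  have d: "(lborel :: 'a measure) = density (distr lborel borel (\<lambda>x. t + (-1) *\<^sub>R x)) (\<lambda>_. ennreal (\<bar>-1::real\<bar> ^ DIM('a)))"
    by (rule lborel_affine) simp
  have "(\<integral>\<^sup>+x. h x \<partial>lborel) = (\<integral>\<^sup>+x. h (t - x) \<partial>lborel)"
    by (subst d) (simp add: nn_integral_density nn_integral_distr density_1)
  then show ?thesis by simp
qed

lemma lp_le_translate:
  fixes x :: "'a::euclidean_space"
  assumes "lp_le lborel s w B" shows "lp_le lborel s (\<lambda>t. w (t - x)) B"
proof -
  have [measurable]: "w \<in> borel_measurable borel" using assms by (simp add: lp_le_def)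
  show ?thesis
    using assms nn_integral_lborel_translate[of "\<lambda>t. ennreal (\<bar>w t\<bar> powr s)" x] by (auto simp: lp_le_def)
qed

lemma abs_le_one_plus_powr:
  assumes "(s::real) \<ge> 1" shows "\<bar>y\<bar> \<le> 1 + \<bar>y\<bar> powr s"
proof (cases "\<bar>y\<bar> \<le> 1")
  case True
  then show ?thesis using powr_ge_zero[of "\<bar>y\<bar>" s] by linarith
next
  case False
  then have "\<bar>y\<bar> powr 1 \<le> \<bar>y\<bar> powr s" using assms by (intro powr_mono) auto
  then show ?thesis using False by simp
qed

text \<open>Jensen's inequality without an integrability hypothesis: an infinite right-hand side
  makes it trivial, a finite one makes \<open>h\<close> integrable.\<close>

lemma (in prob_space) abs_expectation_powr_le:
  assumes s: "s \<ge> 1" and [measurable]: "h \<in> borel_measurable M"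
  shows "ennreal (\<bar>expectation h\<bar> powr s) \<le> (\<integral>\<^sup>+x. ennreal (\<bar>h x\<bar> powr s) \<partial>M)"
proof (cases "(\<integral>\<^sup>+x. ennreal (\<bar>h x\<bar> powr s) \<partial>M) = \<infinity>")
  case False
  then have i: "integrable M (\<lambda>x. \<bar>h x\<bar> powr s)"
    by (intro integrableI_bounded) (auto simp: less_top[symmetric])
  have b: "\<bar>y\<bar> \<le> 1 + \<bar>y\<bar> powr s" for y :: real
    using abs_le_one_plus_powr[OF s] .
  have ih: "integrable M h"
    by (rule Bochner_Integration.integrable_bound[of _ "\<lambda>x. 1 + \<bar>h x\<bar> powr s"]) (use i b in \<open>auto simp: abs_of_nonneg\<close>)
  have "\<bar>expectation h\<bar> powr s \<le> expectation (\<lambda>x. \<bar>h x\<bar> powr s)"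
  proof (rule jensens_inequality[of h UNIV _ _ "\<lambda>x. \<bar>x\<bar> powr s"])
    show "convex_on UNIV (\<lambda>x. \<bar>x\<bar> powr s)"
      by (intro convex_onI) (auto intro: abs_powr_convex[OF s])
  qed (use ih i in auto)
  then show ?thesis using i by (subst nn_integral_eq_integral) (auto intro: ennreal_leI)
qed auto

text \<open>The common law of the observations. Arguing with the law alone lets the recursion run on
  finite product measures; the random variables return only at the very end.\<close>

locale translation_law = prob_space \<nu> for \<nu> :: "'a::euclidean_space measure" +
  assumes sets_law [measurable_cong]: "sets \<nu> = sets borel"
begin

definition cmean :: "('a \<Rightarrow> real) \<Rightarrow> 'a \<Rightarrow> real" where
  "cmean w t = (\<integral>x. w (t - x) \<partial>\<nu>)"

definition ctr :: "('a \<Rightarrow> real) \<Rightarrow> 'a \<Rightarrow> 'a \<Rightarrow> real" where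
  "ctr w x t = w (t - x) - cmean w t"

lemma space_law [simp]: "space \<nu> = UNIV"
  using sets_eq_imp_space_eq[OF sets_law] by simp

lemma pair_sf: "pair_sigma_finite \<nu> (lborel :: 'a measure)"
  by (simp add: pair_sigma_finite_def lborel.sigma_finite_measure_axioms sigma_finite_measure_axioms)

lemma cmean_measurable [measurable]:
  assumes [measurable]: "w \<in> borel_measurable borel"
  shows "cmean w \<in> borel_measurable borel"
  unfolding cmean_def by measurable

lemma ctr_measurable [measurable]:
  assumes [measurable]: "w \<in> borel_measurable borel" "f \<in> borel_measurable N" "g \<in> borel_measurable N"
  shows "(\<lambda>z. ctr w (f z) (g z)) \<in> borel_measurable N"
  unfolding ctr_def by measurable

text \<open>Tonelli together with translation invariance of Lebesgue measure.\<close>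

lemma nn_integral_translates:
  assumes [measurable]: "h \<in> borel_measurable borel"
  shows "(\<integral>\<^sup>+t. \<integral>\<^sup>+x. h (t - x) \<partial>\<nu> \<partial>lborel) = (\<integral>\<^sup>+t. h t \<partial>lborel)"
proof -
  interpret pair_sigma_finite \<nu> "lborel :: 'a measure" by (rule pair_sf)
  have "(\<integral>\<^sup>+t. \<integral>\<^sup>+x. h (t - x) \<partial>\<nu> \<partial>lborel) = (\<integral>\<^sup>+x. \<integral>\<^sup>+t. h (t - x) \<partial>lborel \<partial>\<nu>)"
    by (rule Fubini') measurable
  also have "\<dots> = (\<integral>\<^sup>+t. h t \<partial>lborel)"
    by (simp add: nn_integral_lborel_translate emeasure_space_1[simplified])
  finally show ?thesis .
qed

text \<open>Averaging contracts the norm: Jensen for each t, then Tonelli. Points t at which the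
  translate is not integrable are covered too, since \<open>cmean\<close> has the default value 0
  there.\<close>

lemma lp_le_cmean:
  assumes s: "s \<ge> 1" and w: "lp_le lborel s w B"
  shows "lp_le lborel s (cmean w) B"
proof -
  have [measurable]: "w \<in> borel_measurable borel" using w by (simp add: lp_le_def)
  have "(\<integral>\<^sup>+t. ennreal (\<bar>cmean w t\<bar> powr s) \<partial>lborel) \<le> (\<integral>\<^sup>+t. \<integral>\<^sup>+x. ennreal (\<bar>w (t - x)\<bar> powr s) \<partial>\<nu> \<partial>lborel)"
    unfolding cmean_def by (intro nn_integral_mono abs_expectation_powr_le s) measurable
  also have "\<dots> = (\<integral>\<^sup>+t. ennreal (\<bar>w t\<bar> powr s) \<partial>lborel)" by (rule nn_integral_translates) measurable
  finally show ?thesis using w by (auto simp: lp_le_def)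
qed

text \<open>Needed for the linearity of \<open>cmean\<close> in the weight, which is available only
  at points where the translates are integrable.\<close>

lemma AE_integrable_translate:
  assumes s: "s \<ge> 1" and w: "lp_le lborel s w B"
  shows "AE t in lborel. integrable \<nu> (\<lambda>x. w (t - x))"
proof -
  have [measurable]: "w \<in> borel_measurable borel" using w by (simp add: lp_le_def)
  have "(\<integral>\<^sup>+t. \<integral>\<^sup>+x. ennreal (\<bar>w (t - x)\<bar> powr s) \<partial>\<nu> \<partial>lborel) \<noteq> \<infinity>"
    using w by (subst nn_integral_translates) (auto simp: lp_le_def top_unique)
  then have "AE t in lborel. (\<integral>\<^sup>+x. ennreal (\<bar>w (t - x)\<bar> powr s) \<partial>\<nu>) \<noteq> \<infinity>"
    by (intro nn_integral_PInf_AE) measurable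
  then show ?thesis
  proof eventually_elim
    case (elim t)
    then have i: "integrable \<nu> (\<lambda>x. \<bar>w (t - x)\<bar> powr s)"
      by (intro integrableI_bounded) (auto simp: less_top[symmetric])
    have b: "\<bar>y\<bar> \<le> 1 + \<bar>y\<bar> powr s" for y :: real
      using abs_le_one_plus_powr[OF s] .
    show ?case
      by (rule Bochner_Integration.integrable_bound[of _ "\<lambda>x. 1 + \<bar>w (t - x)\<bar> powr s"])
         (use i b in \<open>auto simp: abs_of_nonneg\<close>)
  qed
qed

lemma lp_le_ctr:
  assumes s: "s \<ge> 1" and w: "lp_le lborel s w B"
  shows "lp_le lborel s (ctr w x) (2 * B)"
  using lp_le_diff[OF s lp_le_translate[OF w, of x] lp_le_cmean[OF s w]] by (simp add: ctr_def[abs_def])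

text \<open>The weight \<open>k\<close> plays the role of the dual element of \<open>g\<close> in the pairing with \<open>L\<^sub>s\<close>.\<close>

context
  fixes s B R :: real and w g k :: "'a \<Rightarrow> real"
  assumes s: "s \<ge> 1" and w: "lp_le lborel s w B" and B: "B > 0"
    and g: "lp_le lborel s g R" and R: "R > 0"
    and k: "k \<in> borel_measurable borel" "\<And>t. \<bar>k t\<bar> \<le> \<bar>g t\<bar> powr (s - 1)"
begin

lemma pairing_measurable: "(\<lambda>x. \<integral>t. k t * ctr w x t \<partial>lborel) \<in> borel_measurable borel"
proof -
  have [measurable]: "w \<in> borel_measurable borel" "k \<in> borel_measurable borel"
    using w k by (auto simp: lp_le_def)
  show ?thesis by measurable
qed

lemma pairing_bound: "\<bar>\<integral>t. k t * ctr w x t \<partial>lborel\<bar> \<le> R powr (s - 1) * (2 * B)"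
  by (rule holder_integral(2)[OF s g lp_le_ctr[OF s w]]) (use R B k in auto)

lemma pairing_translate_integrable_pair:
  "integrable (\<nu> \<Otimes>\<^sub>M lborel) (\<lambda>(x, t). k t * w (t - x))"
proof -
  interpret pair_sigma_finite \<nu> "lborel :: 'a measure" by (rule pair_sf)
  have [measurable]: "w \<in> borel_measurable borel" "k \<in> borel_measurable borel"
    using w k by (auto simp: lp_le_def)
  have h: "integrable lborel (\<lambda>t. k t * w (t - x))" "(\<integral>t. \<bar>k t * w (t - x)\<bar> \<partial>lborel) \<le> R powr (s - 1) * B" for x
    using holder_integral[OF s g lp_le_translate[OF w, of x] R B, of k] k by auto
  show ?thesis
  proof (rule Fubini_integrable)
    show "integrable \<nu> (\<lambda>x. \<integral>t. norm (case (x, t) of (x, t) \<Rightarrow> k t * w (t - x)) \<partial>lborel)"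
      by (rule integrable_const_bound[of _ "R powr (s - 1) * B"])
         (use h in \<open>auto simp: abs_of_nonneg intro!: AE_I2\<close>)
  qed (use h in auto)
qed

lemma pairing_eq:
  "(\<integral>t. k t * ctr w x t \<partial>lborel) = (\<integral>t. k t * w (t - x) \<partial>lborel) - (\<integral>t. k t * cmean w t \<partial>lborel)"
  using holder_integral(1)[OF s g lp_le_translate[OF w, of x] R B, of k] k
    holder_integral(1)[OF s g lp_le_cmean[OF s w] R B, of k]
  by (simp add: ctr_def right_diff_distrib)

text \<open>Fubini moves the average over the law inside the pairing. This is what makes the pairing
  with the centred translate a martingale difference.\<close>

lemma pairing_translate_mean:
  "integrable \<nu> (\<lambda>x. \<integral>t. k t * w (t - x) \<partial>lborel)"
  "(\<integral>x. (\<integral>t. k t * w (t - x) \<partial>lborel) \<partial>\<nu>) = (\<integral>t. k t * cmean w t \<partial>lborel)"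
proof -
  interpret pair_sigma_finite \<nu> "lborel :: 'a measure" by (rule pair_sf)
  note i = pairing_translate_integrable_pair
  show "integrable \<nu> (\<lambda>x. \<integral>t. k t * w (t - x) \<partial>lborel)"
    using integrable_fst[OF i] by simp
  have "(\<integral>t. k t * cmean w t \<partial>lborel) = (\<integral>t. (\<integral>x. k t * w (t - x) \<partial>\<nu>) \<partial>lborel)"
    by (simp add: cmean_def)
  also have "\<dots> = (\<integral>x. (\<integral>t. k t * w (t - x) \<partial>lborel) \<partial>\<nu>)"
    by (rule Fubini_integral[OF i])
  finally show "(\<integral>x. (\<integral>t. k t * w (t - x) \<partial>lborel) \<partial>\<nu>) = (\<integral>t. k t * cmean w t \<partial>lborel)" by simp
qed

lemma pairing_mean_zero: "(\<integral>x. (\<integral>t. k t * ctr w x t \<partial>lborel) \<partial>\<nu>) = 0"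
  using pairing_translate_mean by (simp add: pairing_eq prob_space[simplified])

end

text \<open>The variance is at most the second moment of P. Splitting |w| into two square roots,
  Cauchy-Schwarz bounds P(x)^2 by the \<open>L\<^sub>1\<close> norm of w times the integral of
  g(t)^2 |w(t - x)| over t. Replacing the density by F and integrating over x produces the
  \<open>L\<^sub>1\<close> norm of w a second time, and Cauchy-Schwarz on the set where w is nonzero
  bounds its square by m B^2.\<close>

lemma pairing_second_moment:
  assumes w: "lp_le lborel 2 w B" and B: "B > 0" and g: "lp_le lborel 2 g R" and R: "R > 0"
    and f: "f \<in> borel_measurable borel" "\<And>x. 0 \<le> f x" "\<And>x. f x \<le> F" and nu: "\<nu> = density lborel (\<lambda>x. ennreal (f x))"
    and supp: "emeasure lborel {t. w t \<noteq> 0} \<le> ennreal m" and m: "m \<ge> 0"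
  shows "(\<integral>x. (\<integral>t. g t * ctr w x t \<partial>lborel)\<^sup>2 \<partial>\<nu>) \<le> F * m * B\<^sup>2 * R\<^sup>2"
proof -
  have [measurable]: "w \<in> borel_measurable borel" "g \<in> borel_measurable borel" "f \<in> borel_measurable borel"
    using w g f by (auto simp: lp_le_def)
  have F: "F \<ge> 0" using f(2,3)[of undefined] by linarith
  have s2: "(1::real) \<le> 2" by simp
  have gk: "\<bar>g t\<bar> \<le> \<bar>g t\<bar> powr (2 - 1)" for t by simp
  define P where "P = (\<lambda>x. \<integral>t. g t * w (t - x) \<partial>lborel)"
  note mean = pairing_translate_mean[OF s2 w B g R _ gk, folded P_def]
  have Pb: "\<bar>P x\<bar> \<le> R * B" for x
    using holder_integral(2)[OF s2 g lp_le_translate[OF w, of x] R B _ gk] R by (simp add: P_def)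
  have [measurable]: "P \<in> borel_measurable borel" unfolding P_def by measurable
  have iP2: "integrable \<nu> (\<lambda>x. (P x)\<^sup>2)"
    by (rule integrable_const_bound[of _ "(R * B)\<^sup>2"]) (use Pb B R in \<open>auto simp: abs_le_square_iff[symmetric] intro!: AE_I2\<close>)
  have iP: "integrable \<nu> P" using mean(1) by simp
  have "(\<integral>t. g t * ctr w x t \<partial>lborel) = P x - expectation P" for x
    using pairing_eq[OF s2 w B g R _ gk, of x] mean(2) by (simp add: P_def)
  then have "(\<integral>x. (\<integral>t. g t * ctr w x t \<partial>lborel)\<^sup>2 \<partial>\<nu>) = variance P" by simp
  also have "\<dots> \<le> expectation (\<lambda>x. (P x)\<^sup>2)"
    using iP iP2 by (subst variance_eq) auto
  finally have var: "(\<integral>x. (\<integral>t. g t * ctr w x t \<partial>lborel)\<^sup>2 \<partial>\<nu>) \<le> expectation (\<lambda>x. (P x)\<^sup>2)" .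
  have "ennreal (expectation (\<lambda>x. (P x)\<^sup>2)) \<le> ennreal (F * m * B\<^sup>2 * R\<^sup>2)"
  proof -
    define W1 where "W1 = (\<integral>\<^sup>+t. ennreal \<bar>w t\<bar> \<partial>lborel)"
    have W1: "W1\<^sup>2 \<le> ennreal (B\<^sup>2) * ennreal m"
    proof -
      have "W1 = (\<integral>\<^sup>+t. ennreal \<bar>w t\<bar> * indicator {t. w t \<noteq> 0} t \<partial>lborel)"
        unfolding W1_def by (intro nn_integral_cong) (auto split: split_indicator)
      then have "W1\<^sup>2 \<le> (\<integral>\<^sup>+t. (ennreal \<bar>w t\<bar>)\<^sup>2 \<partial>lborel) * (\<integral>\<^sup>+t. (indicator {t. w t \<noteq> 0} t)\<^sup>2 \<partial>lborel)"
        by (simp only:) (rule Cauchy_Schwarz_nn_integral; measurable)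
      also have "(\<integral>\<^sup>+t. (ennreal \<bar>w t\<bar>)\<^sup>2 \<partial>lborel) \<le> ennreal (B\<^sup>2)"
        using w B by (simp add: lp_le_def ennreal_power)
      also have "(\<integral>\<^sup>+t. (indicator {t. w t \<noteq> 0} t)\<^sup>2 \<partial>lborel) = (\<integral>\<^sup>+t. indicator {t. w t \<noteq> 0} t \<partial>lborel)"
        by (intro nn_integral_cong) (auto split: split_indicator)
      also have "\<dots> \<le> ennreal m" using supp by simp
      finally show ?thesis by (simp add: mult_right_mono mult_left_mono)
    qed
    have pw: "ennreal ((P x)\<^sup>2) \<le> (\<integral>\<^sup>+t. (ennreal \<bar>g t\<bar>)\<^sup>2 * ennreal \<bar>w (t - x)\<bar> \<partial>lborel) * W1" for x
    proof -
      have "ennreal \<bar>P x\<bar> \<le> (\<integral>\<^sup>+t. ennreal \<bar>g t * w (t - x)\<bar> \<partial>lborel)"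
        unfolding P_def using integral_norm_bound_ennreal[of lborel "\<lambda>t. g t * w (t - x)"]
          holder_integral(1)[OF s2 g lp_le_translate[OF w, of x] R B _ gk] by simp
      also have "\<dots> = (\<integral>\<^sup>+t. (ennreal \<bar>g t\<bar> * ennreal (sqrt \<bar>w (t - x)\<bar>)) * ennreal (sqrt \<bar>w (t - x)\<bar>) \<partial>lborel)"
        by (intro nn_integral_cong) (simp add: ennreal_mult[symmetric] abs_mult mult.assoc)
      finally have "(ennreal \<bar>P x\<bar>)\<^sup>2 \<le> (\<integral>\<^sup>+t. (ennreal \<bar>g t\<bar> * ennreal (sqrt \<bar>w (t - x)\<bar>)) * ennreal (sqrt \<bar>w (t - x)\<bar>) \<partial>lborel)\<^sup>2"
        by (intro power_mono) auto
      also have "\<dots> \<le> (\<integral>\<^sup>+t. (ennreal \<bar>g t\<bar> * ennreal (sqrt \<bar>w (t - x)\<bar>))\<^sup>2 \<partial>lborel) * (\<integral>\<^sup>+t. (ennreal (sqrt \<bar>w (t - x)\<bar>))\<^sup>2 \<partial>lborel)"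
        by (rule Cauchy_Schwarz_nn_integral) measurable
      also have "(\<integral>\<^sup>+t. (ennreal (sqrt \<bar>w (t - x)\<bar>))\<^sup>2 \<partial>lborel) = W1"
        using nn_integral_lborel_translate[of "\<lambda>t. ennreal \<bar>w t\<bar>" x] by (simp add: ennreal_power W1_def)
      also have "(\<integral>\<^sup>+t. (ennreal \<bar>g t\<bar> * ennreal (sqrt \<bar>w (t - x)\<bar>))\<^sup>2 \<partial>lborel) = (\<integral>\<^sup>+t. (ennreal \<bar>g t\<bar>)\<^sup>2 * ennreal \<bar>w (t - x)\<bar> \<partial>lborel)"
        by (intro nn_integral_cong) (simp add: power_mult_distrib ennreal_power)
      finally show ?thesis by (simp add: ennreal_power)
    qed
    have "ennreal (expectation (\<lambda>x. (P x)\<^sup>2)) = (\<integral>\<^sup>+x. ennreal ((P x)\<^sup>2) \<partial>\<nu>)"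
      using iP2 by (subst nn_integral_eq_integral) auto
    also have "\<dots> = (\<integral>\<^sup>+x. ennreal (f x) * ennreal ((P x)\<^sup>2) \<partial>lborel)"
      unfolding nu by (subst nn_integral_density) auto
    also have "\<dots> \<le> (\<integral>\<^sup>+x. ennreal F * ((\<integral>\<^sup>+t. (ennreal \<bar>g t\<bar>)\<^sup>2 * ennreal \<bar>w (t - x)\<bar> \<partial>lborel) * W1) \<partial>lborel)"
      using f by (intro nn_integral_mono mult_mono pw ennreal_leI) auto
    also have "\<dots> = ennreal F * ((\<integral>\<^sup>+x. (\<integral>\<^sup>+t. (ennreal \<bar>g t\<bar>)\<^sup>2 * ennreal \<bar>w (t - x)\<bar> \<partial>lborel) \<partial>lborel) * W1)"
      by (simp add: nn_integral_cmult nn_integral_multc)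
    also have "(\<integral>\<^sup>+x. (\<integral>\<^sup>+t. (ennreal \<bar>g t\<bar>)\<^sup>2 * ennreal \<bar>w (t - x)\<bar> \<partial>lborel) \<partial>lborel)
        = (\<integral>\<^sup>+t. (\<integral>\<^sup>+x. (ennreal \<bar>g t\<bar>)\<^sup>2 * ennreal \<bar>w (t - x)\<bar> \<partial>lborel) \<partial>lborel)"
      by (rule lborel_pair.Fubini') measurable
    also have "\<dots> = (\<integral>\<^sup>+t. (ennreal \<bar>g t\<bar>)\<^sup>2 * W1 \<partial>lborel)"
      using nn_integral_lborel_reflect[of "\<lambda>t. ennreal \<bar>w t\<bar>"] by (simp add: nn_integral_cmult W1_def)
    also have "\<dots> = (\<integral>\<^sup>+t. (ennreal \<bar>g t\<bar>)\<^sup>2 \<partial>lborel) * W1" by (simp add: nn_integral_multc)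
    also have "ennreal F * ((\<integral>\<^sup>+t. (ennreal \<bar>g t\<bar>)\<^sup>2 \<partial>lborel) * W1 * W1) = ennreal F * ((\<integral>\<^sup>+t. (ennreal \<bar>g t\<bar>)\<^sup>2 \<partial>lborel) * W1\<^sup>2)"
      by (simp add: power2_eq_square mult.assoc)
    also have "\<dots> \<le> ennreal F * (ennreal (R\<^sup>2) * (ennreal (B\<^sup>2) * ennreal m))"
      using g R by (intro mult_left_mono mult_mono W1) (auto simp: lp_le_def ennreal_power)
    also have "\<dots> = ennreal (F * m * B\<^sup>2 * R\<^sup>2)"
      using F m by (simp add: ennreal_mult[symmetric] mult_ac)
    finally show ?thesis .
  qed
  then have "expectation (\<lambda>x. (P x)\<^sup>2) \<le> F * m * B\<^sup>2 * R\<^sup>2" using F m by (simp add: ennreal_le_iff)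
  with var show ?thesis by linarith
qed

end

section \<open>Exponential moments by a supermartingale-type recursion\<close>

text \<open>Expansion around a: the linear coefficient is the derivative of the s-th power of |a|,
  the remainder is of order |b|^s. By homogeneity it suffices to treat a = 1, which is
  \<open>unit\<close>.\<close>

lemma abs_add_powr_le:
  fixes a b s :: real
  assumes s: "1 \<le> s" "s \<le> 2"
  shows "\<bar>a + b\<bar> powr s \<le> \<bar>a\<bar> powr s + s * (sgn a * \<bar>a\<bar> powr (s - 1)) * b + 2 * \<bar>b\<bar> powr s"
proof -
  \<comment> \<open>Weighted arithmetic-geometric mean inequality for 1 + x and 1 with weights s - 1
    and 2 - s.\<close>
  have conc: "(1 + x) powr (s - 1) \<le> 1 + (s - 1) * x" if "x \<ge> -1" for x
    using Youngs_inequality_0[of "s - 1" "2 - s" "1 + x" 1] s that by (cases "x = -1") (auto simp: algebra_simps)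
  have unit: "\<bar>1 + x\<bar> powr s \<le> 1 + s * x + 2 * \<bar>x\<bar> powr s" for x
  proof -
    consider "\<bar>x\<bar> \<le> 1" | "x > 1" | "x < -1" by linarith
    then show ?thesis
    proof cases
      case 1
      have "\<bar>1 + x\<bar> powr s = (1 + x) * (1 + x) powr (s - 1)"
        using 1 s by (cases "x = -1") (auto simp: powr_mult_base)
      also have "\<dots> \<le> (1 + x) * (1 + (s - 1) * x)" using 1 by (intro mult_left_mono conc) auto
      also have "\<dots> = 1 + s * x + (s - 1) * \<bar>x\<bar>\<^sup>2" by (simp add: algebra_simps power2_eq_square)
      also have "(s - 1) * \<bar>x\<bar>\<^sup>2 \<le> 1 * \<bar>x\<bar> powr s"
      proof (rule mult_mono)
        show "\<bar>x\<bar>\<^sup>2 \<le> \<bar>x\<bar> powr s"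
          using powr_mono'[of s 2 "\<bar>x\<bar>"] 1 s by (cases "x = 0") (auto simp: powr_numeral)
      qed (use s in auto)
      finally show ?thesis using powr_ge_zero[of "\<bar>x\<bar>" s] by linarith
    next
      case 2
      \<comment> \<open>Factoring out x leaves \<open>1 + 1/x\<close> under the concave power, which
        costs at most the factor 1 + 1/x.\<close>
      have "\<bar>1 + x\<bar> powr s = (1 + x) * (x * (1 + 1/x)) powr (s - 1)"
        using 2 s powr_mult_base[of "1+x" "s-1"] by (simp add: distrib_left add.commute)
      also have "(x * (1 + 1/x)) powr (s - 1) = x powr (s-1) * (1 + 1/x) powr (s-1)"
        using 2 by (subst powr_mult) auto
      also have "(1 + 1/x) powr (s-1) \<le> 1 + (s-1) * (1/x)" using 2 by (intro conc) (auto intro: order_trans[of _ 0])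
      also have "1 + (s-1) * (1/x) \<le> 1 + 1 / x" using 2 s by (auto simp: divide_simps)
      finally have "\<bar>1 + x\<bar> powr s \<le> (1 + x) * (x powr (s-1) * (1 + 1 / x))" using 2 by (simp add: mult_left_mono)
      also have "\<dots> = x * x powr (s-1) + 2 * x powr (s-1) + x powr (s-1) / x"
        using 2 by (simp add: field_simps)
      also have "x * x powr (s-1) = x powr s" using 2 by (simp add: powr_mult_base)
      also have "x powr (s-1) / x \<le> 1"
        using powr_mono[of "s-1" 1 x] 2 s by simp
      also have "2 * x powr (s-1) \<le> x + x powr s"
      proof -
        have "x powr (s-1) \<le> x powr 1" "x powr (s-1) \<le> x powr s" using 2 s by (intro powr_mono; simp)+
        moreover have "x powr 1 = x" using 2 by simp
        ultimately show ?thesis by linarith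
      qed
      finally have "\<bar>1 + x\<bar> powr s \<le> x powr s + (x + x powr s) + 1" by linarith
      moreover have "x \<le> s * x" using 2 s by simp
      moreover have "\<bar>x\<bar> = x" using 2 by simp
      ultimately show ?thesis by simp
    next
      case 3
      define y where "y = - x"
      have y: "y > 1" using 3 by (simp add: y_def)
      have "\<bar>1 + x\<bar> powr s = (y - 1) * (y - 1) powr (s - 1)"
      proof -
        have "\<bar>1 + x\<bar> = y - 1" using y by (simp add: y_def)
        then show ?thesis using y by (simp add: powr_mult_base)
      qed
      also have "\<dots> \<le> (y - 1) * y powr (s - 1)"
        using y s by (intro mult_left_mono powr_mono2) auto
      also have "\<dots> = y powr s - y powr (s-1)"
        using y powr_mult_base[of y "s-1"] by (simp add: left_diff_distrib)
      also have "\<dots> \<le> y powr s" by simp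
      \<comment> \<open>Young's inequality at 1 and y; the leftover s - 1 is at most 1.\<close>
      also have "s * y \<le> s - 1 + y powr s"
        using mult_left_mono[OF young_powr[of s 1 y], of s] s y by (simp add: distrib_left)
      then have "y powr s \<le> 1 - s * y + 2 * y powr s" using s by linarith
      finally show ?thesis using 3 by (simp add: y_def)
    qed
  qed
  consider "a = 0" | "a \<noteq> 0" by blast
  then show ?thesis
  proof cases
    case 1 then show ?thesis using s by simp
  next
    case 2
    have "\<bar>a + b\<bar> powr s = \<bar>a\<bar> powr s * \<bar>1 + b / a\<bar> powr s"
      using 2 by (simp add: powr_mult[symmetric] abs_mult[symmetric] distrib_left)
    also have "\<dots> \<le> \<bar>a\<bar> powr s * (1 + s * (b/a) + 2 * \<bar>b/a\<bar> powr s)"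
      by (intro mult_left_mono unit) auto
    also have "\<dots> = \<bar>a\<bar> powr s + s * (\<bar>a\<bar> powr s / a) * b + 2 * \<bar>b\<bar> powr s"
      using 2 by (simp add: powr_divide distrib_left)
    also have "\<bar>a\<bar> powr s / a = sgn a * \<bar>a\<bar> powr (s - 1)"
      using 2 powr_mult_base[of "\<bar>a\<bar>" "s-1"] by (auto simp: sgn_if field_simps abs_if)
    finally show ?thesis .
  qed
qed

text \<open>The tangent to the concave s-th root at \<open>R powr s\<close>, obtained from Young's
  inequality for R and the root y itself.\<close>

lemma powr_root_add_le:
  assumes s: "(s::real) \<ge> 1" and R: "R > 0" and h: "R powr s + h \<ge> 0"
  shows "(R powr s + h) powr (1 / s) \<le> R + h / (s * R powr (s - 1))"
proof -
  define y where "y = (R powr s + h) powr (1 / s)"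
  have ys: "y powr s = R powr s + h" using s h by (simp add: y_def powr_powr)
  have "R powr (s - 1) * y \<le> (s - 1) / s * R powr s + 1 / s * (R powr s + h)"
    using young_powr[of s R y] s R by (simp add: ys) (simp add: y_def)
  also have "\<dots> = R powr s + h / s" using s by (simp add: field_simps)
  also have "R powr s = R powr (s - 1) * R" using R powr_mult_base[of R "s-1"] by (simp add: mult.commute)
  finally have "R powr (s - 1) * y \<le> R powr (s - 1) * (R + h / (s * R powr (s - 1)))"
    using R by (simp add: distrib_left)
  then show ?thesis using R by (simp add: y_def)
qed

text \<open>Bernstein's remainder: (k + 2)! is at least 2 * 3^k, so the exponential series from the
  second order on is dominated by a geometric series of ratio u / 3.\<close>

lemma exp_le_quadratic:
  fixes x u :: real
  assumes x: "\<bar>x\<bar> \<le> u" and u: "u < 3"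
  shows "exp x \<le> 1 + x + x\<^sup>2 / (2 * (1 - u / 3))"
proof -
  have u0: "u \<ge> 0" using x by linarith
  have fact_ge: "2 * 3 ^ k \<le> (fact (k + 2) :: real)" for k
  proof (induction k)
    case (Suc k)
    have "2 * 3 ^ Suc k = 3 * (2 * 3 ^ k :: real)" by simp
    also have "\<dots> \<le> real (k + 3) * fact (k + 2)" using Suc by (intro mult_mono) auto
    finally show ?case by (simp add: algebra_simps)
  qed (simp add: fact_numeral)
  have sm: "summable (\<lambda>k. x ^ k / fact k)" using summable_exp[of x] by (simp add: divide_inverse mult.commute)
  have "exp x = (\<Sum>k. x ^ k / fact k)" by (simp add: exp_def divide_inverse mult.commute)
  also have "\<dots> = (\<Sum>k. x ^ (k + 2) / fact (k + 2)) + (\<Sum>k<2. x ^ k / fact k)"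
    by (rule suminf_split_initial_segment[OF sm])
  also have "(\<Sum>k<2. x ^ k / fact k) = 1 + x" by (simp add: numeral_2_eq_2)
  also have "(\<Sum>k. x ^ (k + 2) / fact (k + 2)) \<le> (\<Sum>k. x\<^sup>2 / 2 * (u / 3) ^ k)"
  proof (rule suminf_le)
    show "x ^ (k + 2) / fact (k + 2) \<le> x\<^sup>2 / 2 * (u / 3) ^ k" for k
    proof -
      have "x ^ (k + 2) / fact (k + 2) \<le> \<bar>x ^ (k + 2)\<bar> / fact (k + 2)" by (intro divide_right_mono) auto
      also have "\<dots> = x\<^sup>2 * \<bar>x\<bar> ^ k / fact (k + 2)" by (simp add: power_add abs_mult power_abs mult.commute power2_eq_square)
      also have "\<dots> \<le> x\<^sup>2 * u ^ k / (2 * 3 ^ k)"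
        using x u0 by (intro frac_le mult_left_mono power_mono fact_ge) auto
      finally show ?thesis by (simp add: power_divide)
    qed
    show "summable (\<lambda>k. x ^ (k + 2) / fact (k + 2))" using sm by (subst summable_iff_shift)
    show "summable (\<lambda>k. x\<^sup>2 / 2 * (u / 3) ^ k)" using u u0 by (intro summable_mult summable_geometric) auto
  qed
  also have "(\<Sum>k. x\<^sup>2 / 2 * (u / 3) ^ k) = x\<^sup>2 / 2 * (1 / (1 - u / 3))"
    using u u0 by (subst suminf_mult) (auto intro: summable_geometric simp: suminf_geometric)
  finally show ?thesis by simp
qed

section \<open>Exponential moments of one centred bounded variable\<close>

context prob_space
begin

lemma mgf_hoeffding:
  assumes [measurable]: "D \<in> borel_measurable M" and D: "\<And>x. \<bar>D x\<bar> \<le> c" and "expectation D = 0" and "l > 0"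
  shows "(\<integral>\<^sup>+x. ennreal (exp (l * D x)) \<partial>M) \<le> ennreal (exp (l\<^sup>2 * c\<^sup>2 / 2))"
proof -
  have "D x \<in> {-c..c}" for x using D[of x] by auto
  then interpret interval_bounded_random_variable M D "-c" c
    by unfold_locales auto
  \<comment> \<open>Hoeffding's lemma has the squared length of the range divided by 8, and the
    range here has length 2c.\<close>
  have eq: "l\<^sup>2 * (c - (- c))\<^sup>2 / 8 = l\<^sup>2 * c\<^sup>2 / 2" by (simp add: power2_eq_square)
  show ?thesis using Hoeffdings_lemma_nn_integral_0[OF \<open>l > 0\<close> \<open>expectation D = 0\<close>] unfolding eq .
qed

lemma mgf_bernstein:
  assumes [measurable]: "D \<in> borel_measurable M" and D: "\<And>x. \<bar>D x\<bar> \<le> c" and E: "expectation D = 0"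
    and v: "expectation (\<lambda>x. (D x)\<^sup>2) \<le> v" and l: "l > 0" "l * c < 3"
  shows "(\<integral>\<^sup>+x. ennreal (exp (l * D x)) \<partial>M) \<le> ennreal (exp (l\<^sup>2 * v / (2 * (1 - l * c / 3))))"
proof -
  define a where "a = 1 / (2 * (1 - l * c / 3))"
  have a: "a > 0" using l by (simp add: a_def mult.commute)
  have c: "c \<ge> 0" using D[of undefined] by linarith
  have iD: "integrable M D" by (rule integrable_const_bound[of _ c]) (use D in auto)
  have iD2: "integrable M (\<lambda>x. (D x)\<^sup>2)"
    by (rule integrable_const_bound[of _ "c\<^sup>2"]) (use D c in \<open>auto simp: abs_le_square_iff[symmetric]\<close>)
  have pw: "exp (l * D x) \<le> 1 + l * D x + a * l\<^sup>2 * (D x)\<^sup>2" for x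
    using exp_le_quadratic[of "l * D x" "l * c"] l D[of x] by (auto simp: a_def abs_mult power_mult_distrib)
  have i: "integrable M (\<lambda>x. 1 + l * D x + a * l\<^sup>2 * (D x)\<^sup>2)" using iD iD2 by simp
  have "(\<integral>\<^sup>+x. ennreal (exp (l * D x)) \<partial>M) \<le> (\<integral>\<^sup>+x. ennreal (1 + l * D x + a * l\<^sup>2 * (D x)\<^sup>2) \<partial>M)"
    by (intro nn_integral_mono ennreal_leI pw)
  also have "\<dots> = ennreal (expectation (\<lambda>x. 1 + l * D x + a * l\<^sup>2 * (D x)\<^sup>2))"
    using order_trans[OF exp_ge_zero pw] by (intro nn_integral_eq_integral i AE_I2)
  also have "\<dots> \<le> ennreal (exp (a * l\<^sup>2 * v))"
  proof (rule ennreal_leI)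
    have "expectation (\<lambda>x. 1 + l * D x + a * l\<^sup>2 * (D x)\<^sup>2) = 1 + a * l\<^sup>2 * expectation (\<lambda>x. (D x)\<^sup>2)"
      using iD iD2 E by (simp add: prob_space)
    also have "\<dots> \<le> 1 + a * l\<^sup>2 * v" using a v by (intro add_left_mono mult_left_mono) auto
    also have "\<dots> \<le> exp (a * l\<^sup>2 * v)" by (rule exp_ge_add_one_self)
    finally show "expectation (\<lambda>x. 1 + l * D x + a * l\<^sup>2 * (D x)\<^sup>2) \<le> exp (a * l\<^sup>2 * v)" .
  qed
  finally show ?thesis by (simp add: a_def)
qed

end

section \<open>Recursion over the observations\<close>

context translation_law
begin

definition sum_ctr :: "('a \<Rightarrow> real) \<Rightarrow> nat set \<Rightarrow> (nat \<Rightarrow> 'a) \<Rightarrow> 'a \<Rightarrow> real" where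
  "sum_ctr w I x t = (\<Sum>i\<in>I. ctr w (x i) t)"

lemma lp_le_sum_ctr:
  assumes "s \<ge> 1" "lp_le lborel s w B" "finite I"
  shows "lp_le lborel s (sum_ctr w I x) (real (card I) * (2 * B))"
  using lp_le_sum[OF assms(1,3), of lborel "\<lambda>i. ctr w (x i)" "\<lambda>_. 2 * B"] lp_le_ctr[OF assms(1,2)]
  by (simp add: sum_ctr_def[abs_def])

text \<open>Here \<open>r\<close> is the reserve for observations still to come. One observation
  spends K of it: the s-th power of the norm grows by at most K plus a term linear in the new
  centred translate, and the tangent to the root turns this into R plus that term divided by
  \<open>R powr (s - 1)\<close>. Since R is fixed before the new observation, the factor C accounts
  for all of the randomness.\<close>

lemma exp_step:
  assumes s: "s \<ge> 1" and w: "lp_le lborel s w B" and B: "B > 0"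
    and S: "lp_le lborel s S A" and r: "r \<ge> 0" and K: "K > 0"
    and R_def: "R = ((\<integral>t. \<bar>S t\<bar> powr s \<partial>lborel) + r + K) powr (1 / s)"
    and g: "lp_le lborel s g R'" and R': "R' > 0"
    and k: "k \<in> borel_measurable borel" "\<And>t. \<bar>k t\<bar> \<le> \<bar>g t\<bar> powr (s - 1)"
    and expand: "\<And>x. (\<integral>t. \<bar>S t + ctr w x t\<bar> powr s \<partial>lborel)
        \<le> (\<integral>t. \<bar>S t\<bar> powr s \<partial>lborel) + K + s * (\<integral>t. k t * ctr w x t \<partial>lborel)"
    and l: "l > 0"
    and mgf: "(\<integral>\<^sup>+x. ennreal (exp (l * ((\<integral>t. k t * ctr w x t \<partial>lborel) / R powr (s - 1)))) \<partial>\<nu>) \<le> C"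
  shows "(\<integral>\<^sup>+x. ennreal (exp (l * ((\<integral>t. \<bar>S t + ctr w x t\<bar> powr s \<partial>lborel) + r) powr (1 / s))) \<partial>\<nu>)
    \<le> C * ennreal (exp (l * ((\<integral>t. \<bar>S t\<bar> powr s \<partial>lborel) + (r + K)) powr (1 / s)))"
proof -
  define a where "a = (\<integral>t. \<bar>S t\<bar> powr s \<partial>lborel)"
  define D where "D x = (\<integral>t. k t * ctr w x t \<partial>lborel)" for x
  have [measurable]: "w \<in> borel_measurable borel" "k \<in> borel_measurable borel"
    using w k by (auto simp: lp_le_def)
  have a: "a \<ge> 0" by (simp add: a_def)
  have arK: "a + r + K > 0" using a r K by simp
  then have R: "R > 0" by (simp add: R_def a_def)
  have Rs: "R powr s = a + r + K" using arK s by (simp add: R_def a_def[symmetric] powr_powr)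
  have pw: "((\<integral>t. \<bar>S t + ctr w x t\<bar> powr s \<partial>lborel) + r) powr (1 / s) \<le> R + D x / R powr (s - 1)" for x
  proof -
    have le: "(\<integral>t. \<bar>S t + ctr w x t\<bar> powr s \<partial>lborel) + r \<le> R powr s + s * D x"
      using expand[of x] Rs by (simp add: a_def D_def)
    have nn: "0 \<le> (\<integral>t. \<bar>S t + ctr w x t\<bar> powr s \<partial>lborel) + r" using r by simp
    have "((\<integral>t. \<bar>S t + ctr w x t\<bar> powr s \<partial>lborel) + r) powr (1 / s) \<le> (R powr s + s * D x) powr (1 / s)"
      using le nn s by (intro powr_mono2) auto
    also have "\<dots> \<le> R + (s * D x) / (s * R powr (s - 1))"
      using le nn by (intro powr_root_add_le s R) linarith
    also have "(s * D x) / (s * R powr (s - 1)) = D x / R powr (s - 1)" using s by simp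
    finally show ?thesis .
  qed
  have "(\<integral>\<^sup>+x. ennreal (exp (l * ((\<integral>t. \<bar>S t + ctr w x t\<bar> powr s \<partial>lborel) + r) powr (1 / s))) \<partial>\<nu>)
     \<le> (\<integral>\<^sup>+x. ennreal (exp (l * (D x / R powr (s - 1)))) * ennreal (exp (l * R)) \<partial>\<nu>)"
  proof (intro nn_integral_mono)
    fix x
    have "l * ((\<integral>t. \<bar>S t + ctr w x t\<bar> powr s \<partial>lborel) + r) powr (1 / s) \<le> l * (R + D x / R powr (s - 1))"
      using pw l by (intro mult_left_mono) auto
    then show "ennreal (exp (l * ((\<integral>t. \<bar>S t + ctr w x t\<bar> powr s \<partial>lborel) + r) powr (1 / s)))
      \<le> ennreal (exp (l * (D x / R powr (s - 1)))) * ennreal (exp (l * R))"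
      by (simp add: ennreal_mult[symmetric] exp_add[symmetric] distrib_left add.commute)
  qed
  also have "\<dots> = (\<integral>\<^sup>+x. ennreal (exp (l * (D x / R powr (s - 1)))) \<partial>\<nu>) * ennreal (exp (l * R))"
    unfolding D_def by (rule nn_integral_multc) measurable
  also have "\<dots> \<le> C * ennreal (exp (l * R))" using mgf by (intro mult_right_mono) (auto simp: D_def)
  finally show ?thesis by (simp add: R_def add.assoc)
qed

text \<open>The induction generalises \<open>r\<close> because every observation integrated out
  becomes a further K in the reserve. The inserted variable is integrated first with the others
  frozen, so \<open>step\<close> applies with S the sum over the others.\<close>

lemma exp_moment_recursion:
  fixes s K l r :: real
  assumes s: "s \<ge> 1" and w: "lp_le lborel s w B" and K: "K \<ge> 0"
    and step: "\<And>S A r. lp_le lborel s S A \<Longrightarrow> r \<ge> 0 \<Longrightarrow>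
      (\<integral>\<^sup>+x. ennreal (exp (l * ((\<integral>t. \<bar>S t + ctr w x t\<bar> powr s \<partial>lborel) + r) powr (1 / s))) \<partial>\<nu>)
      \<le> C * ennreal (exp (l * ((\<integral>t. \<bar>S t\<bar> powr s \<partial>lborel) + (r + K)) powr (1 / s)))"
    and "finite I" and "r \<ge> 0"
  shows "(\<integral>\<^sup>+x. ennreal (exp (l * ((\<integral>t. \<bar>sum_ctr w I x t\<bar> powr s \<partial>lborel) + r) powr (1 / s))) \<partial>PiM I (\<lambda>_. \<nu>))
    \<le> C ^ card I * ennreal (exp (l * (r + real (card I) * K) powr (1 / s)))"
  using assms(5,6)
proof (induction I arbitrary: r rule: finite_induct)
  case empty
  interpret product_prob_space "\<lambda>_::nat. \<nu>" "{}" ..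
  show ?case using empty by (simp add: sum_ctr_def P.emeasure_space_1)
next
  case (insert i I)
  interpret product_sigma_finite "\<lambda>_::nat. \<nu>"
    by (simp add: product_sigma_finite_def sigma_finite_measure_axioms)
  have [measurable]: "w \<in> borel_measurable borel" using w by (auto simp: lp_le_def)
  have m: "(\<lambda>x. ennreal (exp (l * ((\<integral>t. \<bar>sum_ctr w J x t\<bar> powr s \<partial>lborel) + r) powr (1 / s))))
     \<in> borel_measurable (PiM J (\<lambda>_. \<nu>))" for J r
    unfolding sum_ctr_def by measurable
  have upd: "sum_ctr w (insert i I) (x(i := y)) t = sum_ctr w I x t + ctr w y t" for x y t
  proof -
    have "(\<Sum>j\<in>I. ctr w ((x(i := y)) j) t) = (\<Sum>j\<in>I. ctr w (x j) t)"
      using insert by (intro sum.cong) auto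
    then show ?thesis using insert by (simp add: sum_ctr_def)
  qed
  have "(\<integral>\<^sup>+x. ennreal (exp (l * ((\<integral>t. \<bar>sum_ctr w (insert i I) x t\<bar> powr s \<partial>lborel) + r) powr (1 / s))) \<partial>PiM (insert i I) (\<lambda>_. \<nu>))
    = (\<integral>\<^sup>+x. (\<integral>\<^sup>+y. ennreal (exp (l * ((\<integral>t. \<bar>sum_ctr w I x t + ctr w y t\<bar> powr s \<partial>lborel) + r) powr (1 / s))) \<partial>\<nu>) \<partial>PiM I (\<lambda>_. \<nu>))"
    by (subst product_nn_integral_insert[OF insert(1,2) m]) (simp add: upd)
  also have "\<dots> \<le> (\<integral>\<^sup>+x. C * ennreal (exp (l * ((\<integral>t. \<bar>sum_ctr w I x t\<bar> powr s \<partial>lborel) + (r + K)) powr (1 / s))) \<partial>PiM I (\<lambda>_. \<nu>))"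
    by (intro nn_integral_mono step[OF lp_le_sum_ctr[OF s w insert(1)] insert.prems])
  also have "\<dots> = C * (\<integral>\<^sup>+x. ennreal (exp (l * ((\<integral>t. \<bar>sum_ctr w I x t\<bar> powr s \<partial>lborel) + (r + K)) powr (1 / s))) \<partial>PiM I (\<lambda>_. \<nu>))"
    by (rule nn_integral_cmult[OF m])
  also have "\<dots> \<le> C * (C ^ card I * ennreal (exp (l * ((r + K) + real (card I) * K) powr (1 / s))))"
    using insert K by (intro mult_left_mono insert.IH) auto
  finally show ?case using insert by (simp add: algebra_simps)
qed

end

section \<open>From exponential moments to moments of the excess\<close>

text \<open>The integral defining \<open>Gamma (q + 1)\<close>, restricted to t beyond x and with
  t^q replaced by x^q, equals x^q exp(-x). This is where the Gamma factor of \<open>T_common\<close>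
  comes from.\<close>

lemma powr_le_Gamma_exp:
  fixes x q :: real
  assumes x: "x \<ge> 0" and q: "q > 0"
  shows "x powr q \<le> Gamma (q + 1) * exp x"
proof -
  have gi: "((\<lambda>t. t powr q / exp t) has_integral Gamma (q + 1)) {0..}"
    using Gamma_integral_real[of "q + 1"] q by simp
  have ei: "((\<lambda>t. x powr q * exp (- 1 * t)) has_integral x powr q * (exp (- 1 * x) / 1)) {x..}"
    by (intro has_integral_mult_right has_integral_exp_minus_to_infinity) simp
  have ei': "((\<lambda>t. if t \<in> {x..} then x powr q * exp (- 1 * t) else 0) has_integral x powr q * (exp (- 1 * x) / 1)) {0..}"
    using ei x by (subst has_integral_restrict) auto
  have "x powr q * (exp (- 1 * x) / 1) \<le> Gamma (q + 1)"
  proof (rule has_integral_le[OF ei' gi])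
    fix t :: real assume "t \<in> {0..}"
    then show "(if t \<in> {x..} then x powr q * exp (- 1 * t) else 0) \<le> t powr q / exp t"
      using x q by (auto simp: exp_minus divide_inverse intro!: mult_right_mono powr_mono2)
  qed
  then show ?thesis by (simp add: exp_minus field_simps)
qed

text \<open>Chernoff's argument for the q-th power of the positive part. Measuring
  \<open>\<theta>\<close> and H in units of b makes it scale free, so that weights and increments of
  any size can share it.\<close>

lemma excess_moment_from_mgf:
  assumes [measurable]: "Y \<in> borel_measurable N" and b: "b > 0" and \<theta>: "\<theta> > 0" and q: "q > 0"
    and E: "(\<integral>\<^sup>+x. ennreal (exp (\<theta> / b * Y x)) \<partial>N) \<le> ennreal (exp E)"
  shows "(\<integral>\<^sup>+x. ennreal (max 0 (Y x - H * b) powr q) \<partial>N)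
    \<le> ennreal (b powr q * Gamma (q + 1) * (1 / \<theta>) powr q * exp (E - \<theta> * H))"
proof -
  define c where "c = (b / \<theta>) powr q * Gamma (q + 1) * exp (- \<theta> * H)"
  have G: "Gamma (q + 1) > 0" using q by (intro Gamma_real_pos) auto
  have c: "c \<ge> 0" using G by (simp add: c_def)
  have pw: "max 0 (Y x - H * b) powr q \<le> c * exp (\<theta> / b * Y x)" for x
  proof (cases "Y x - H * b > 0")
    case True
    have "Y x - H * b = b / \<theta> * (\<theta> * (Y x - H * b) / b)" using b \<theta> by simp
    then have "max 0 (Y x - H * b) powr q = (b / \<theta>) powr q * (\<theta> * (Y x - H * b) / b) powr q"
      using True b \<theta> by (simp add: powr_mult[symmetric] max_def)
    also have "\<dots> \<le> (b / \<theta>) powr q * (Gamma (q + 1) * exp (\<theta> * (Y x - H * b) / b))"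
      using True b \<theta> by (intro mult_left_mono powr_le_Gamma_exp q) auto
    also have "\<theta> * (Y x - H * b) / b = - \<theta> * H + \<theta> / b * Y x" using b by (simp add: field_simps)
    finally show ?thesis by (simp add: c_def exp_diff exp_minus field_simps)
  next
    case False
    then have "max 0 (Y x - H * b) = 0" by simp
    then show ?thesis using c by simp
  qed
  have "(\<integral>\<^sup>+x. ennreal (max 0 (Y x - H * b) powr q) \<partial>N) \<le> (\<integral>\<^sup>+x. ennreal c * ennreal (exp (\<theta> / b * Y x)) \<partial>N)"
    using c by (intro nn_integral_mono) (simp only: ennreal_mult[symmetric] exp_ge_zero ennreal_leI pw)
  also have "\<dots> = ennreal c * (\<integral>\<^sup>+x. ennreal (exp (\<theta> / b * Y x)) \<partial>N)" by (rule nn_integral_cmult) measurable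
  also have "\<dots> \<le> ennreal c * ennreal (exp E)" by (intro mult_left_mono E) auto
  also have "\<dots> = ennreal (b powr q * Gamma (q + 1) * (1 / \<theta>) powr q * exp (E - \<theta> * H))"
    using c b \<theta> by (simp add: ennreal_mult[symmetric] c_def powr_divide exp_diff exp_minus field_simps)
  finally show ?thesis .
qed

section \<open>Exponential moments of the norm for a single weight\<close>

context translation_law
begin

lemma exp_moment_type_s:
  assumes s: "1 \<le> s" "s \<le> 2" and w: "lp_le lborel s w B" and B: "B > 0" and l: "l > 0" and I: "finite I"
  shows "(\<integral>\<^sup>+x. ennreal (exp (l * (\<integral>t. \<bar>sum_ctr w I x t\<bar> powr s \<partial>lborel) powr (1 / s))) \<partial>PiM I (\<lambda>_. \<nu>))
    \<le> ennreal (exp (2 * real (card I) * l\<^sup>2 * B\<^sup>2 + l * (real (card I) powr (1 / s) * (4 * B))))"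
proof -
  \<comment> \<open>The second-order term is at most 2 (2B)^s because centred translates have norm
    at most 2B, and 2 is at most 2^s.\<close>
  define K where "K = (4 * B) powr s"
  have K: "K > 0" using B by (simp add: K_def)
  have [measurable]: "w \<in> borel_measurable borel" using w by (auto simp: lp_le_def)
  have step: "(\<integral>\<^sup>+x. ennreal (exp (l * ((\<integral>t. \<bar>S t + ctr w x t\<bar> powr s \<partial>lborel) + r) powr (1 / s))) \<partial>\<nu>)
      \<le> ennreal (exp (l\<^sup>2 * (2 * B)\<^sup>2 / 2)) * ennreal (exp (l * ((\<integral>t. \<bar>S t\<bar> powr s \<partial>lborel) + (r + K)) powr (1 / s)))"
    if S: "lp_le lborel s S A" and r: "r \<ge> 0" for S A r
  proof -
    have [measurable]: "S \<in> borel_measurable borel" using S by (auto simp: lp_le_def)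
    define R where "R = ((\<integral>t. \<bar>S t\<bar> powr s \<partial>lborel) + r + K) powr (1 / s)"
    have arK: "(\<integral>t. \<bar>S t\<bar> powr s \<partial>lborel) + r + K > 0"
      using r K by (intro add_nonneg_pos add_nonneg_nonneg) auto
    have R: "R > 0" using arK by (simp add: R_def)
    have Rs: "R powr s = (\<integral>t. \<bar>S t\<bar> powr s \<partial>lborel) + r + K" using arK s by (simp add: R_def powr_powr)
    have SR: "lp_le lborel s S R"
      by (rule lp_leI_integral) (use lp_le_integral[OF S] R Rs r K in auto)
    define k where "k t = sgn (S t) * \<bar>S t\<bar> powr (s - 1)" for t
    have k: "k \<in> borel_measurable borel" "\<And>t. \<bar>k t\<bar> \<le> \<bar>S t\<bar> powr (s - 1)"
      by (auto simp: k_def[abs_def] abs_mult sgn_if)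
    show ?thesis
    proof (rule exp_step[OF s(1) w B S r K R_def SR R k _ l])
      fix x
      note c = lp_le_ctr[OF s(1) w, of x]
      note ic = lp_le_integral[OF c]
      have B2: "2 * B > 0" using B by simp
      have kl: "k \<in> borel_measurable lborel" using k by simp
      note ik = holder_integral(1)[OF s(1) SR c R B2 kl k(2)]
      have "(\<integral>t. \<bar>S t + ctr w x t\<bar> powr s \<partial>lborel)
        \<le> (\<integral>t. \<bar>S t\<bar> powr s + s * (k t * ctr w x t) + 2 * \<bar>ctr w x t\<bar> powr s \<partial>lborel)"
      proof (rule integral_mono)
        show "integrable lborel (\<lambda>t. \<bar>S t + ctr w x t\<bar> powr s)"
          using lp_le_integral[OF lp_le_add[OF s(1) S c]] by simp
        show "integrable lborel (\<lambda>t. \<bar>S t\<bar> powr s + s * (k t * ctr w x t) + 2 * \<bar>ctr w x t\<bar> powr s)"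
          using ic ik B lp_le_integral[OF S] by simp
        show "\<bar>S t + ctr w x t\<bar> powr s \<le> \<bar>S t\<bar> powr s + s * (k t * ctr w x t) + 2 * \<bar>ctr w x t\<bar> powr s" for t
          using abs_add_powr_le[OF s, of "S t" "ctr w x t"] by (simp add: k_def mult.assoc)
      qed
      also have "\<dots> = (\<integral>t. \<bar>S t\<bar> powr s \<partial>lborel) + s * (\<integral>t. k t * ctr w x t \<partial>lborel) + 2 * (\<integral>t. \<bar>ctr w x t\<bar> powr s \<partial>lborel)"
        using ic ik B lp_le_integral[OF S] by simp
      also have "2 * (\<integral>t. \<bar>ctr w x t\<bar> powr s \<partial>lborel) \<le> 2 powr 1 * (2 * B) powr s" using ic by simp
      also have "\<dots> \<le> 2 powr s * (2 * B) powr s" using s by (intro mult_right_mono powr_mono) auto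
      also have "\<dots> = K" using B by (simp add: K_def powr_mult[symmetric])
      finally show "(\<integral>t. \<bar>S t + ctr w x t\<bar> powr s \<partial>lborel)
        \<le> (\<integral>t. \<bar>S t\<bar> powr s \<partial>lborel) + K + s * (\<integral>t. k t * ctr w x t \<partial>lborel)" by simp
    next
      note P = s(1) w B SR R k
      show "(\<integral>\<^sup>+x. ennreal (exp (l * ((\<integral>t. k t * ctr w x t \<partial>lborel) / R powr (s - 1)))) \<partial>\<nu>) \<le> ennreal (exp (l\<^sup>2 * (2 * B)\<^sup>2 / 2))"
      proof (rule mgf_hoeffding)
        have "(\<lambda>x. \<integral>t. k t * ctr w x t \<partial>lborel) \<in> borel_measurable \<nu>" using pairing_measurable[OF P] by simp
        then show "(\<lambda>x. (\<integral>t. k t * ctr w x t \<partial>lborel) / R powr (s - 1)) \<in> borel_measurable \<nu>" by measurable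
        show "\<bar>(\<integral>t. k t * ctr w x t \<partial>lborel) / R powr (s - 1)\<bar> \<le> 2 * B" for x
          using pairing_bound[OF P, of x] R by (simp add: pos_divide_le_eq mult.commute)
        show "expectation (\<lambda>x. (\<integral>t. k t * ctr w x t \<partial>lborel) / R powr (s - 1)) = 0"
          using pairing_mean_zero[OF P] by simp
      qed (rule l)
    qed
  qed
  have "(\<integral>\<^sup>+x. ennreal (exp (l * ((\<integral>t. \<bar>sum_ctr w I x t\<bar> powr s \<partial>lborel) + 0) powr (1 / s))) \<partial>PiM I (\<lambda>_. \<nu>))
    \<le> ennreal (exp (l\<^sup>2 * (2 * B)\<^sup>2 / 2)) ^ card I * ennreal (exp (l * (0 + real (card I) * K) powr (1 / s)))"
    by (rule exp_moment_recursion[OF s(1) w less_imp_le[OF K] step I]) auto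
  also have "\<dots> = ennreal (exp (2 * real (card I) * l\<^sup>2 * B\<^sup>2 + l * (real (card I) powr (1 / s) * (4 * B))))"
  proof -
    have "(0 + real (card I) * K) powr (1 / s) = real (card I) powr (1 / s) * (4 * B)"
      using B s by (simp add: K_def powr_mult powr_powr)
    moreover have "exp (l\<^sup>2 * (2 * B)\<^sup>2 / 2) ^ card I = exp (2 * real (card I) * l\<^sup>2 * B\<^sup>2)"
      by (simp add: exp_of_nat_mult[symmetric] power_mult_distrib mult_ac)
    ultimately show ?thesis by (simp add: ennreal_power ennreal_mult[symmetric] exp_add)
  qed
  finally show ?thesis by simp
qed

text \<open>Pairing with g, that is S minus the mean function, rather than with S leaves the
  uncentred translate in the quadratic term. Hence K is B^2 and the level starts with the constant
  1; the price is the factor \<open>sqrt 2\<close> in the bound for g. The hypothesis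
  \<open>mgf\<close> is abstract so that Hoeffding's and Bernstein's bounds can both be
  inserted.\<close>

lemma exp_moment_hilbert:
  assumes w: "lp_le lborel 2 w B" and B: "B > 0" and l: "l > 0" and I: "finite I"
    and mgf: "\<And>g R. lp_le lborel 2 g (sqrt 2 * R) \<Longrightarrow> R > 0 \<Longrightarrow>
      (\<integral>\<^sup>+x. ennreal (exp (l * ((\<integral>t. g t * ctr w x t \<partial>lborel) / R))) \<partial>\<nu>) \<le> ennreal (exp c)"
  shows "(\<integral>\<^sup>+x. ennreal (exp (l * (\<integral>t. \<bar>sum_ctr w I x t\<bar> powr 2 \<partial>lborel) powr (1 / 2))) \<partial>PiM I (\<lambda>_. \<nu>))
    \<le> ennreal (exp (real (card I) * c + l * (sqrt (real (card I)) * B)))"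
proof -
  have s: "(1::real) \<le> 2" by simp
  define K where "K = B\<^sup>2"
  have K: "K > 0" using B by (simp add: K_def)
  have [measurable]: "w \<in> borel_measurable borel" using w by (auto simp: lp_le_def)
  note m = lp_le_cmean[OF s w]
  have step: "(\<integral>\<^sup>+x. ennreal (exp (l * ((\<integral>t. \<bar>S t + ctr w x t\<bar> powr 2 \<partial>lborel) + r) powr (1 / 2))) \<partial>\<nu>)
      \<le> ennreal (exp c) * ennreal (exp (l * ((\<integral>t. \<bar>S t\<bar> powr 2 \<partial>lborel) + (r + K)) powr (1 / 2)))"
    if S: "lp_le lborel 2 S A" and r: "r \<ge> 0" for S A r
  proof -
    have [measurable]: "S \<in> borel_measurable borel" using S by (auto simp: lp_le_def)
    define R where "R = ((\<integral>t. \<bar>S t\<bar> powr 2 \<partial>lborel) + r + K) powr (1 / 2)"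
    have arK: "(\<integral>t. \<bar>S t\<bar> powr 2 \<partial>lborel) + r + K > 0"
      using r K by (intro add_nonneg_pos add_nonneg_nonneg) auto
    have R: "R > 0" using arK by (simp add: R_def)
    have Rs: "R\<^sup>2 = (\<integral>t. \<bar>S t\<bar> powr 2 \<partial>lborel) + r + K" 
      using arK by (simp only: R_def powr_half_sqrt[OF less_imp_le[OF arK]] real_sqrt_pow2[OF less_imp_le[OF arK]])
    define g where "g t = S t - cmean w t" for t
    have [measurable]: "g \<in> borel_measurable borel" unfolding g_def by measurable
    note gA = lp_le_diff[OF s S m, folded g_def]
    \<comment> \<open>The square of a difference costs a factor 2, and the squared norm of the mean
      function is at most B^2, which is the summand K of R^2.\<close>
    have gR: "lp_le lborel 2 g (sqrt 2 * R)"
    proof (rule lp_leI_integral)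
      show "integrable lborel (\<lambda>x. \<bar>g x\<bar> powr 2)" by (rule lp_le_integral[OF gA])
      have "(\<integral>t. \<bar>g t\<bar> powr 2 \<partial>lborel) \<le> (\<integral>t. 2 * \<bar>S t\<bar> powr 2 + 2 * \<bar>cmean w t\<bar> powr 2 \<partial>lborel)"
      proof (rule integral_mono[OF lp_le_integral(1)[OF gA]])
        show "integrable lborel (\<lambda>t. 2 * \<bar>S t\<bar> powr 2 + 2 * \<bar>cmean w t\<bar> powr 2)"
          using lp_le_integral[OF S] lp_le_integral[OF m] by simp
        show "\<bar>g t\<bar> powr 2 \<le> 2 * \<bar>S t\<bar> powr 2 + 2 * \<bar>cmean w t\<bar> powr 2" for t
          using sum_squares_ge_zero[of "S t + cmean w t" 0] by (simp add: g_def power2_eq_square algebra_simps)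
      qed
      also have "\<dots> = 2 * (\<integral>t. \<bar>S t\<bar> powr 2 \<partial>lborel) + 2 * (\<integral>t. \<bar>cmean w t\<bar> powr 2 \<partial>lborel)"
        using lp_le_integral[OF S] lp_le_integral[OF m] by simp
      also have "(\<integral>t. \<bar>cmean w t\<bar> powr 2 \<partial>lborel) \<le> B\<^sup>2" using lp_le_integral(2)[OF m] B by simp
      also have "2 * (\<integral>t. \<bar>S t\<bar> powr 2 \<partial>lborel) + 2 * B\<^sup>2 \<le> (sqrt 2 * R) powr 2"
        using Rs r R by (simp add: power_mult_distrib K_def)
      finally show "(\<integral>t. \<bar>g t\<bar> powr 2 \<partial>lborel) \<le> (sqrt 2 * R) powr 2" by simp
    qed (use R in auto)
    have R2: "sqrt 2 * R > 0" using R by simp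
    have k: "g \<in> borel_measurable borel" "\<And>t. \<bar>g t\<bar> \<le> \<bar>g t\<bar> powr (2 - 1)" by auto
    show ?thesis
    proof (rule exp_step[OF s w B S r K R_def gR R2 k _ l])
      fix x
      note c = lp_le_ctr[OF s w, of x]
      note wx = lp_le_integral[OF lp_le_translate[OF w, of x]]
      have B2: "2 * B > 0" using B by simp
      have kl: "g \<in> borel_measurable lborel" by simp
      note ik = holder_integral(1)[OF s gR c R2 B2 kl k(2)]
      have "(\<integral>t. \<bar>S t + ctr w x t\<bar> powr 2 \<partial>lborel)
        \<le> (\<integral>t. \<bar>S t\<bar> powr 2 + \<bar>w (t - x)\<bar> powr 2 + 2 * (g t * ctr w x t) \<partial>lborel)"
      proof (rule integral_mono)
        show "integrable lborel (\<lambda>t. \<bar>S t + ctr w x t\<bar> powr 2)"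
          using lp_le_integral[OF lp_le_add[OF s S c]] by simp
        show "integrable lborel (\<lambda>t. \<bar>S t\<bar> powr 2 + \<bar>w (t - x)\<bar> powr 2 + 2 * (g t * ctr w x t))"
          using wx ik B lp_le_integral[OF S] by simp
        \<comment> \<open>The right side exceeds the left side by exactly the square of
          \<open>cmean w t\<close>.\<close>
        show "\<bar>S t + ctr w x t\<bar> powr 2 \<le> \<bar>S t\<bar> powr 2 + \<bar>w (t - x)\<bar> powr 2 + 2 * (g t * ctr w x t)" for t
          using zero_le_square[of "cmean w t"] by (simp add: g_def ctr_def power2_eq_square algebra_simps)
      qed
      also have "\<dots> = (\<integral>t. \<bar>S t\<bar> powr 2 \<partial>lborel) + (\<integral>t. \<bar>w (t - x)\<bar> powr 2 \<partial>lborel) + 2 * (\<integral>t. g t * ctr w x t \<partial>lborel)"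
        using wx ik B lp_le_integral[OF S] by simp
      also have "(\<integral>t. \<bar>w (t - x)\<bar> powr 2 \<partial>lborel) \<le> K" using wx(2) B by (simp add: K_def)
      finally show "(\<integral>t. \<bar>S t + ctr w x t\<bar> powr 2 \<partial>lborel)
        \<le> (\<integral>t. \<bar>S t\<bar> powr 2 \<partial>lborel) + K + 2 * (\<integral>t. g t * ctr w x t \<partial>lborel)" by simp
    next
      show "(\<integral>\<^sup>+x. ennreal (exp (l * ((\<integral>t. g t * ctr w x t \<partial>lborel) / R powr (2 - 1)))) \<partial>\<nu>) \<le> ennreal (exp c)"
        using mgf[OF gR R] R by simp
    qed
  qed
  have "(\<integral>\<^sup>+x. ennreal (exp (l * ((\<integral>t. \<bar>sum_ctr w I x t\<bar> powr 2 \<partial>lborel) + 0) powr (1 / 2))) \<partial>PiM I (\<lambda>_. \<nu>))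
    \<le> ennreal (exp c) ^ card I * ennreal (exp (l * (0 + real (card I) * K) powr (1 / 2)))"
    by (rule exp_moment_recursion[OF s w less_imp_le[OF K] step I]) auto
  also have "\<dots> = ennreal (exp (real (card I) * c + l * (sqrt (real (card I)) * B)))"
  proof -
    have "(0 + real (card I) * K) powr (1 / 2) = sqrt (real (card I)) * B"
      using B by (simp add: K_def powr_half_sqrt real_sqrt_mult)
    moreover have "exp c ^ card I = exp (real (card I) * c)"
      by (simp add: exp_of_nat_mult[symmetric])
    ultimately show ?thesis by (simp add: ennreal_power ennreal_mult[symmetric] exp_add)
  qed
  finally show ?thesis by simp
qed

lemma hilbert_pairing:
  assumes w: "lp_le lborel 2 w B" and B: "B > 0" and g: "lp_le lborel 2 g (sqrt 2 * R)" and R: "R > 0"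
  shows "(\<lambda>x. (\<integral>t. g t * ctr w x t \<partial>lborel) / R) \<in> borel_measurable \<nu>"
    "\<bar>(\<integral>t. g t * ctr w x t \<partial>lborel) / R\<bar> \<le> 2 * sqrt 2 * B"
    "(\<integral>x. (\<integral>t. g t * ctr w x t \<partial>lborel) / R \<partial>\<nu>) = 0"
proof -
  have [measurable]: "g \<in> borel_measurable borel" using g by (auto simp: lp_le_def)
  have s: "(1::real) \<le> 2" and R2: "sqrt 2 * R > 0" and k: "g \<in> borel_measurable borel" "\<And>t. \<bar>g t\<bar> \<le> \<bar>g t\<bar> powr (2 - 1)"
    using R by auto
  note P = s w B g R2 k
  have "(\<lambda>x. \<integral>t. g t * ctr w x t \<partial>lborel) \<in> borel_measurable \<nu>" using pairing_measurable[OF P] by simp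
  then show "(\<lambda>x. (\<integral>t. g t * ctr w x t \<partial>lborel) / R) \<in> borel_measurable \<nu>" by measurable
  show "\<bar>(\<integral>t. g t * ctr w x t \<partial>lborel) / R\<bar> \<le> 2 * sqrt 2 * B"
    using pairing_bound[OF P, of x] R by (simp add: pos_divide_le_eq mult_ac)
  show "(\<integral>x. (\<integral>t. g t * ctr w x t \<partial>lborel) / R \<partial>\<nu>) = 0"
    using pairing_mean_zero[OF P] by simp
qed

lemma exp_moment_hilbert_subgaussian:
  assumes w: "lp_le lborel 2 w B" and B: "B > 0" and l: "l > 0" and I: "finite I"
  shows "(\<integral>\<^sup>+x. ennreal (exp (l * (\<integral>t. \<bar>sum_ctr w I x t\<bar> powr 2 \<partial>lborel) powr (1 / 2))) \<partial>PiM I (\<lambda>_. \<nu>))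
    \<le> ennreal (exp (real (card I) * (4 * l\<^sup>2 * B\<^sup>2) + l * (sqrt (real (card I)) * B)))"
proof (rule exp_moment_hilbert[OF w B l I])
  fix g :: "'a \<Rightarrow> real" and R :: real assume g: "lp_le lborel 2 g (sqrt 2 * R)" and R: "R > 0"
  have eq: "l\<^sup>2 * (2 * sqrt 2 * B)\<^sup>2 / 2 = 4 * l\<^sup>2 * B\<^sup>2" by (simp add: power_mult_distrib)
  show "(\<integral>\<^sup>+x. ennreal (exp (l * ((\<integral>t. g t * ctr w x t \<partial>lborel) / R))) \<partial>\<nu>) \<le> ennreal (exp (4 * l\<^sup>2 * B\<^sup>2))"
    using mgf_hoeffding[OF hilbert_pairing[OF w B g R] l] unfolding eq .
qed

lemma exp_moment_hilbert_bernstein: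
  assumes w: "lp_le lborel 2 w B" and B: "B > 0" and l: "l > 0" "l * (2 * sqrt 2 * B) < 3" and I: "finite I"
    and f: "f \<in> borel_measurable borel" "\<And>x. 0 \<le> f x" "\<And>x. f x \<le> F" and nu: "\<nu> = density lborel (\<lambda>x. ennreal (f x))"
    and supp: "emeasure lborel {t. w t \<noteq> 0} \<le> ennreal m" and m: "m \<ge> 0"
  shows "(\<integral>\<^sup>+x. ennreal (exp (l * (\<integral>t. \<bar>sum_ctr w I x t\<bar> powr 2 \<partial>lborel) powr (1 / 2))) \<partial>PiM I (\<lambda>_. \<nu>))
    \<le> ennreal (exp (real (card I) * (l\<^sup>2 * (F * m * B\<^sup>2) / (1 - l * (2 * sqrt 2 * B) / 3)) + l * (sqrt (real (card I)) * B)))"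
proof (rule exp_moment_hilbert[OF w B l(1) I])
  fix g :: "'a \<Rightarrow> real" and R :: real assume g: "lp_le lborel 2 g (sqrt 2 * R)" and R: "R > 0"
  have "(\<integral>x. (\<integral>t. g t * ctr w x t \<partial>lborel)\<^sup>2 \<partial>\<nu>) \<le> F * m * B\<^sup>2 * (sqrt 2 * R)\<^sup>2"
    by (rule pairing_second_moment[OF w B g _ f nu supp m]) (use R in auto)
  \<comment> \<open>The factor 2 is the square of the \<open>sqrt 2\<close> in the bound for
    g.\<close>
  then have "(\<integral>x. ((\<integral>t. g t * ctr w x t \<partial>lborel) / R)\<^sup>2 \<partial>\<nu>) \<le> 2 * (F * m * B\<^sup>2)"
    using R by (simp add: power_divide power_mult_distrib pos_divide_le_eq mult_ac)
  note b = mgf_bernstein[OF hilbert_pairing[OF w B g R] this l]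
  have eq: "l\<^sup>2 * (2 * (F * m * B\<^sup>2)) / (2 * (1 - l * (2 * sqrt 2 * B) / 3)) = l\<^sup>2 * (F * m * B\<^sup>2) / (1 - l * (2 * sqrt 2 * B) / 3)"
  proof -
    have "a * (2 * b) / (2 * c) = a * b / c" for a b c :: real by simp
    then show ?thesis .
  qed
  show "(\<integral>\<^sup>+x. ennreal (exp (l * ((\<integral>t. g t * ctr w x t \<partial>lborel) / R))) \<partial>\<nu>)
    \<le> ennreal (exp (l\<^sup>2 * (F * m * B\<^sup>2) / (1 - l * (2 * sqrt 2 * B) / 3)))"
    using b unfolding eq .
qed

text \<open>A real number in every case; \<open>Lp_norm_eq\<close> identifies it with the extended
  norm once the weight has a finite norm bound.\<close>

definition sum_norm :: "real \<Rightarrow> ('a \<Rightarrow> real) \<Rightarrow> nat set \<Rightarrow> (nat \<Rightarrow> 'a) \<Rightarrow> real" where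
  "sum_norm s w I x = (\<integral>t. \<bar>sum_ctr w I x t\<bar> powr s \<partial>lborel) powr (1 / s)"

lemma sum_norm_measurable:
  assumes [measurable]: "w \<in> borel_measurable borel"
  shows "sum_norm s w I \<in> borel_measurable (PiM I (\<lambda>_. \<nu>))"
  unfolding sum_norm_def sum_ctr_def by measurable

section \<open>Moments of the excess for a single weight\<close>

text \<open>The level is written with \<open>0 * y\<^sup>2\<close> to match the quadratic shape that
  chaining expects. The 2 in front of y^2 is the reserve that chaining consumes.\<close>

lemma moment_type_s:
  fixes n :: nat
  assumes s: "1 \<le> s" "s \<le> 2" and q: "q > 0" and b: "b > 0" and I: "finite I" "card I = n" "n \<ge> 1"
    and w: "lp_le lborel s w (b / real n powr (1 / s))"
    and y: "y \<ge> sqrt 37 / 2 * real n powr (1/2 - 1/s)"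
  shows "(\<integral>\<^sup>+x. ennreal (max 0 (sum_norm s w I x - (4 + 4 * y + 0 * y\<^sup>2) * b) powr q) \<partial>PiM I (\<lambda>_. \<nu>))
    \<le> ennreal (b powr q * Gamma (q + 1) * (4 * (1 + 4 * real n powr (1/2 - 1/s))) powr q
        * exp (- 2 * y\<^sup>2 * (2 / 37 * real n powr (2/s - 1))))"
proof -
  define N where "N = real n"
  have N: "N > 0" using I by (simp add: N_def)
  define e where "e = N powr (2/s - 1)"
  have e: "e > 0" using N by (simp add: e_def)
  have e1: "N powr (1/2 - 1/s) = 1 / sqrt e"
  proof -
    have "sqrt e = N powr ((2/s-1) * (1/2))" unfolding e_def using N by (simp add: powr_half_sqrt[symmetric] powr_powr)
    also have "(2/s-1) * (1/2) = - (1/2 - 1/s)" by (simp add: field_simps)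
    finally show ?thesis by (simp only: powr_minus_divide) simp
  qed
  have y0: "y \<ge> sqrt 37 / 2 * (1 / sqrt e)" using y e1 by (simp add: N_def)
  have ypos: "y > 0" using less_le_trans[OF _ y0] e by simp
  \<comment> \<open>Minimises \<open>2 * \<theta>\<^sup>2 / e - 4 * \<theta> * y\<close>, the
    exponent that remains at level 4 + 4y; the minimum is -2 y^2 e.\<close>
  define \<theta> where "\<theta> = y * e"
  have \<theta>: "\<theta> > 0" using e ypos by (simp add: \<theta>_def)
  define B where "B = b / N powr (1 / s)"
  have B: "B > 0" using b N by (simp add: B_def)
  have [measurable]: "w \<in> borel_measurable borel" using w by (auto simp: lp_le_def)
  have wB: "lp_le lborel s w B" using w by (simp add: B_def N_def)
  have mgf: "(\<integral>\<^sup>+x. ennreal (exp (\<theta> / b * sum_norm s w I x)) \<partial>PiM I (\<lambda>_. \<nu>))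
      \<le> ennreal (exp (2 * \<theta>\<^sup>2 / e + 4 * \<theta>))"
  proof -
    have eN: "e = N powr (1/s) * N powr (1/s) / N"
      using N by (simp add: e_def powr_diff powr_add[symmetric])
    have "2 * N * (\<theta> / b)\<^sup>2 * B\<^sup>2 + \<theta> / b * (N powr (1 / s) * (4 * B)) = 2 * \<theta>\<^sup>2 / e + 4 * \<theta>"
      using N b by (simp add: eN B_def power2_eq_square)
    then show ?thesis
      using exp_moment_type_s[OF s wB B, of "\<theta> / b", OF _ I(1)] \<theta> b I
      by (simp add: sum_norm_def N_def)
  qed
  have "(\<integral>\<^sup>+x. ennreal (max 0 (sum_norm s w I x - (4 + 4 * y + 0 * y\<^sup>2) * b) powr q) \<partial>PiM I (\<lambda>_. \<nu>))
    \<le> ennreal (b powr q * Gamma (q + 1) * (1 / \<theta>) powr q * exp (2 * \<theta>\<^sup>2 / e + 4 * \<theta> - \<theta> * (4 + 4 * y + 0 * y\<^sup>2)))"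
    by (rule excess_moment_from_mgf[OF sum_norm_measurable b \<theta> q mgf]) measurable
  also have "\<dots> \<le> ennreal (b powr q * Gamma (q + 1) * (4 * (1 + 4 * (1 / sqrt e))) powr q * exp (- 2 * y\<^sup>2 * (2 / 37 * e)))"
  proof (intro ennreal_leI mult_mono powr_mono2)
    have "1 / \<theta> \<le> 1 / (sqrt 37 / 2 * (1 / sqrt e) * e)"
      unfolding \<theta>_def using y0 e by (intro divide_left_mono mult_right_mono mult_pos_pos) (auto intro: ypos)
    also have "\<dots> = 2 / sqrt 37 * (1 / sqrt e)"
      using e by (simp add: field_simps)
    also have "\<dots> \<le> 1 * (1 / sqrt e)"
      using e by (intro mult_right_mono) (auto simp: field_simps real_le_rsqrt)
    also have "\<dots> \<le> 4 * (1 + 4 * (1 / sqrt e))"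
    proof -
      have le: "1 * v \<le> 4 * (1 + 4 * v)" if "v \<ge> 0" for v :: real using that by simp
      have "1 / sqrt e \<ge> 0" using e by simp
      from le[OF this] show ?thesis .
    qed
    finally show "1 / \<theta> \<le> 4 * (1 + 4 * (1 / sqrt e))" .
    have "2 * \<theta>\<^sup>2 / e + 4 * \<theta> - \<theta> * (4 + 4 * y + 0 * y\<^sup>2) = - 2 * (y\<^sup>2 * e)"
      using e by (simp add: \<theta>_def power2_eq_square algebra_simps)
    also have "\<dots> \<le> - 2 * y\<^sup>2 * (2 / 37 * e)" using e by (simp add: mult_left_mono)
    finally show "exp (2 * \<theta>\<^sup>2 / e + 4 * \<theta> - \<theta> * (4 + 4 * y + 0 * y\<^sup>2)) \<le> exp (- 2 * y\<^sup>2 * (2 / 37 * e))" by simp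
  qed (use q \<theta> e b in \<open>auto intro!: mult_nonneg_nonneg less_imp_le[OF Gamma_real_pos]\<close>)
  finally show ?thesis using e1 by (simp only: N_def e_def)
qed

text \<open>The support bound is twice \<open>\<mu>\<close> because increments of two weights are
  treated as well. Two regimes are needed: Bernstein's bound makes \<open>1 / \<theta>\<close>
  contain A / 3, which the 1 in the prefactor absorbs while A is below 2, and for larger A
  Hoeffding's bound already decays fast enough.\<close>

lemma moment_hilbert:
  fixes n :: nat
  assumes q: "q > 0" and b: "b > 0" and I: "finite I" "card I = n" "n \<ge> 1"
    and w: "lp_le lborel 2 w (b / real n powr (1 / 2))"
    and f: "f \<in> borel_measurable borel" "\<And>x. 0 \<le> f x" "\<And>x. f x \<le> F" and nu: "\<nu> = density lborel (\<lambda>x. ennreal (f x))"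
    and F: "F \<ge> 1" and supp: "emeasure lborel {t. w t \<noteq> 0} \<le> ennreal (2 * \<mu>)" and \<mu>: "\<mu> \<ge> 0"
    and A_def: "A = F\<^sup>2 * \<mu> + 4 * real n powr (-1/2)"
    and y: "y \<ge> sqrt (8 * A)"
  shows "(\<integral>\<^sup>+x. ennreal (max 0 (sum_norm 2 w I x - (1 + 1 * y + 1/12 * y\<^sup>2) * b) powr q) \<partial>PiM I (\<lambda>_. \<nu>))
    \<le> ennreal (b powr q * Gamma (q + 1) * (1 + 2 * sqrt (2 * A)) powr q * exp (- 2 * y\<^sup>2 * (1 / (16 * A))))"
proof -
  define N where "N = real n"
  have N: "N > 0" using I by (simp add: N_def)
  define r where "r = sqrt N"
  have r: "r > 0" "r * r = N" using N by (auto simp: r_def)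
  have A_eq: "A = F\<^sup>2 * \<mu> + 4 / r"
    using N by (simp add: A_def N_def[symmetric] r_def powr_minus_divide powr_half_sqrt[symmetric])
  have A: "A > 0" using F \<mu> r by (simp add: A_eq add_nonneg_pos)
  have ypos: "y > 0" using A by (intro less_le_trans[OF _ y]) simp
  have y2: "y\<^sup>2 \<ge> 8 * A" using y A by (simp add: real_le_rsqrt sqrt_le_D)
  define B where "B = b / r"
  have B: "B > 0" using b r by (simp add: B_def)
  have [measurable]: "w \<in> borel_measurable borel" using w by (auto simp: lp_le_def)
  have wB: "lp_le lborel 2 w B" using w N by (simp add: B_def r_def N_def powr_half_sqrt)
  note G = less_imp_le[OF Gamma_real_pos[of "q+1"]]
  define H where "H = 1 + 1 * y + 1/12 * y\<^sup>2"
  have "\<exists>\<theta> E. \<theta> > 0 \<and> 1 / \<theta> \<le> 1 + 2 * sqrt (2 * A) \<and> E - \<theta> * H \<le> - 2 * y\<^sup>2 * (1 / (16 * A)) \<and>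
     (\<integral>\<^sup>+x. ennreal (exp (\<theta> / b * sum_norm 2 w I x)) \<partial>PiM I (\<lambda>_. \<nu>)) \<le> ennreal (exp E)"
  proof (cases "A \<ge> 2")
    case True
    \<comment> \<open>Minimises \<open>4 * \<theta>\<^sup>2 - \<theta> * y\<close>. The value -y^2 /
      16 reaches the target -y^2 / (8A) exactly when A is at least 2.\<close>
    define \<theta> where "\<theta> = y / 8"
    have "\<theta> > 0" using ypos by (simp add: \<theta>_def)
    moreover have "1 / \<theta> \<le> 1 + 2 * sqrt (2 * A)"
    proof -
      have "4 \<le> sqrt (8 * A)" using True by (intro real_le_rsqrt) simp
      then have "1 / \<theta> \<le> 2" using y ypos by (simp add: \<theta>_def divide_simps)
      moreover have "2 \<le> sqrt (2 * A)" using True by (intro real_le_rsqrt) simp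
      ultimately show ?thesis by linarith
    qed
    moreover have "4 * \<theta>\<^sup>2 + \<theta> - \<theta> * H \<le> - 2 * y\<^sup>2 * (1 / (16 * A))"
    proof -
      have "4 * \<theta>\<^sup>2 + \<theta> - \<theta> * H = - (y\<^sup>2 / 16) - y * y\<^sup>2 / 96"
        by (simp add: \<theta>_def H_def power2_eq_square field_simps)
      also have "\<dots> \<le> - (y\<^sup>2 / 16)" using ypos by simp
      also have "\<dots> \<le> - 2 * y\<^sup>2 * (1 / (16 * A))" using True mult_right_mono[OF True, of "y\<^sup>2"] by (simp add: divide_simps mult.commute)
      finally show ?thesis .
    qed
    moreover have "(\<integral>\<^sup>+x. ennreal (exp (\<theta> / b * sum_norm 2 w I x)) \<partial>PiM I (\<lambda>_. \<nu>)) \<le> ennreal (exp (4 * \<theta>\<^sup>2 + \<theta>))"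
    proof -
      have "N * (4 * (\<theta> / b)\<^sup>2 * B\<^sup>2) + \<theta> / b * (r * B) = 4 * \<theta>\<^sup>2 + \<theta>"
        using r b by (simp add: B_def power2_eq_square r(2)[symmetric])
      then show ?thesis
        using exp_moment_hilbert_subgaussian[OF wB B, of "\<theta> / b", OF _ I(1)] \<open>\<theta> > 0\<close> b I
        by (simp add: sum_norm_def N_def r_def)
    qed
    ultimately show ?thesis by blast
  next
    case False
    \<comment> \<open>With this p the level H is 1 + y p, and 1 / p will be a lower bound for
      Bernstein's denominator.\<close>
    define p where "p = 1 + y / 12"
    have p: "p > 1" using ypos by (simp add: p_def)
    \<comment> \<open>Makes \<open>\<theta> * (y * p)\<close> equal to y^2 / (4A), twice the bound
      y^2 / (8A) that the variance term will satisfy.\<close>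
    define \<theta> where "\<theta> = y / (4 * A * p)"
    have \<theta>: "\<theta> > 0" using ypos A p by (simp add: \<theta>_def)
    have \<theta>1: "1 / \<theta> = 4 * A / y + A / 3" using ypos by (simp add: \<theta>_def p_def field_simps)
    have "4 * A / y \<le> sqrt (2 * A)"
    proof -
      have "4 * A = sqrt ((4 * A)\<^sup>2)" using A by (subst real_sqrt_abs) simp
      also have "\<dots> = sqrt (2 * A) * sqrt (8 * A)"
        unfolding real_sqrt_mult[symmetric] by (simp add: power2_eq_square)
      also have "\<dots> \<le> sqrt (2 * A) * y" using y A by (intro mult_left_mono) auto
      finally show ?thesis using ypos by (simp add: divide_simps)
    qed
    then have "1 / \<theta> \<le> 1 + 2 * sqrt (2 * A)" using False A \<theta>1 real_sqrt_ge_zero[of "2 * A"] by linarith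
    define x where "x = \<theta> * (2 * sqrt 2) / r"
    have s2: "sqrt 2 \<le> 2" by (simp add: real_le_lsqrt)
    \<comment> \<open>The summand 4 n^(-1/2) of A controls the range of the increments: 1 / r is at
      most A / 4. The right-hand side here is 1 - 1/p.\<close>
    have xb: "x / 3 \<le> (y / 12) / p"
    proof -
      have "4 / r \<le> A" using A_eq F \<mu> by simp
      then have "1 / r \<le> A / 4" by simp
      have "\<theta> * (2 * sqrt 2) * (1 / r) \<le> \<theta> * (2 * 2) * (A / 4)"
        by (intro mult_mono \<open>1 / r \<le> A / 4\<close>) (use \<theta> s2 r in auto)
      then have "x / 3 \<le> \<theta> * (2 * 2) * (A / 4) / 3" unfolding x_def by (simp add: mult_ac)
      also have "\<dots> = (y / 12) / p" using A by (simp add: \<theta>_def)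
      finally show ?thesis .
    qed
    have xp: "1 - x / 3 \<ge> 1 / p"
    proof -
      have "1 / p = 1 - (y / 12) / p" using p by (simp add: p_def field_simps)
      then show ?thesis using xb by linarith
    qed
    moreover have "1 / p > 0" using p by simp
    ultimately have x3: "x < 3" by linarith
    define E where "E = \<theta>\<^sup>2 * (F * (2 * \<mu>)) / (1 - x / 3) + \<theta>"
    have "E - \<theta> * H \<le> - 2 * y\<^sup>2 * (1 / (16 * A))"
    proof -
      \<comment> \<open>The variance is linear in F whereas A contains F^2; \<open>F \<ge> 1\<close>
        closes this gap.\<close>
      have "F * 1 * \<mu> \<le> F * F * \<mu>" using F \<mu> by (intro mult_right_mono mult_left_mono) auto
      moreover have "F * F * \<mu> \<le> A" using r A_eq by (simp add: power2_eq_square)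
      ultimately have Fm: "F * (2 * \<mu>) \<le> 2 * A" by linarith
      have "\<theta>\<^sup>2 * (F * (2 * \<mu>)) / (1 - x / 3) \<le> \<theta>\<^sup>2 * (2 * A) / (1 / p)"
        using xp p A Fm by (intro frac_le mult_left_mono) auto
      also have "\<dots> = y\<^sup>2 / (8 * A) * (1 / p)"
        using A p by (simp add: \<theta>_def power2_eq_square field_simps)
      also have "\<dots> \<le> y\<^sup>2 / (8 * A) * 1" using A p by (intro mult_left_mono) auto
      finally have 1: "\<theta>\<^sup>2 * (F * (2 * \<mu>)) / (1 - x / 3) \<le> y\<^sup>2 / (8 * A)" by simp
      have "\<theta> * H = \<theta> + \<theta> * (y * p)" by (simp add: H_def p_def power2_eq_square algebra_simps)
      also have "\<theta> * (y * p) = y\<^sup>2 / (4 * A)" using p by (simp add: \<theta>_def power2_eq_square)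
      finally have "E - \<theta> * H \<le> y\<^sup>2 / (8 * A) - y\<^sup>2 / (4 * A)" using 1 by (simp add: E_def)
      also have "\<dots> = - 2 * y\<^sup>2 * (1 / (16 * A))" using A by (simp add: field_simps)
      finally show ?thesis .
    qed
    moreover have "(\<integral>\<^sup>+x. ennreal (exp (\<theta> / b * sum_norm 2 w I x)) \<partial>PiM I (\<lambda>_. \<nu>)) \<le> ennreal (exp E)"
    proof -
      have lB: "\<theta> / b * (2 * sqrt 2 * B) = x" using b by (simp add: x_def B_def)
      have "N * ((\<theta> / b)\<^sup>2 * (F * (2 * \<mu>) * B\<^sup>2) / (1 - x / 3)) + \<theta> / b * (r * B) = E"
        using r b by (simp add: B_def E_def power2_eq_square r(2)[symmetric])
      then show ?thesis
        using exp_moment_hilbert_bernstein[OF wB B, of "\<theta> / b", OF _ _ I(1) f nu supp, unfolded lB] \<theta> b I x3 \<mu>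
        by (simp add: sum_norm_def N_def r_def)
    qed
    ultimately show ?thesis using \<theta> \<open>1 / \<theta> \<le> 1 + 2 * sqrt (2 * A)\<close> by blast
  qed
  then obtain \<theta> E where \<theta>: "\<theta> > 0" and \<theta>1: "1 / \<theta> \<le> 1 + 2 * sqrt (2 * A)"
    and E: "E - \<theta> * H \<le> - 2 * y\<^sup>2 * (1 / (16 * A))"
    and mgf: "(\<integral>\<^sup>+x. ennreal (exp (\<theta> / b * sum_norm 2 w I x)) \<partial>PiM I (\<lambda>_. \<nu>)) \<le> ennreal (exp E)" by blast
  have "(\<integral>\<^sup>+x. ennreal (max 0 (sum_norm 2 w I x - H * b) powr q) \<partial>PiM I (\<lambda>_. \<nu>))
    \<le> ennreal (b powr q * Gamma (q + 1) * (1 / \<theta>) powr q * exp (E - \<theta> * H))"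
    by (rule excess_moment_from_mgf[OF sum_norm_measurable b \<theta> q mgf]) measurable
  also have "\<dots> \<le> ennreal (b powr q * Gamma (q + 1) * (1 + 2 * sqrt (2 * A)) powr q * exp (- 2 * y\<^sup>2 * (1 / (16 * A))))"
    using \<theta> \<theta>1 E q b G by (intro ennreal_leI mult_mono powr_mono2) (auto intro!: mult_nonneg_nonneg)
  finally show ?thesis by (simp only: H_def)
qed

end

section \<open>Chaining\<close>

lemma ex_finite_cball_cover:
  fixes Z :: "'z::metric_space set"
  assumes "totally_bounded Z" "\<delta> > 0"
  shows "\<exists>C. finite C \<and> card C = covering_number Z \<delta> \<and> Z \<subseteq> (\<Union>c\<in>C. cball c \<delta>)"
proof -
  obtain C where "finite C" and C: "Z \<subseteq> (\<Union>c\<in>C. {y. dist c y < \<delta>})"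
    using assms unfolding totally_bounded_metric by blast
  moreover have "(\<Union>c\<in>C. {y. dist c y < \<delta>}) \<subseteq> (\<Union>c\<in>C. cball c \<delta>)" by (intro UN_mono) auto
  ultimately have "\<exists>k. \<exists>C. finite C \<and> card C = k \<and> Z \<subseteq> (\<Union>c\<in>C. cball c \<delta>)" by blast
  then show ?thesis unfolding covering_number_def by (rule LeastI_ex)
qed

lemma covering_number_pos:
  fixes Z :: "'z::metric_space set"
  assumes "totally_bounded Z" "\<delta> > 0" "Z \<noteq> {}"
  shows "covering_number Z \<delta> \<ge> 1"
proof (rule ccontr)
  assume "\<not> ?thesis"
  then have "covering_number Z \<delta> = 0" by simp
  with ex_finite_cball_cover[OF assms(1,2)] assms(3) show False by (metis UN_empty card_0_eq subset_empty)
qed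

text \<open>Each ball that meets Y is recentred at a point of Y, which doubles the radius. Chain
  points must lie in the slice, because the Lipschitz condition compares only points of the same
  slice.\<close>

lemma ex_internal_net:
  fixes Z :: "'z::metric_space set"
  assumes "totally_bounded Z" "\<delta> > 0" "Y \<subseteq> Z"
  shows "\<exists>C\<subseteq>Y. finite C \<and> card C \<le> covering_number Z \<delta> \<and> (\<forall>y\<in>Y. \<exists>c\<in>C. dist y c \<le> 2 * \<delta>)"
proof -
  obtain C where C: "finite C" "card C = covering_number Z \<delta>" "Z \<subseteq> (\<Union>c\<in>C. cball c \<delta>)"
    using ex_finite_cball_cover[OF assms(1,2)] by blast
  define C' where "C' = {c\<in>C. cball c \<delta> \<inter> Y \<noteq> {}}"
  define r where "r c = (SOME y. y \<in> cball c \<delta> \<inter> Y)" for c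
  have r: "r c \<in> cball c \<delta> \<inter> Y" if "c \<in> C'" for c
    unfolding r_def by (rule someI_ex) (use that in \<open>auto simp: C'_def\<close>)
  show ?thesis
  proof (intro exI[of _ "r ` C'"] conjI ballI)
    show "r ` C' \<subseteq> Y" using r by auto
    show "finite (r ` C')" using C by (simp add: C'_def)
    have "card (r ` C') \<le> card C'" using C by (intro card_image_le) (simp add: C'_def)
    also have "\<dots> \<le> card C" using C by (intro card_mono) (auto simp: C'_def)
    finally show "card (r ` C') \<le> covering_number Z \<delta>" using C by simp
    fix y assume y: "y \<in> Y"
    then obtain c where c: "c \<in> C" "y \<in> cball c \<delta>" using C(3) assms(3) by blast
    then have "c \<in> C'" using y by (auto simp: C'_def)
    moreover have "dist y (r c) \<le> dist c y + dist c (r c)" by (metis dist_commute dist_triangle)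
    ultimately show "\<exists>c\<in>r ` C'. dist y c \<le> 2 * \<delta>"
      using c r[of c] by (intro bexI[of _ "r c"]) auto
  qed
qed

section \<open>Deviation levels along the chain\<close>

text \<open>
  The deviation level of link \<open>k\<close> is \<open>chain_weight k * z\<close>. Its square is chosen so that the tail
  exponent exceeds the target exponent by \<open>9 * 2 ^ k / (k + 4)\<^sup>2\<close>, the weight of term \<open>k + 4\<close> of
  \<open>L_exp\<close>; the shift by 4 is due to the net radius \<open>\<epsilon> / 2 ^ (k + 2)\<close> and to internal nets
  doubling the covering radius.
\<close>

definition chain_weight :: "nat \<Rightarrow> real" where
  "chain_weight k = sqrt (1/2 + 9 * 2 ^ k / (real k + 4)\<^sup>2)"

lemma chain_weight_sq: "(chain_weight k)\<^sup>2 = 1/2 + 9 * 2 ^ k / (real k + 4)\<^sup>2"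
  unfolding chain_weight_def by (intro real_sqrt_pow2) auto

text \<open>Keeps all deviation levels at or above z, where the moment bounds hold. It amounts to (k
  + 4)^2 being at most 18 * 2^k, which reads 16 against 18 at k = 0.\<close>

lemma chain_weight_ge_1: "chain_weight k \<ge> 1"
proof -
  have "(real k + 4)\<^sup>2 \<le> 18 * 2 ^ k"
  proof (induction k)
    case (Suc k)
    have "(real (Suc k) + 4)\<^sup>2 = (real k + 4)\<^sup>2 + (2 * real k + 9)" by (simp add: power2_eq_square algebra_simps)
    moreover have "2 * real k + 9 \<le> (real k + 4)\<^sup>2" by (simp add: power2_eq_square algebra_simps)
    moreover have "18 * 2 ^ Suc k = 2 * (18 * 2 ^ k :: real)" by simp
    ultimately show ?case using Suc by linarith
  qed simp
  then have "1 \<le> 1/2 + 9 * 2 ^ k / (real k + 4)\<^sup>2"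
    by (simp add: field_simps add_pos_nonneg)
  then show ?thesis unfolding chain_weight_def by (intro real_le_rsqrt) simp
qed

lemma chain_weight_le_sq: "chain_weight k \<le> (chain_weight k)\<^sup>2"
  using mult_left_mono[OF chain_weight_ge_1, of "chain_weight k" k] chain_weight_ge_1[of k]
  by (simp add: power2_eq_square)

lemma sum_half_powers_le: "(\<Sum>k<K. 1 / 2 ^ (k + 2)) \<le> (1/2 :: real)"
proof -
  have "(\<Sum>k<K. 1 / 2 ^ (k + 2)) = 1/2 - 1 / (2 ^ (K + 1) :: real)"
    by (induction K) (auto simp: field_simps)
  then show ?thesis by simp
qed

text \<open>The two summands of the squared weight contribute at most 1/4 and 3/4, the latter by
  telescoping. The total 1 is what limits the inflation of the level to the factor
  \<open>1 + \<epsilon>\<close>.\<close>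

lemma sum_chain_weight_sq_le: "(\<Sum>k<K. (chain_weight k)\<^sup>2 / 2 ^ (k + 2)) \<le> 1"
proof -
  have sq: "(\<Sum>k<K. 1 / (real k + 4)\<^sup>2) \<le> 1/3 - 1 / (real K + 3)"
  proof (induction K)
    case (Suc K)
    have "1 / (real K + 4)\<^sup>2 \<le> 1 / ((real K + 3) * (real K + 4))"
      by (intro divide_left_mono) (auto simp: power2_eq_square)
    also have "\<dots> = 1 / (real K + 3) - 1 / (real (Suc K) + 3)"
      by (simp add: divide_simps)
    finally show ?case using Suc by simp
  qed simp
  have "(\<Sum>k<K. (chain_weight k)\<^sup>2 / 2 ^ (k + 2)) = (\<Sum>k<K. 1/2 * (1 / 2 ^ (k + 2)) + 9/4 * (1 / (real k + 4)\<^sup>2))"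
  proof (rule sum.cong[OF refl])
    fix k
    have "9 * 2 ^ k / (real k + 4)\<^sup>2 / 2 ^ (k + 2) = 9/4 * (1 / (real k + 4)\<^sup>2)"
      by (simp add: power_add)
    then show "(chain_weight k)\<^sup>2 / 2 ^ (k + 2) = 1/2 * (1 / 2 ^ (k + 2)) + 9/4 * (1 / (real k + 4)\<^sup>2)"
      unfolding chain_weight_sq add_divide_distrib by simp
  qed
  also have "\<dots> = 1/2 * (\<Sum>k<K. 1 / 2 ^ (k + 2)) + 9/4 * (\<Sum>k<K. 1 / (real k + 4)\<^sup>2)"
    by (simp only: sum.distrib sum_distrib_left)
  also have "\<dots> \<le> 1/2 * (1/2) + 9/4 * (1/3 - 1 / (real K + 3))"
    by (intro add_mono mult_left_mono sum_half_powers_le sq) auto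
  also have "\<dots> \<le> 1"
  proof -
    have le: "1/2 * (1/2) + 9/4 * (1/3 - a) \<le> 1" if "a \<ge> 0" for a :: real using that by (simp add: field_simps)
    show ?thesis by (rule le) simp
  qed
  finally show ?thesis .
qed

section \<open>The chaining argument\<close>

text \<open>Here \<open>sn\<close> is the norm of the centred sum of a weight and \<open>inc\<close>
  that of an increment. The additional level \<open>\<epsilon> * h z * b\<close> is spent as
  follows: half of its constant part and all of the part depending on z go to the links, the other
  half of the constant part covers the remainder below the deepest net.\<close>

lemma chaining_bound:
  fixes Z :: "'z::metric_space set" and sn :: "'z \<Rightarrow> 'x \<Rightarrow> real" and inc :: "'z \<Rightarrow> 'z \<Rightarrow> 'x \<Rightarrow> real"
    and \<alpha> \<beta> \<gamma> z \<epsilon> b q \<tau> D Q :: real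
  defines "h \<equiv> \<lambda>y. \<alpha> + \<beta> * y + \<gamma> * y\<^sup>2"
  assumes Z: "totally_bounded Z" "Y \<subseteq> Z" and N1: "\<And>\<delta>. \<delta> > 0 \<Longrightarrow> covering_number Z \<delta> \<ge> 1"
    and summ: "(\<lambda>k. exp (2 * metric_entropy Z (\<epsilon> * 2 powr (- real k)) - (9/16) * 2 ^ k * real k powr (-2))) summable_on {1..}"
    and par: "\<alpha> > 0" "\<beta> \<ge> 0" "\<gamma> \<ge> 0" "z \<ge> 0" "0 < \<epsilon>" "\<epsilon> \<le> 1" "b > 0" "q > 0" "D \<ge> 0" "Q \<ge> 0"
    and z\<tau>: "z\<^sup>2 * \<tau> \<ge> 1/2"
    and [measurable]: "\<And>\<zeta>. \<zeta> \<in> Y \<Longrightarrow> sn \<zeta> \<in> borel_measurable N"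
      "\<And>\<zeta> \<zeta>'. \<zeta> \<in> Y \<Longrightarrow> \<zeta>' \<in> Y \<Longrightarrow> inc \<zeta> \<zeta>' \<in> borel_measurable N"
    and tri: "\<And>\<zeta> \<zeta>' x. \<zeta> \<in> Y \<Longrightarrow> \<zeta>' \<in> Y \<Longrightarrow> sn \<zeta> x \<le> sn \<zeta>' x + inc \<zeta> \<zeta>' x"
    and lip: "\<And>\<zeta> \<zeta>' x. \<zeta> \<in> Y \<Longrightarrow> \<zeta>' \<in> Y \<Longrightarrow> inc \<zeta> \<zeta>' x \<le> D * dist \<zeta> \<zeta>'"
    and mom0: "\<And>\<zeta>. \<zeta> \<in> Y \<Longrightarrow>
      (\<integral>\<^sup>+x. ennreal (max 0 (sn \<zeta> x - h z * b) powr q) \<partial>N) \<le> ennreal (b powr q * Q * exp (- 2 * z\<^sup>2 * \<tau>))"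
    and mom1: "\<And>\<zeta> \<zeta>' \<delta> y. \<zeta> \<in> Y \<Longrightarrow> \<zeta>' \<in> Y \<Longrightarrow> \<delta> > 0 \<Longrightarrow> dist \<zeta> \<zeta>' \<le> \<delta> \<Longrightarrow> y \<ge> z \<Longrightarrow>
      (\<integral>\<^sup>+x. ennreal (max 0 (inc \<zeta> \<zeta>' x - h y * (b * \<delta>)) powr q) \<partial>N) \<le> ennreal ((b * \<delta>) powr q * Q * exp (- 2 * y\<^sup>2 * \<tau>))"
  obtains H where "H \<in> borel_measurable N"
    "\<And>x \<zeta>. \<zeta> \<in> Y \<Longrightarrow> ennreal (max 0 (sn \<zeta> x - (1 + \<epsilon>) * h z * b) powr q) \<le> H x"
    "(\<integral>\<^sup>+x. H x \<partial>N) \<le> ennreal (2 powr q * b powr q * Q * real (covering_number Z (\<epsilon> / 8)) * (1 + L_exp Z \<epsilon>) * exp (- z\<^sup>2 * \<tau>))"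
proof -
  define \<delta> where "\<delta> k = \<epsilon> / 2 ^ (k + 2)" for k :: nat
  have \<delta>: "\<delta> k > 0" for k using par by (simp add: \<delta>_def)
  define NN where "NN k = covering_number Z (\<epsilon> / 2 ^ (k + 3))" for k :: nat
  have "\<exists>C. C \<subseteq> Y \<and> finite C \<and> card C \<le> NN k \<and> (\<forall>y\<in>Y. \<exists>c\<in>C. dist y c \<le> \<delta> k)" for k
  proof -
    have "2 * (\<epsilon> / 2 ^ (k + 3)) = \<delta> k" by (simp add: \<delta>_def power_add)
    then show ?thesis using ex_internal_net[OF Z(1) _ Z(2), of "\<epsilon> / 2 ^ (k + 3)"] par by (auto simp: NN_def)
  qed
  then obtain C where C: "\<And>k. C k \<subseteq> Y" "\<And>k. finite (C k)" "\<And>k. card (C k) \<le> NN k"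
    "\<And>k y. y \<in> Y \<Longrightarrow> \<exists>c\<in>C k. dist y c \<le> \<delta> k" by metis
  define pr where "pr k y = (SOME c. c \<in> C k \<and> dist y c \<le> \<delta> k)" for k y
  have pr: "pr k y \<in> C k" "dist y (pr k y) \<le> \<delta> k" if "y \<in> Y" for k y
    using someI_ex[of "\<lambda>c. c \<in> C k \<and> dist y c \<le> \<delta> k"] C(4)[OF that, of k] unfolding pr_def by blast+
  define c where "c = chain_weight"
  define yk where "yk k = c k * z" for k
  have yk: "yk k \<ge> z" for k using mult_right_mono[OF chain_weight_ge_1[of k] par(4)] by (simp add: yk_def c_def)
  \<comment> \<open>Depth at which the deterministic bound for the last link fits into its share of
    the level.\<close>
  obtain K where K: "D * \<delta> K \<le> \<alpha> * \<epsilon> / 2 * b"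
  proof -
    obtain K where "D / (2 * \<alpha> * b) < 2 ^ K" using real_arch_pow[of 2 "D / (2 * \<alpha> * b)"] by auto
    then have "D * \<delta> K \<le> \<alpha> * \<epsilon> / 2 * b" using par by (simp add: \<delta>_def field_simps)
    then show ?thesis using that by blast
  qed
  define E0 where "E0 \<zeta> x = max 0 (sn \<zeta> x - h z * b)" for \<zeta> x
  define E1 where "E1 k \<zeta> x = max 0 (inc \<zeta> (pr k \<zeta>) x - h (yk k) * (b * \<delta> k))" for k \<zeta> x
  \<comment> \<open>With m the q-th root of H, the factors 2 and \<open>2 ^ (k + 2)\<close> force
    the individual excesses below m/2 and m/2^(k+2), which add up to at most m.\<close>
  define H where "H x = (\<Sum>\<zeta>\<in>C 0. (E0 \<zeta> x * 2) powr q) + (\<Sum>k<K. \<Sum>\<zeta>\<in>C (Suc k). (E1 k \<zeta> x * 2 ^ (k + 2)) powr q)" for x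
  have CY: "\<zeta> \<in> Y" if "\<zeta> \<in> C k" for \<zeta> k using C(1) that by blast
  have prY: "pr k \<zeta> \<in> Y" if "\<zeta> \<in> Y" for k \<zeta> using pr(1)[OF that] CY by blast
  have [measurable]: "E0 \<zeta> \<in> borel_measurable N" if "\<zeta> \<in> C k" for \<zeta> k
    using CY[OF that] unfolding E0_def by measurable
  have [measurable]: "E1 k \<zeta> \<in> borel_measurable N" if "\<zeta> \<in> C j" for \<zeta> k j
    using CY[OF that] prY[OF CY[OF that], of k] unfolding E1_def by measurable
  have Hm[measurable]: "H \<in> borel_measurable N" unfolding H_def by measurable
  have dom: "max 0 (sn \<zeta> x - (1 + \<epsilon>) * h z * b) powr q \<le> H x" if \<zeta>: "\<zeta> \<in> Y" for \<zeta> x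
  proof -
    define m where "m = H x powr (1 / q)"
    have H0: "H x \<ge> 0" unfolding H_def by (intro add_nonneg_nonneg sum_nonneg) auto
    have mq: "m powr q = H x" using H0 par by (simp add: m_def powr_powr)
    have m0: "m \<ge> 0" by (simp add: m_def)
    have root: "t \<le> m" if "t powr q \<le> H x" "t \<ge> 0" for t
      using powr_mono2[OF _ _ that(1), of "1/q"] that(2) par by (simp add: m_def powr_powr)
    have e0: "E0 c x \<le> m / 2" if "c \<in> C 0" for c
    proof -
      have "(E0 c x * 2) powr q \<le> (\<Sum>\<zeta>\<in>C 0. (E0 \<zeta> x * 2) powr q)"
        by (rule member_le_sum[OF that _ C(2)]) auto
      also have "\<dots> \<le> H x" unfolding H_def by (simp add: sum_nonneg)
      finally show ?thesis using root[of "E0 c x * 2"] by (simp add: E0_def)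
    qed
    have e1: "E1 k c x \<le> m / 2 ^ (k + 2)" if "k < K" "c \<in> C (Suc k)" for k c
    proof -
      have "(E1 k c x * 2 ^ (k + 2)) powr q \<le> (\<Sum>\<zeta>\<in>C (Suc k). (E1 k \<zeta> x * 2 ^ (k + 2)) powr q)"
        by (rule member_le_sum[OF that(2) _ C(2)]) auto
      also have "\<dots> \<le> (\<Sum>k<K. \<Sum>\<zeta>\<in>C (Suc k). (E1 k \<zeta> x * 2 ^ (k + 2)) powr q)"
        using that(1) by (intro member_le_sum[of k "{..<K}" "\<lambda>k. \<Sum>\<zeta>\<in>C (Suc k). (E1 k \<zeta> x * 2 ^ (k + 2)) powr q"]) (auto intro!: sum_nonneg)
      also have "\<dots> \<le> H x" unfolding H_def by (simp add: sum_nonneg)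
      finally have "E1 k c x * 2 ^ (k + 2) \<le> m" using root[of "E1 k c x * 2 ^ (k+2)"] by (simp add: E1_def)
      then show ?thesis by (simp add: pos_le_divide_eq)
    qed
    \<comment> \<open>Every link starts at a net point of level j + 1 and leads to the projection of
      that point to level j, so the number of links at a level is the size of one net and not of a
      product of two.\<close>
    have chain: "sn c x \<le> h z * b + m / 2 + (\<Sum>k<j. h (yk k) * (b * \<delta> k) + m / 2 ^ (k + 2))" if "c \<in> C j" "j \<le> K" for c j
      using that
    proof (induction j arbitrary: c)
      case 0
      moreover have "sn c x - h z * b \<le> E0 c x" by (simp add: E0_def)
      ultimately show ?case using e0[of c] by simp
    next
      case (Suc j)
      have cY: "c \<in> Y" using CY Suc by blast
      have "sn c x \<le> sn (pr j c) x + inc c (pr j c) x" by (rule tri[OF cY prY[OF cY]])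
      moreover have "inc c (pr j c) x - h (yk j) * (b * \<delta> j) \<le> E1 j c x" by (simp add: E1_def)
      moreover have "E1 j c x \<le> m / 2 ^ (j + 2)" using e1[of j c] Suc.prems by simp
      ultimately show ?case using Suc.IH[OF pr(1)[OF cY]] Suc.prems by simp
    qed
    have "sn \<zeta> x \<le> sn (pr K \<zeta>) x + inc \<zeta> (pr K \<zeta>) x" by (rule tri[OF \<zeta> prY[OF \<zeta>]])
    also have "inc \<zeta> (pr K \<zeta>) x \<le> D * dist \<zeta> (pr K \<zeta>)" by (rule lip[OF \<zeta> prY[OF \<zeta>]])
    also have "\<dots> \<le> D * \<delta> K" using pr(2)[OF \<zeta>] par by (intro mult_left_mono) auto
    also have "\<dots> \<le> \<alpha> * \<epsilon> / 2 * b" by (rule K)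
    also have "sn (pr K \<zeta>) x \<le> h z * b + m / 2 + (\<Sum>k<K. h (yk k) * (b * \<delta> k) + m / 2 ^ (k + 2))"
      by (rule chain[OF pr(1)[OF \<zeta>]]) simp
    also have "(\<Sum>k<K. h (yk k) * (b * \<delta> k) + m / 2 ^ (k + 2)) = b * (\<Sum>k<K. h (yk k) * \<delta> k) + m * (\<Sum>k<K. 1 / 2 ^ (k + 2))"
      by (simp add: sum.distrib sum_distrib_left mult_ac)
    also have "m * (\<Sum>k<K. 1 / 2 ^ (k + 2)) \<le> m * (1/2)" by (intro mult_left_mono sum_half_powers_le m0)
    also have "(\<Sum>k<K. h (yk k) * \<delta> k) \<le> \<alpha> * \<epsilon> / 2 + (\<beta> * z + \<gamma> * z\<^sup>2) * \<epsilon>"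
    proof -
      have "(\<Sum>k<K. h (yk k) * \<delta> k) \<le> (\<Sum>k<K. \<alpha> * \<epsilon> * (1 / 2 ^ (k + 2)) + (\<beta> * z + \<gamma> * z\<^sup>2) * \<epsilon> * ((c k)\<^sup>2 / 2 ^ (k + 2)))"
      proof (rule sum_mono)
        fix k
        \<comment> \<open>Weights are at least 1, so the linear part of the level can be bounded
          with the squared weight as well and one sum controls both parts.\<close>
        have "\<beta> * (c k * z) \<le> \<beta> * ((c k)\<^sup>2 * z)"
          using par chain_weight_le_sq[of k] by (intro mult_left_mono mult_right_mono) (auto simp: c_def)
        then have "h (yk k) \<le> \<alpha> + (\<beta> * z + \<gamma> * z\<^sup>2) * (c k)\<^sup>2"
          by (simp add: h_def yk_def power_mult_distrib algebra_simps)
        from mult_right_mono[OF this less_imp_le[OF \<delta>[of k]]]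
        show "h (yk k) * \<delta> k \<le> \<alpha> * \<epsilon> * (1 / 2 ^ (k + 2)) + (\<beta> * z + \<gamma> * z\<^sup>2) * \<epsilon> * ((c k)\<^sup>2 / 2 ^ (k + 2))"
          by (simp add: \<delta>_def algebra_simps add_divide_distrib)
      qed
      also have "\<dots> = \<alpha> * \<epsilon> * (\<Sum>k<K. 1 / 2 ^ (k + 2)) + (\<beta> * z + \<gamma> * z\<^sup>2) * \<epsilon> * (\<Sum>k<K. (c k)\<^sup>2 / 2 ^ (k + 2))"
        by (simp only: sum.distrib sum_distrib_left)
      also have "\<dots> \<le> \<alpha> * \<epsilon> * (1/2) + (\<beta> * z + \<gamma> * z\<^sup>2) * \<epsilon> * 1"
        using par unfolding c_def
        by (intro add_mono mult_left_mono sum_half_powers_le sum_chain_weight_sq_le) auto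
      finally show ?thesis by simp
    qed
    finally have "sn \<zeta> x \<le> h z * b + m / 2 + (b * (\<alpha> * \<epsilon> / 2 + (\<beta> * z + \<gamma> * z\<^sup>2) * \<epsilon>) + m * (1/2)) + \<alpha> * \<epsilon> / 2 * b"
      using par by (simp add: mult_left_mono)
    also have "\<dots> = (1 + \<epsilon>) * h z * b + m" by (simp add: h_def algebra_simps)
    finally have "max 0 (sn \<zeta> x - (1 + \<epsilon>) * h z * b) \<le> m" using m0 by simp
    then have "max 0 (sn \<zeta> x - (1 + \<epsilon>) * h z * b) powr q \<le> m powr q" using par by (intro powr_mono2) auto
    then show ?thesis by (simp add: mq)
  qed
  define T where "T = (2 * b) powr q * Q * exp (- z\<^sup>2 * \<tau>)"
  have T0: "T \<ge> 0" using par by (simp add: T_def)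
  have ez: "- 2 * z\<^sup>2 * \<tau> \<le> - z\<^sup>2 * \<tau>"
  proof -
    have "- 2 * z\<^sup>2 * \<tau> = - 2 * (z\<^sup>2 * \<tau>)" "- z\<^sup>2 * \<tau> = - (z\<^sup>2 * \<tau>)" by simp_all
    then show ?thesis using z\<tau> by linarith
  qed
  define ell where "ell k = exp (- (9 * 2 ^ k / (real k + 4)\<^sup>2))" for k :: nat
  have i0: "(\<integral>\<^sup>+x. ennreal ((E0 \<zeta> x * 2) powr q) \<partial>N) \<le> ennreal T" if "\<zeta> \<in> C 0" for \<zeta>
  proof -
    have "(\<integral>\<^sup>+x. ennreal ((E0 \<zeta> x * 2) powr q) \<partial>N) = (\<integral>\<^sup>+x. ennreal (2 powr q) * ennreal (E0 \<zeta> x powr q) \<partial>N)"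
      by (intro nn_integral_cong) (simp add: powr_mult ennreal_mult[symmetric] E0_def mult.commute)
    also have "\<dots> = ennreal (2 powr q) * (\<integral>\<^sup>+x. ennreal (E0 \<zeta> x powr q) \<partial>N)"
      by (rule nn_integral_cmult) (use that in measurable)
    also have "\<dots> \<le> ennreal (2 powr q) * ennreal (b powr q * Q * exp (- 2 * z\<^sup>2 * \<tau>))"
      unfolding E0_def by (intro mult_left_mono mom0 CY[OF that]) auto
    also have "\<dots> = ennreal ((2 * b) powr q * Q * exp (- 2 * z\<^sup>2 * \<tau>))"
      using par by (simp add: ennreal_mult[symmetric] powr_mult mult.assoc)
    also have "\<dots> \<le> ennreal T"
      unfolding T_def using par ez by (intro ennreal_leI mult_left_mono) auto
    finally show ?thesis .
  qed
  have i1: "(\<integral>\<^sup>+x. ennreal ((E1 k \<zeta> x * 2 ^ (k + 2)) powr q) \<partial>N) \<le> ennreal (T * ell k)" if "\<zeta> \<in> C (Suc k)" for \<zeta> k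
  proof -
    have \<zeta>Y: "\<zeta> \<in> Y" using CY that by blast
    have "(\<integral>\<^sup>+x. ennreal ((E1 k \<zeta> x * 2 ^ (k + 2)) powr q) \<partial>N) = (\<integral>\<^sup>+x. ennreal ((2 ^ (k + 2)) powr q) * ennreal (E1 k \<zeta> x powr q) \<partial>N)"
      by (intro nn_integral_cong) (simp only: ennreal_mult[symmetric] powr_ge_zero powr_mult mult.commute E1_def)
    also have "\<dots> = ennreal ((2 ^ (k + 2)) powr q) * (\<integral>\<^sup>+x. ennreal (E1 k \<zeta> x powr q) \<partial>N)"
      by (rule nn_integral_cmult) (use that in measurable)
    also have "\<dots> \<le> ennreal ((2 ^ (k + 2)) powr q) * ennreal ((b * \<delta> k) powr q * Q * exp (- 2 * (yk k)\<^sup>2 * \<tau>))"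
      unfolding E1_def by (intro mult_left_mono mom1 \<zeta>Y prY \<delta> pr(2) yk) auto
    also have "\<dots> = ennreal ((2 ^ (k + 2)) powr q * (b * \<delta> k) powr q * Q * exp (- 2 * (yk k)\<^sup>2 * \<tau>))"
      using par by (simp add: ennreal_mult[symmetric] mult.assoc)
    \<comment> \<open>The length of the link cancels the factor from its share of m, so a link costs
      no more than the initial level apart from its exponential.\<close>
    also have "(2 ^ (k + 2)) powr q * (b * \<delta> k) powr q = (b * \<epsilon>) powr q"
    proof -
      have "2 ^ (k + 2) * (b * \<delta> k) = b * \<epsilon>" by (simp add: \<delta>_def)
      moreover have "(2 ^ (k + 2)) powr q * (b * \<delta> k) powr q = (2 ^ (k + 2) * (b * \<delta> k)) powr q"
        using par \<delta>[of k] by (subst powr_mult) auto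
      ultimately show ?thesis by (simp only:)
    qed
    also have "ennreal ((b * \<epsilon>) powr q * Q * exp (- 2 * (yk k)\<^sup>2 * \<tau>)) \<le> ennreal ((2 * b) powr q * Q * (exp (- z\<^sup>2 * \<tau>) * ell k))"
    proof -
      have p: "(b * \<epsilon>) powr q \<le> (2 * b) powr q"
        using par by (intro powr_mono2) (auto simp: mult.commute[of b])
      \<comment> \<open>Squaring the weight splits the exponent: the summand 1/2 returns the final
        rate, and the other summand is multiplied by \<open>2 * (z\<^sup>2 * \<tau>)\<close>, which
        is at least 1.\<close>
      have "9 * 2 ^ k / (real k + 4)\<^sup>2 * 1 \<le> 9 * 2 ^ k / (real k + 4)\<^sup>2 * (2 * (z\<^sup>2 * \<tau>))"
        using z\<tau> by (intro mult_left_mono) auto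
      moreover have "2 * (yk k)\<^sup>2 * \<tau> = z\<^sup>2 * \<tau> + 9 * 2 ^ k / (real k + 4)\<^sup>2 * (2 * (z\<^sup>2 * \<tau>))"
        by (simp only: yk_def c_def power_mult_distrib chain_weight_sq) (simp add: algebra_simps)
      ultimately have e: "exp (- 2 * (yk k)\<^sup>2 * \<tau>) \<le> exp (- z\<^sup>2 * \<tau>) * ell k"
        by (simp add: ell_def exp_add[symmetric])
      show ?thesis
        by (intro ennreal_leI mult_mono[OF mult_right_mono[OF p] e]) (use par in auto)
    qed
    finally show ?thesis by (simp add: T_def mult.assoc)
  qed
  have L: "(\<Sum>k<K. real (NN (Suc k)) * ell k) \<le> L_exp Z \<epsilon>"
  proof -
    define g where "g = (\<lambda>k. exp (2 * metric_entropy Z (\<epsilon> * 2 powr (- real k)) - (9/16) * 2 ^ k * real k powr (-2)))"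
    have gs: "g summable_on {1..}" unfolding g_def by (rule summ)
    \<comment> \<open>Link k uses the covering radius of term k + 4 of \<open>L_exp\<close>. That
      term contains the squared covering number, so one factor, being at least 1, is
      dropped.\<close>
    have "(\<Sum>k<K. real (NN (Suc k)) * ell k) \<le> (\<Sum>k<K. g (k + 4))"
    proof (rule sum_mono)
      fix k
      have r: "\<epsilon> * 2 powr (- real (k + 4)) = \<epsilon> / 2 ^ (Suc k + 3)"
      proof -
        have "2 powr (- real (k + 4)) = 1 / (2 ^ (k + 4) :: real)"
          by (subst powr_minus_divide, subst powr_realpow) auto
        moreover have "Suc k + 3 = k + 4" by simp
        ultimately show ?thesis by (simp only: times_divide_eq_right mult_1_right)
      qed
      have N: "real (NN (Suc k)) \<ge> 1" using N1[of "\<epsilon> / 2 ^ (Suc k + 3)"] par by (simp add: NN_def)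
      have "(9/16) * 2 ^ (k + 4) * real (k + 4) powr (-2) = 9 * 2 ^ k / (real k + 4)\<^sup>2"
        by (simp add: powr_minus_divide power_add)
      then have "g (k + 4) = exp (ln (real (NN (Suc k)))) * exp (ln (real (NN (Suc k)))) * ell k"
        by (simp only: g_def metric_entropy_def r NN_def ell_def exp_add[symmetric]) simp
      also have "\<dots> = real (NN (Suc k)) * (real (NN (Suc k)) * ell k)" using N by simp
      also have "\<dots> \<ge> 1 * (real (NN (Suc k)) * ell k)" using N by (intro mult_right_mono) (auto simp: ell_def)
      finally show "real (NN (Suc k)) * ell k \<le> g (k + 4)" by simp
    qed
    also have "\<dots> = sum g ((\<lambda>k. k + 4) ` {..<K})" by (subst sum.reindex) (auto simp: inj_on_def)
    also have "\<dots> \<le> infsum g {1..}"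
      by (rule finite_sum_le_infsum[OF gs]) (auto simp: g_def)
    finally show ?thesis by (simp add: L_exp_def g_def)
  qed
  have L0: "L_exp Z \<epsilon> \<ge> 0" by (rule order_trans[OF sum_nonneg L]) (auto simp: ell_def)
  have "(\<integral>\<^sup>+x. ennreal (H x) \<partial>N) = (\<integral>\<^sup>+x. (\<Sum>\<zeta>\<in>C 0. ennreal ((E0 \<zeta> x * 2) powr q))
      + (\<Sum>k<K. \<Sum>\<zeta>\<in>C (Suc k). ennreal ((E1 k \<zeta> x * 2 ^ (k + 2)) powr q)) \<partial>N)"
    unfolding H_def by (intro nn_integral_cong) (simp add: sum_nonneg ennreal_plus sum_ennreal)
  also have "\<dots> = (\<Sum>\<zeta>\<in>C 0. \<integral>\<^sup>+x. ennreal ((E0 \<zeta> x * 2) powr q) \<partial>N)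
      + (\<Sum>k<K. \<Sum>\<zeta>\<in>C (Suc k). \<integral>\<^sup>+x. ennreal ((E1 k \<zeta> x * 2 ^ (k + 2)) powr q) \<partial>N)"
    by (simp add: nn_integral_add nn_integral_sum del: sum_ennreal)
  also have "\<dots> \<le> (\<Sum>\<zeta>\<in>C 0. ennreal T) + (\<Sum>k<K. \<Sum>\<zeta>\<in>C (Suc k). ennreal (T * ell k))"
    by (intro add_mono sum_mono i0 i1) auto
  also have "\<dots> = ennreal (real (card (C 0)) * T + (\<Sum>k<K. real (card (C (Suc k))) * (T * ell k)))"
    using T0 by (simp add: ennreal_of_nat_eq_real_of_nat ennreal_mult[symmetric] ell_def sum_nonneg)
  also have "\<dots> \<le> ennreal (real (NN 0) * T + T * L_exp Z \<epsilon>)"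
  proof (intro ennreal_leI add_mono mult_right_mono T0)
    show "real (card (C 0)) \<le> real (NN 0)" using C(3) by simp
    have "(\<Sum>k<K. real (card (C (Suc k))) * (T * ell k)) \<le> (\<Sum>k<K. real (NN (Suc k)) * (T * ell k))"
      using C(3) T0 by (intro sum_mono mult_right_mono) (auto simp: ell_def)
    also have "\<dots> = T * (\<Sum>k<K. real (NN (Suc k)) * ell k)" by (simp add: sum_distrib_left mult_ac)
    also have "\<dots> \<le> T * L_exp Z \<epsilon>" by (intro mult_left_mono L T0)
    finally show "(\<Sum>k<K. real (card (C (Suc k))) * (T * ell k)) \<le> T * L_exp Z \<epsilon>" .
  qed
  also have "\<dots> \<le> ennreal (2 powr q * b powr q * Q * real (covering_number Z (\<epsilon> / 8)) * (1 + L_exp Z \<epsilon>) * exp (- z\<^sup>2 * \<tau>))"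
  proof (rule ennreal_leI)
    have N0: "NN 0 = covering_number Z (\<epsilon> / 8)" by (simp add: NN_def)
    have "real (NN 0) \<ge> 1" using N1[of "\<epsilon> / 8"] par by (simp add: N0)
    then have "1 * (T * L_exp Z \<epsilon>) \<le> real (NN 0) * (T * L_exp Z \<epsilon>)" using T0 L0 by (intro mult_right_mono) auto
    then have "real (NN 0) * T + T * L_exp Z \<epsilon> \<le> real (NN 0) * T * (1 + L_exp Z \<epsilon>)" by (simp add: algebra_simps)
    also have "\<dots> = 2 powr q * b powr q * Q * real (covering_number Z (\<epsilon> / 8)) * (1 + L_exp Z \<epsilon>) * exp (- z\<^sup>2 * \<tau>)"
      unfolding T_def N0 using par by (simp add: powr_mult mult_ac)
    finally show "real (NN 0) * T + T * L_exp Z \<epsilon> \<le> 2 powr q * b powr q * Q * real (covering_number Z (\<epsilon> / 8)) * (1 + L_exp Z \<epsilon>) * exp (- z\<^sup>2 * \<tau>)" .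
  qed
  finally show ?thesis using Hm dom by (intro that[of "\<lambda>x. ennreal (H x)"]) (auto intro: ennreal_leI)
qed

section \<open>Convergence of the entropy series\<close>

text \<open>The entropy grows like 2^(\<open>\<beta>\<close> k) with \<open>\<beta>\<close> below 1
  and loses against 2^k / k^2, so the exponent is eventually below -k. A divergent
  \<open>infsum\<close> would have the value 0 and bound nothing, hence convergence must be
  established before \<open>L_exp\<close> can dominate partial sums.\<close>

lemma L_exp_summable:
  fixes Z :: "'z::metric_space set"
  assumes "entropy_condition Z" and \<epsilon>: "0 < \<epsilon>" "\<epsilon> \<le> 1"
  shows "(\<lambda>k. exp (2 * metric_entropy Z (\<epsilon> * 2 powr (- real k)) - (9/16) * 2 ^ k * real k powr (-2))) summable_on {1..}"
    (is "?g summable_on _")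
proof -
  obtain \<beta> C where \<beta>: "0 < \<beta>" "\<beta> < 1" and "\<forall>\<delta>\<in>{0<..<1}. ln (real (covering_number Z \<delta>)) - \<delta> powr (- \<beta>) \<le> C"
    using assms(1) unfolding entropy_condition_def bdd_above_def by auto
  then have C: "metric_entropy Z \<delta> \<le> C + \<delta> powr (- \<beta>)" if "0 < \<delta>" "\<delta> < 1" for \<delta>
    using that by (force simp: metric_entropy_def)
  define a where "a = 2 * \<epsilon> powr (- \<beta>)"
  have a: "a > 0" using \<epsilon> by (simp add: a_def)
  have "eventually (\<lambda>k. 2 * C + a * 2 powr (\<beta> * real k) - (9/16) * 2 ^ k * real k powr (-2) \<le> - real k) sequentially"
    using \<beta> a by real_asymp
  then have ev: "eventually (\<lambda>k. norm (?g k) \<le> exp (-1) ^ k) sequentially"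
    using eventually_gt_at_top[of 0]
  proof eventually_elim
    case (elim k)
    \<comment> \<open>The entropy condition concerns radii below 1, and \<open>\<epsilon>\<close>
      may equal 1; k > 0 makes the radius strictly smaller.\<close>
    have "2 powr (- real k) < 2 powr 0" using elim by (intro powr_less_mono) auto
    then have "\<epsilon> * 2 powr (- real k) < 1 * 1" using \<epsilon> by (intro mult_le_less_imp_less) auto
    then have "metric_entropy Z (\<epsilon> * 2 powr (- real k)) \<le> C + (\<epsilon> * 2 powr (- real k)) powr (- \<beta>)"
      using \<epsilon> by (intro C) auto
    also have "(\<epsilon> * 2 powr (- real k)) powr (- \<beta>) = \<epsilon> powr (- \<beta>) * 2 powr (\<beta> * real k)"
      using \<epsilon> by (simp add: powr_mult powr_powr mult.commute)
    finally have "2 * metric_entropy Z (\<epsilon> * 2 powr (- real k)) \<le> 2 * C + a * 2 powr (\<beta> * real k)" by (simp add: a_def)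
    then have "?g k \<le> exp (- real k)" using elim by simp
    also have "exp (- real k) = exp (-1) ^ k" by (simp add: exp_of_nat_mult[symmetric])
    finally show ?case by simp
  qed
  have "summable ?g"
    by (rule summable_comparison_test_ev[OF ev]) (intro summable_geometric; simp)
  then have "?g summable_on UNIV" by (rule summable_nonneg_imp_summable_on) simp
  then show ?thesis by (rule summable_on_subset) simp
qed

section \<open>The norm of the centred sum as a seminorm in the weight\<close>

context translation_law
begin

lemma lp_le_sum_norm:
  assumes "s \<ge> 1" "lp_le lborel s w B" "finite I"
  shows "lp_le lborel s (sum_ctr w I x) (sum_norm s w I x)"
proof -
  note l = lp_le_sum_ctr[OF assms, of x]
  show ?thesis
    by (rule lp_leI_integral) (use lp_le_integral[OF l] l assms in \<open>auto simp: sum_norm_def powr_powr lp_le_def\<close>)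
qed

lemma sum_norm_le:
  assumes "s \<ge> 1" "lp_le lborel s (sum_ctr w I x) A"
  shows "sum_norm s w I x \<le> A"
proof -
  have A: "A \<ge> 0" using assms by (simp add: lp_le_def)
  have "sum_norm s w I x \<le> (A powr s) powr (1 / s)"
    unfolding sum_norm_def using lp_le_integral(2)[OF assms(2)] assms(1) by (intro powr_mono2) auto
  then show ?thesis using A assms(1) by (simp add: powr_powr)
qed

lemma sum_norm_bound:
  assumes "s \<ge> 1" "lp_le lborel s w B" "finite I"
  shows "sum_norm s w I x \<le> real (card I) * (2 * B)"
  by (rule sum_norm_le[OF assms(1) lp_le_sum_ctr[OF assms]])

text \<open>Minkowski's inequality after a decomposition of the centred sum that is established
  almost everywhere only, because \<open>cmean\<close> is additive where both translates are
  integrable.\<close>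

lemma sum_norm_triangle:
  assumes s: "s \<ge> 1" and w: "lp_le lborel s w A" and v: "lp_le lborel s v B" and I: "finite I"
  shows "sum_norm s w I x \<le> sum_norm s v I x + sum_norm s (\<lambda>t. w t - v t) I x"
proof (rule sum_norm_le[OF s])
  have d: "lp_le lborel s (\<lambda>t. w t - v t) (A + B)" by (rule lp_le_diff[OF s w v])
  have [measurable]: "w \<in> borel_measurable borel" using w by (auto simp: lp_le_def)
  have sum: "lp_le lborel s (\<lambda>t. sum_ctr v I x t + sum_ctr (\<lambda>t. w t - v t) I x t)
      (sum_norm s v I x + sum_norm s (\<lambda>t. w t - v t) I x)"
    by (intro lp_le_add s lp_le_sum_norm[OF s v I] lp_le_sum_norm[OF s d I])
  show "lp_le lborel s (sum_ctr w I x) (sum_norm s v I x + sum_norm s (\<lambda>t. w t - v t) I x)"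
  proof (rule lp_le_AE_cong[OF sum])
    show "AE t in lborel. sum_ctr w I x t = sum_ctr v I x t + sum_ctr (\<lambda>t. w t - v t) I x t"
      using AE_integrable_translate[OF s w] AE_integrable_translate[OF s v]
    proof eventually_elim
      case (elim t)
      then have "ctr w y t = ctr v y t + ctr (\<lambda>t. w t - v t) y t" for y
        by (simp add: ctr_def cmean_def)
      then show ?case by (simp add: sum_ctr_def sum.distrib)
    qed
    show "sum_ctr w I x \<in> borel_measurable lborel" unfolding sum_ctr_def by measurable
  qed
qed

end

section \<open>Slices and the Lipschitz condition\<close>

lemma ennreal_mult_le_iff_le_divide:
  assumes "c > 0" "b \<ge> 0"
  shows "ennreal c * x \<le> ennreal b \<longleftrightarrow> x \<le> ennreal (b / c)"
  using assms by (cases x) (auto simp: ennreal_mult[symmetric] ennreal_le_iff field_simps ennreal_mult_top top_unique)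

lemma ennreal_divide_le_imp_le_mult:
  assumes "x / ennreal d \<le> ennreal b" "d > 0" "b \<ge> 0"
  shows "x \<le> ennreal b * ennreal d"
  using assms by (cases x)
    (auto simp: divide_ennreal ennreal_mult[symmetric] ennreal_le_iff field_simps ennreal_top_divide top_unique)

lemma slice_lp_le:
  assumes n: "n \<ge> 1" and p: "p > 0" and b: "b \<ge> 0"
    and "\<zeta> \<in> slice n p \<phi> Z (ennreal b)" "\<phi> \<zeta> \<in> borel_measurable borel"
  shows "lp_le lborel p (\<phi> \<zeta>) (b / real n powr (1 / p))"
proof -
  have "Lp_norm p (\<phi> \<zeta>) \<le> ennreal (b / real n powr (1 / p))"
    using assms by (subst ennreal_mult_le_iff_le_divide[symmetric]) (auto simp: slice_def)
  then show ?thesis using assms by (subst (asm) Lp_norm_le_iff) auto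
qed

lemma slice_increment_lp_le:
  fixes Z :: "'z::metric_space set"
  assumes n: "n \<ge> 1" and p: "p > 0" and b: "b > 0"
    and L: "lipschitz_slices n p \<phi> Z" and up: "ennreal b \<le> w_upper n p (\<phi> ` Z)"
    and \<zeta>: "\<zeta>1 \<in> slice n p \<phi> Z (ennreal b)" "\<zeta>2 \<in> slice n p \<phi> Z (ennreal b)"
    and m: "\<phi> \<zeta>1 \<in> borel_measurable borel" "\<phi> \<zeta>2 \<in> borel_measurable borel"
  shows "lp_le lborel p (\<lambda>t. \<phi> \<zeta>1 t - \<phi> \<zeta>2 t) (b * dist \<zeta>1 \<zeta>2 / real n powr (1 / p))"
proof (cases "\<zeta>1 = \<zeta>2")
  case True
  then show ?thesis by (simp add: lp_le_zero)
next
  case False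
  then have d: "dist \<zeta>1 \<zeta>2 > 0" by simp
  \<comment> \<open>The slice contains a point, so b lies in the range for which the Lipschitz bound
    is assumed.\<close>
  have "w_lower n p (\<phi> ` Z) \<le> ennreal (real n powr (1 / p)) * Lp_norm p (\<phi> \<zeta>1)"
    unfolding w_lower_def using \<zeta> by (intro mult_left_mono INF_lower) (auto simp: slice_def)
  also have "\<dots> \<le> ennreal b" using \<zeta> by (simp add: slice_def)
  finally have "w_lower n p (\<phi> ` Z) \<le> ennreal b" .
  with L up have "(SUP (\<zeta>1, \<zeta>2)\<in>{(\<zeta>1, \<zeta>2). \<zeta>1 \<in> slice n p \<phi> Z (ennreal b) \<and> \<zeta>2 \<in> slice n p \<phi> Z (ennreal b) \<and> \<zeta>1 \<noteq> \<zeta>2}.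
           ennreal (real n powr (1 / p)) * Lp_norm p (\<lambda>x. \<phi> \<zeta>1 x - \<phi> \<zeta>2 x) / ennreal (dist \<zeta>1 \<zeta>2)) \<le> ennreal b"
    unfolding lipschitz_slices_def by auto
  then have "ennreal (real n powr (1 / p)) * Lp_norm p (\<lambda>x. \<phi> \<zeta>1 x - \<phi> \<zeta>2 x) / ennreal (dist \<zeta>1 \<zeta>2) \<le> ennreal b"
    using \<zeta> False unfolding SUP_le_iff by (auto dest!: bspec[of _ _ "(\<zeta>1, \<zeta>2)"])
  then have "ennreal (real n powr (1 / p)) * Lp_norm p (\<lambda>x. \<phi> \<zeta>1 x - \<phi> \<zeta>2 x) \<le> ennreal b * ennreal (dist \<zeta>1 \<zeta>2)"
    by (rule ennreal_divide_le_imp_le_mult[OF _ d less_imp_le[OF b]])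
  also have "\<dots> = ennreal (b * dist \<zeta>1 \<zeta>2)" using b by (simp add: ennreal_mult)
  finally have "Lp_norm p (\<lambda>x. \<phi> \<zeta>1 x - \<phi> \<zeta>2 x) \<le> ennreal (b * dist \<zeta>1 \<zeta>2 / real n powr (1 / p))"
    using n b by (subst (asm) ennreal_mult_le_iff_le_divide) auto
  then show ?thesis using p b m by (subst (asm) Lp_norm_le_iff) auto
qed

section \<open>Peeling and the main bounds\<close>

lemma epowr_ennreal: "0 \<le> a \<Longrightarrow> epowr (ennreal a) r = ennreal (a powr r)"
  by (simp add: epowr_def)

text \<open>A geometric series of ratio 2^(-q \<open>\<epsilon>\<close>); it accounts for the
  denominator in \<open>T_common\<close>.\<close>

lemma geometric_powr_sum_le:
  assumes "q > 0" "\<epsilon> > (0::real)"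
  shows "(\<Sum>j<J. (2 powr (- \<epsilon> * real j)) powr q) \<le> 2 powr (q * \<epsilon>) / (2 powr (q * \<epsilon>) - 1)"
proof -
  define r where "r = 2 powr (- (q * \<epsilon>))"
  have g: "2 powr (q * \<epsilon>) > 1" using assms by simp
  have r: "r = 1 / 2 powr (q * \<epsilon>)" by (simp add: r_def powr_minus_divide)
  have r01: "0 < r" "r < 1" using g by (simp_all add: r)
  have "(\<Sum>j<J. (2 powr (- \<epsilon> * real j)) powr q) = (\<Sum>j<J. r ^ j)"
  proof (rule sum.cong[OF refl])
    fix j
    have "(2 powr (- \<epsilon> * real j)) powr q = r powr real j"
      by (simp add: r_def powr_powr mult_ac)
    also have "\<dots> = r ^ j" using r01 by (simp add: powr_realpow)
    finally show "(2 powr (- \<epsilon> * real j)) powr q = r ^ j" .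
  qed
  also have "\<dots> \<le> (\<Sum>j. r ^ j)" using r01 by (intro sum_le_suminf summable_geometric) auto
  also have "\<dots> = 1 / (1 - r)" using r01 by (intro suminf_geometric) auto
  also have "\<dots> = 2 powr (q * \<epsilon>) / (2 powr (q * \<epsilon>) - 1)" using g by (simp add: r field_simps)
  finally show ?thesis .
qed

text \<open>One number of shells works for all a, because the shells shrink to 0 while a stays above
  the positive l. The shell of a is found from the least index whose radius falls strictly below
  a.\<close>

lemma peeling_index:
  assumes "W > 0" "\<epsilon> > (0::real)" "l > 0"
  shows "\<exists>J. \<forall>a. l \<le> a \<longrightarrow> a \<le> W \<longrightarrow>
    (\<exists>j<J. a \<le> W * 2 powr (- \<epsilon> * real j) \<and> W * 2 powr (- \<epsilon> * real (Suc j)) < a)"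
proof -
  define b where "b j = W * 2 powr (- \<epsilon> * real j)" for j
  have "b \<longlonglongrightarrow> 0" unfolding b_def using assms by real_asymp
  then have "eventually (\<lambda>j. b j < l) sequentially" using assms by (intro order_tendstoD)
  then obtain J where J: "b J < l" by (auto simp: eventually_sequentially)
  show ?thesis
  proof (rule exI[of _ J], intro allI impI)
    fix a assume a: "l \<le> a" "a \<le> W"
    define i where "i = (LEAST i. b i < a)"
    have ex: "b J < a" using J a by simp
    have i: "b i < a" "i \<le> J" unfolding i_def using ex by (auto intro: LeastI Least_le)
    have "b 0 = W" using assms by (simp add: b_def)
    then have "i \<noteq> 0" using i(1) a by (intro notI) simp
    then obtain j where j: "i = Suc j" by (cases i) auto
    have "\<not> b j < a" using not_less_Least[of j "\<lambda>i. b i < a"] j by (simp add: i_def[symmetric])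
    then show "\<exists>j<J. a \<le> W * 2 powr (- \<epsilon> * real j) \<and> W * 2 powr (- \<epsilon> * real (Suc j)) < a"
      using i j by (intro exI[of _ j]) (auto simp: b_def)
  qed
qed

text \<open>The tuple is restricted to the index set, since points of the finite product space take
  the value \<open>undefined\<close> elsewhere.\<close>

lemma (in prob_space) xi_eq_sum_ctr:
  fixes X :: "'a \<Rightarrow> real ^ 'd" and w :: "real ^ 'd \<Rightarrow> real"
  assumes [measurable]: "X \<in> borel_measurable M" "w \<in> borel_measurable borel"
    and tl: "translation_law (distr M borel X)"
  shows "xi M X Xs n w \<omega> = translation_law.sum_ctr (distr M borel X) w {1..n} (\<lambda>i\<in>{1..n}. Xs i \<omega>)"
proof
  fix t
  interpret T: translation_law "distr M borel X" by (rule tl)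
  have "(\<integral>\<omega>'. w (t - X \<omega>') \<partial>M) = T.cmean w t"
    unfolding T.cmean_def by (subst integral_distr) auto
  then show "xi M X Xs n w \<omega> t = T.sum_ctr w {1..n} (\<lambda>i\<in>{1..n}. Xs i \<omega>) t"
    by (simp add: xi_def T.sum_ctr_def T.ctr_def)
qed

text \<open>The two factors of \<open>u_eps\<close> arise separately: \<open>1 + \<epsilon>\<close>
  from chaining within a shell, and \<open>2 powr \<epsilon>\<close> from replacing the radius of
  the shell by the norm of the individual weight, which exceeds the radius of the next shell. The
  hypothesis \<open>mom\<close> includes differences of weights because the links of the chain are
  such differences.\<close>

lemma excess_dominated:
  fixes M :: "'o measure" and X :: "'o \<Rightarrow> real ^ 'd" and Z :: "'z::metric_space set"
    and \<phi> :: "'z \<Rightarrow> real ^ 'd \<Rightarrow> real" and n :: nat and s q \<alpha> \<beta> \<gamma> z \<epsilon> \<tau> G c :: real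
  defines "\<nu> \<equiv> distr M borel X" and "h \<equiv> \<lambda>y. \<alpha> + \<beta> * y + \<gamma> * y\<^sup>2"
  assumes "prob_space M" and X: "X \<in> borel_measurable M"
    and indep: "prob_space.indep_vars M (\<lambda>_. borel) Xs {1..n}"
    and same: "\<And>i. i \<in> {1..n} \<Longrightarrow> distr M borel (Xs i) = \<nu>"
    and n: "n \<ge> 1" and s: "s \<ge> 1" and q: "q \<ge> 1"
    and Z: "totally_bounded Z" and m: "\<And>\<zeta>. \<zeta> \<in> Z \<Longrightarrow> \<phi> \<zeta> \<in> borel_measurable borel"
    and low: "0 < w_lower n s (\<phi> ` Z)" and lowup: "w_lower n s (\<phi> ` Z) \<le> w_upper n s (\<phi> ` Z)"
    and up: "w_upper n s (\<phi> ` Z) < \<infinity>"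
    and W4: "entropy_condition Z" and L: "lipschitz_slices n s \<phi> Z"
    and par: "\<alpha> > 0" "\<beta> \<ge> 0" "\<gamma> \<ge> 0" "z \<ge> 0" "0 < \<epsilon>" "\<epsilon> \<le> 1" "G \<ge> 0"
    and z\<tau>: "z\<^sup>2 * \<tau> \<ge> 1/2"
    and mom: "\<And>v b y. b > 0 \<Longrightarrow> lp_le lborel s v (b / real n powr (1 / s)) \<Longrightarrow>
      (\<exists>\<zeta>1\<in>Z. \<exists>\<zeta>2\<in>Z. v = \<phi> \<zeta>1 \<or> v = (\<lambda>t. \<phi> \<zeta>1 t - \<phi> \<zeta>2 t)) \<Longrightarrow> y \<ge> z \<Longrightarrow>
      (\<integral>\<^sup>+x. ennreal (max 0 (translation_law.sum_norm \<nu> s v {1..n} x - (\<alpha> + \<beta> * y + \<gamma> * y\<^sup>2) * b) powr q) \<partial>PiM {1..n} (\<lambda>_. \<nu>))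
      \<le> ennreal (b powr q * Gamma (q + 1) * G powr q * exp (- 2 * y\<^sup>2 * \<tau>))"
    and c: "c = u_eps \<epsilon> * h z * real n powr (1 / s)"
  obtains H where "H \<in> borel_measurable M"
    "\<And>\<omega> w. w \<in> \<phi> ` Z \<Longrightarrow> epowr (Lp_norm s (xi M X Xs n w \<omega>) - ennreal c * Lp_norm s w) q \<le> H \<omega>"
    "(\<integral>\<^sup>+\<omega>. H \<omega> \<partial>M)
      \<le> ennreal (T_common q Z \<epsilon> * (enn2real (w_upper n s (\<phi> ` Z)) * G) powr q * exp (- z\<^sup>2 * \<tau>))"
proof -
  interpret prob_space M by fact
  note [measurable] = X
  interpret D: prob_space \<nu> unfolding \<nu>_def by (rule prob_space_distr) (rule X)
  have tl: "translation_law \<nu>" by unfold_locales (simp add: \<nu>_def)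
  interpret T: translation_law \<nu> by (rule tl)
  define I where "I = {1..n}"
  have I: "finite I" "card I = n" "I \<noteq> {}" using n by (auto simp: I_def)
  define P where "P = PiM I (\<lambda>_. \<nu>)"
  define rn where "rn = real n powr (1 / s)"
  have rn: "rn > 0" using n by (simp add: rn_def)
  obtain W where W: "w_upper n s (\<phi> ` Z) = ennreal W" "W \<ge> 0" using up by (cases "w_upper n s (\<phi> ` Z)") auto
  obtain l where l: "w_lower n s (\<phi> ` Z) = ennreal l" "l \<ge> 0" using le_less_trans[OF lowup up] by (cases "w_lower n s (\<phi> ` Z)") auto
  have l0: "l > 0" using low l by simp
  have lW: "l \<le> W" using lowup l W by (simp add: ennreal_le_iff)
  have W0: "W > 0" using l0 lW by simp
  \<comment> \<open>For empty Z the supremum in \<open>w_upper\<close> would be 0, contradicting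
    \<open>low\<close> and \<open>lowup\<close>.\<close>
  have Z0: "Z \<noteq> {}" using lowup low by (auto simp: w_upper_def bot_ennreal)
  define b where "b j = W * 2 powr (- \<epsilon> * real j)" for j
  have b: "b j > 0" for j using W0 by (simp add: b_def)
  have bW: "b j \<le> W" for j
  proof -
    have "2 powr (- \<epsilon> * real j) \<le> 2 powr 0" using par by (intro powr_mono) auto
    then show ?thesis using W0 by (simp add: b_def)
  qed
  have b_up: "ennreal (b j) \<le> w_upper n s (\<phi> ` Z)" for j using bW by (simp add: W ennreal_leI)
  define Q where "Q = Gamma (q + 1) * G powr q"
  have Q: "Q \<ge> 0" using less_imp_le[OF Gamma_real_pos[of "q+1"]] q by (simp add: Q_def)
  define Kc where "Kc = 2 powr q * Q * real (covering_number Z (\<epsilon> / 8)) * (1 + L_exp Z \<epsilon>) * exp (- z\<^sup>2 * \<tau>)"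
  have L0: "L_exp Z \<epsilon> \<ge> 0" unfolding L_exp_def by (intro infsum_nonneg) auto
  have Kc: "Kc \<ge> 0" using Q L0 by (simp add: Kc_def)
  have s0: "s > 0" using s by simp
  have ex: "\<exists>H\<in>borel_measurable P. (\<forall>x. \<forall>\<zeta>\<in>slice n s \<phi> Z (ennreal (b j)). ennreal (max 0 (T.sum_norm s (\<phi> \<zeta>) I x - (1 + \<epsilon>) * h z * b j) powr q) \<le> H x)
     \<and> (\<integral>\<^sup>+x. H x \<partial>P) \<le> ennreal (2 powr q * b j powr q * Q * real (covering_number Z (\<epsilon> / 8)) * (1 + L_exp Z \<epsilon>) * exp (- z\<^sup>2 * \<tau>))" for j
  proof -
    define Y where "Y = slice n s \<phi> Z (ennreal (b j))"
    have YZ: "Y \<subseteq> Z" by (auto simp: Y_def slice_def)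
    have lpY: "lp_le lborel s (\<phi> \<zeta>) (b j / rn)" if "\<zeta> \<in> Y" for \<zeta>
      unfolding rn_def using that b[of j] m YZ by (intro slice_lp_le[OF n s0, of _ \<zeta> \<phi> Z]) (auto simp: Y_def)
    have lpI: "lp_le lborel s (\<lambda>t. \<phi> \<zeta> t - \<phi> \<zeta>' t) (b j * dist \<zeta> \<zeta>' / rn)" if "\<zeta> \<in> Y" "\<zeta>' \<in> Y" for \<zeta> \<zeta>'
      unfolding rn_def using that m YZ by (intro slice_increment_lp_le[OF n s0 b L b_up]) (auto simp: Y_def)
    show ?thesis
      unfolding Y_def[symmetric] h_def
    \<comment> \<open>The constant D is the deterministic bound: a sum of n centred translates, each
      of norm at most twice that of the increment.\<close>
    proof (rule chaining_bound[where inc = "\<lambda>\<zeta> \<zeta>'. T.sum_norm s (\<lambda>t. \<phi> \<zeta> t - \<phi> \<zeta>' t) I" and D = "real n * (2 * (b j / rn))"])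
      show "totally_bounded Z" "Y \<subseteq> Z" by fact+
      show "covering_number Z \<delta> \<ge> 1" if "\<delta> > 0" for \<delta> by (rule covering_number_pos[OF Z that Z0])
      show "(\<lambda>k. exp (2 * metric_entropy Z (\<epsilon> * 2 powr (- real k)) - (9/16) * 2 ^ k * real k powr (-2))) summable_on {1..}"
        by (rule L_exp_summable[OF W4]) (use par in auto)
      show "T.sum_norm s (\<phi> \<zeta>) I \<in> borel_measurable P" if "\<zeta> \<in> Y" for \<zeta>
        unfolding P_def using that YZ m by (intro T.sum_norm_measurable) auto
      show "T.sum_norm s (\<lambda>t. \<phi> \<zeta> t - \<phi> \<zeta>' t) I \<in> borel_measurable P" if "\<zeta> \<in> Y" "\<zeta>' \<in> Y" for \<zeta> \<zeta>'
        unfolding P_def using that YZ m by (intro T.sum_norm_measurable borel_measurable_diff) auto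
      show "T.sum_norm s (\<phi> \<zeta>) I x \<le> T.sum_norm s (\<phi> \<zeta>') I x + T.sum_norm s (\<lambda>t. \<phi> \<zeta> t - \<phi> \<zeta>' t) I x"
        if "\<zeta> \<in> Y" "\<zeta>' \<in> Y" for \<zeta> \<zeta>' x
        by (rule T.sum_norm_triangle[OF s lpY lpY I(1)]) (use that in auto)
      show "T.sum_norm s (\<lambda>t. \<phi> \<zeta> t - \<phi> \<zeta>' t) I x \<le> real n * (2 * (b j / rn)) * dist \<zeta> \<zeta>'"
        if "\<zeta> \<in> Y" "\<zeta>' \<in> Y" for \<zeta> \<zeta>' x
        using T.sum_norm_bound[OF s lpI[OF that] I(1), of x] I(2) by (simp add: mult_ac)
      show "(\<integral>\<^sup>+x. ennreal (max 0 (T.sum_norm s (\<phi> \<zeta>) I x - (\<alpha> + \<beta> * z + \<gamma> * z\<^sup>2) * b j) powr q) \<partial>P)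
        \<le> ennreal (b j powr q * Q * exp (- 2 * z\<^sup>2 * \<tau>))" if "\<zeta> \<in> Y" for \<zeta>
        using mom[OF b lpY[OF that, unfolded rn_def] _ order_refl] that YZ
        unfolding P_def I_def Q_def by (auto simp: mult.assoc)
      show "(\<integral>\<^sup>+x. ennreal (max 0 (T.sum_norm s (\<lambda>t. \<phi> \<zeta> t - \<phi> \<zeta>' t) I x - (\<alpha> + \<beta> * y + \<gamma> * y\<^sup>2) * (b j * \<delta>)) powr q) \<partial>P)
        \<le> ennreal ((b j * \<delta>) powr q * Q * exp (- 2 * y\<^sup>2 * \<tau>))"
        if h: "\<zeta> \<in> Y" "\<zeta>' \<in> Y" "\<delta> > 0" "dist \<zeta> \<zeta>' \<le> \<delta>" "y \<ge> z" for \<zeta> \<zeta>' \<delta> y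
      proof -
        have "lp_le lborel s (\<lambda>t. \<phi> \<zeta> t - \<phi> \<zeta>' t) (b j * \<delta> / rn)"
          by (rule lp_le_mono[OF lpI[OF h(1,2)]]) (use h b[of j] rn s in \<open>auto intro!: divide_right_mono mult_left_mono\<close>)
        from mom[OF _ this[unfolded rn_def] _ h(5)] show ?thesis
          using h YZ b[of j] unfolding P_def I_def Q_def by (auto simp: mult.assoc)
      qed
    qed (use par q Q b z\<tau> rn n in \<open>auto intro: less_imp_le\<close>)
  qed
  then obtain H where Hm[measurable]: "\<And>j. H j \<in> borel_measurable P"
    and Hd: "\<And>j x \<zeta>. \<zeta> \<in> slice n s \<phi> Z (ennreal (b j)) \<Longrightarrow> ennreal (max 0 (T.sum_norm s (\<phi> \<zeta>) I x - (1 + \<epsilon>) * h z * b j) powr q) \<le> H j x"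
    and Hi: "\<And>j. (\<integral>\<^sup>+x. H j x \<partial>P) \<le> ennreal (2 powr q * b j powr q * Q * real (covering_number Z (\<epsilon> / 8)) * (1 + L_exp Z \<epsilon>) * exp (- z\<^sup>2 * \<tau>))"
    by metis
  obtain J where J: "\<And>a. l \<le> a \<Longrightarrow> a \<le> W \<Longrightarrow> \<exists>j<J. a \<le> b j \<and> b (Suc j) < a"
    using peeling_index[OF W0 par(5) l0] unfolding b_def by blast
  define xs where "xs \<omega> = (\<lambda>i\<in>I. Xs i \<omega>)" for \<omega>
  have hz: "h z \<ge> 0" using par by (simp add: h_def)
  have pw: "epowr (Lp_norm s (xi M X Xs n (\<phi> \<zeta>) \<omega>) - ennreal c * Lp_norm s (\<phi> \<zeta>)) q \<le> (\<Sum>j<J. H j (xs \<omega>))" if \<zeta>: "\<zeta> \<in> Z" for \<zeta> \<omega>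
  proof -
    have up\<zeta>: "ennreal rn * Lp_norm s (\<phi> \<zeta>) \<le> ennreal W"
      unfolding W(1)[symmetric] w_upper_def rn_def using \<zeta> by (intro mult_left_mono SUP_upper) auto
    have low\<zeta>: "ennreal l \<le> ennreal rn * Lp_norm s (\<phi> \<zeta>)"
      unfolding l(1)[symmetric] w_lower_def rn_def using \<zeta> by (intro mult_left_mono INF_lower) auto
    have "Lp_norm s (\<phi> \<zeta>) \<le> ennreal (W / rn)" using up\<zeta> W rn by (simp add: ennreal_mult_le_iff_le_divide)
    then obtain nm where nm: "Lp_norm s (\<phi> \<zeta>) = ennreal nm" "nm \<ge> 0"
      by (cases "Lp_norm s (\<phi> \<zeta>)") (auto simp: top_unique)
    have "l \<le> rn * nm" "rn * nm \<le> W"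
      using up\<zeta> low\<zeta> nm rn W l by (simp_all add: ennreal_mult[symmetric] ennreal_le_iff)
    then obtain j where j: "j < J" "rn * nm \<le> b j" "b (Suc j) < rn * nm" using J by blast
    have sl: "\<zeta> \<in> slice n s \<phi> Z (ennreal (b j))"
      using \<zeta> j nm rn b[of j] by (auto simp: slice_def rn_def[symmetric] ennreal_mult[symmetric] intro!: ennreal_leI)
    have lp: "lp_le lborel s (\<phi> \<zeta>) (b j / rn)"
      unfolding rn_def by (rule slice_lp_le[OF n s0 less_imp_le[OF b] sl m[OF \<zeta>]])
    have "xi M X Xs n (\<phi> \<zeta>) \<omega> = T.sum_ctr (\<phi> \<zeta>) I (xs \<omega>)"
      unfolding xs_def I_def using xi_eq_sum_ctr[OF X m[OF \<zeta>]] tl by (simp add: \<nu>_def)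
    then have nx: "Lp_norm s (xi M X Xs n (\<phi> \<zeta>) \<omega>) = ennreal (T.sum_norm s (\<phi> \<zeta>) I (xs \<omega>))"
      using Lp_norm_eq[OF T.lp_le_sum_ctr[OF s lp I(1)], of "xs \<omega>"] by (simp add: T.sum_norm_def)
    have bS: "b j = 2 powr \<epsilon> * b (Suc j)"
      by (simp add: b_def powr_add[symmetric] distrib_left mult.left_commute)
    have "(1 + \<epsilon>) * h z * b j = u_eps \<epsilon> * h z * b (Suc j)" by (simp add: bS u_eps_def mult_ac)
    also have "\<dots> \<le> u_eps \<epsilon> * h z * (rn * nm)"
      using j(3) hz par by (intro mult_left_mono) (auto simp: u_eps_def)
    also have "\<dots> = c * nm" by (simp add: c rn_def)
    finally have cn: "(1 + \<epsilon>) * h z * b j \<le> c * nm" .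
    have c0: "c \<ge> 0" using hz par by (simp add: c u_eps_def)
    have "epowr (Lp_norm s (xi M X Xs n (\<phi> \<zeta>) \<omega>) - ennreal c * Lp_norm s (\<phi> \<zeta>)) q
      = epowr (ennreal (max 0 (T.sum_norm s (\<phi> \<zeta>) I (xs \<omega>) - c * nm))) q"
      using nm c0 unfolding nx by (simp add: ennreal_mult[symmetric] ennreal_minus)
    also have "\<dots> = ennreal (max 0 (T.sum_norm s (\<phi> \<zeta>) I (xs \<omega>) - c * nm) powr q)" by (rule epowr_ennreal) simp
    also have "\<dots> \<le> ennreal (max 0 (T.sum_norm s (\<phi> \<zeta>) I (xs \<omega>) - (1 + \<epsilon>) * h z * b j) powr q)"
      using cn q by (intro ennreal_leI powr_mono2) auto
    also have "\<dots> \<le> H j (xs \<omega>)" by (rule Hd[OF sl])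
    also have "\<dots> \<le> (\<Sum>j<J. H j (xs \<omega>))" using j(1) by (intro member_le_sum) auto
    finally show ?thesis .
  qed
  have rv: "Xs i \<in> borel_measurable M" if "i \<in> I" for i
    using indep that unfolding indep_vars_def I_def by auto
  have xs_m: "xs \<in> measurable M (PiM I (\<lambda>_. borel))"
    unfolding xs_def using rv by (intro measurable_restrict) auto
  have law: "distr M (PiM I (\<lambda>_. borel)) xs = P"
  proof -
    have "distr M (PiM I (\<lambda>_. borel)) xs = PiM I (\<lambda>i. distr M borel (Xs i))"
      unfolding xs_def using indep_vars_iff_distr_eq_PiM'[where I = I and M' = "\<lambda>_. borel" and X = Xs] I rv indep by (simp add: I_def)
    also have "\<dots> = P" unfolding P_def by (intro PiM_cong) (auto simp: same I_def)
    finally show ?thesis .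
  qed
  have Hb: "H j \<in> borel_measurable (PiM I (\<lambda>_. borel))" for j
    using Hm[of j] unfolding law[symmetric] by simp
  have "(\<integral>\<^sup>+\<omega>. (\<Sum>j<J. H j (xs \<omega>)) \<partial>M) = (\<integral>\<^sup>+x. (\<Sum>j<J. H j x) \<partial>P)"
    unfolding law[symmetric] by (rule nn_integral_distr[symmetric, OF xs_m]) (use Hb in measurable)
  also have "\<dots> = (\<Sum>j<J. \<integral>\<^sup>+x. H j x \<partial>P)" by (rule nn_integral_sum) simp
  also have "\<dots> \<le> (\<Sum>j<J. ennreal (Kc * W powr q * (2 powr (- \<epsilon> * real j)) powr q))"
  proof (rule sum_mono)
    fix j
    have "2 powr q * b j powr q * Q * real (covering_number Z (\<epsilon> / 8)) * (1 + L_exp Z \<epsilon>) * exp (- z\<^sup>2 * \<tau>)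
      = Kc * W powr q * (2 powr (- \<epsilon> * real j)) powr q"
      using W0 unfolding Kc_def b_def by (subst powr_mult) (auto simp: mult_ac)
    then show "(\<integral>\<^sup>+x. H j x \<partial>P) \<le> ennreal (Kc * W powr q * (2 powr (- \<epsilon> * real j)) powr q)"
      using Hi[of j] by (simp only:)
  qed
  also have "\<dots> = ennreal (Kc * W powr q * (\<Sum>j<J. (2 powr (- \<epsilon> * real j)) powr q))"
    using Kc by (simp add: sum_distrib_left)
  also have "\<dots> \<le> ennreal (T_common q Z \<epsilon> * (enn2real (w_upper n s (\<phi> ` Z)) * G) powr q * exp (- z\<^sup>2 * \<tau>))"
  proof (rule ennreal_leI)
    define F where "F = 2 powr (q * \<epsilon>) / (2 powr (q * \<epsilon>) - 1)"
    have "2 powr (q * \<epsilon>) > 1" using par q by simp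
    then have F: "F \<ge> 0" by (simp add: F_def)
    \<comment> \<open>\<open>T_common\<close> carries the q-th power of \<open>u_eps\<close>, which
      is at least 1 and is inserted here.\<close>
    have "1 * 1 \<le> 2 powr \<epsilon> * (1 + \<epsilon>)"
      using par by (intro mult_mono) (auto intro: ge_one_powr_ge_zero)
    then have u: "1 \<le> u_eps \<epsilon> powr q" using q unfolding u_eps_def by (intro ge_one_powr_ge_zero) auto
    have "Kc * W powr q * (\<Sum>j<J. (2 powr (- \<epsilon> * real j)) powr q) \<le> Kc * W powr q * F"
      unfolding F_def using Kc q par by (intro mult_left_mono geometric_powr_sum_le) auto
    also have "\<dots> \<le> u_eps \<epsilon> powr q * (Kc * W powr q * F)"
      using mult_right_mono[OF u, of "Kc * W powr q * F"] Kc F by simp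
    also have "\<dots> = T_common q Z \<epsilon> * (W * G) powr q * exp (- z\<^sup>2 * \<tau>)"
      using W0 par(7) unfolding T_common_def Kc_def F_def Q_def
      by (simp add: powr_mult powr_add[symmetric] distrib_left mult_ac add.commute)
    finally show "Kc * W powr q * (\<Sum>j<J. (2 powr (- \<epsilon> * real j)) powr q)
      \<le> T_common q Z \<epsilon> * (enn2real (w_upper n s (\<phi> ` Z)) * G) powr q * exp (- z\<^sup>2 * \<tau>)"
      using W by simp
  qed
  finally have int: "(\<integral>\<^sup>+\<omega>. (\<Sum>j<J. H j (xs \<omega>)) \<partial>M)
    \<le> ennreal (T_common q Z \<epsilon> * (enn2real (w_upper n s (\<phi> ` Z)) * G) powr q * exp (- z\<^sup>2 * \<tau>))" .
  have "(\<lambda>\<omega>. \<Sum>j<J. H j (xs \<omega>)) \<in> borel_measurable M"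
    by (intro borel_measurable_sum measurable_compose[OF xs_m Hb])
  then show ?thesis by (rule that[OF _ _ int]) (auto intro: pw)
qed

text \<open>The nonnegative integral is monotone for arbitrary functions, so a pointwise majorant
  suffices even if the supremum is not measurable.\<close>

lemma excess_moment_leI:
  assumes "\<And>\<omega> w. w \<in> V \<Longrightarrow> epowr (Lp_norm s (xi M X Xs n w \<omega>) - ennreal c * Lp_norm s w) q \<le> H \<omega>"
    and "(\<integral>\<^sup>+\<omega>. H \<omega> \<partial>M) \<le> C"
  shows "excess_moment M X Xs n s q c V \<le> C"
proof -
  have "(SUP w\<in>V. epowr (Lp_norm s (xi M X Xs n w \<omega>) - ennreal c * Lp_norm s w) q) \<le> H \<omega>" for \<omega>
    by (intro SUP_least assms(1))
  then have "excess_moment M X Xs n s q c V \<le> (\<integral>\<^sup>+\<omega>. H \<omega> \<partial>M)"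
    unfolding excess_moment_def by (intro nn_integral_mono)
  then show ?thesis using assms(2) by (rule order_trans)
qed

lemma emeasure_nonzero_le_mu_star:
  fixes v :: "real ^ 'd \<Rightarrow> real"
  assumes "v \<in> V"
  shows "emeasure lborel {t. v t \<noteq> 0} \<le> mu_star V"
proof -
  have "emeasure lborel {t. v t \<noteq> 0} \<le> emeasure lborel (closure (support_on UNIV v))"
    using closure_subset[of "support_on UNIV v"] by (intro emeasure_mono) (auto simp: support_on_def)
  also have "\<dots> \<le> mu_star V" unfolding mu_star_def by (rule SUP_upper[OF assms])
  finally show ?thesis .
qed

lemma T_common_nonneg:
  assumes "q \<ge> 1" "\<epsilon> > 0"
  shows "T_common q Z \<epsilon> \<ge> 0"
proof -
  have "L_exp Z \<epsilon> \<ge> 0" unfolding L_exp_def by (intro infsum_nonneg) auto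
  moreover have "2 powr (q * \<epsilon>) > 1" using assms by simp
  moreover have "Gamma (q + 1) \<ge> 0" using assms by (intro less_imp_le[OF Gamma_real_pos]) auto
  ultimately show ?thesis unfolding T_common_def by (intro mult_nonneg_nonneg divide_nonneg_nonneg) auto
qed

section \<open>The two regimes of s\<close>

lemma excess_moment_type_s:
  fixes M :: "'o measure" and X :: "'o \<Rightarrow> real ^ 'd" and Z :: "'z::metric_space set"
    and \<phi> :: "'z \<Rightarrow> real ^ 'd \<Rightarrow> real" and n :: nat and s q z \<epsilon> :: real
  assumes M: "prob_space M" and X: "X \<in> borel_measurable M"
    and indep: "prob_space.indep_vars M (\<lambda>_. borel) Xs {1..n}"
    and same: "\<And>i. i \<in> {1..n} \<Longrightarrow> distr M borel (Xs i) = distr M borel X"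
    and n: "n \<ge> 1" and s: "s \<ge> 1" and q: "q \<ge> 1"
    and Z: "totally_bounded Z" and m: "\<And>\<zeta>. \<zeta> \<in> Z \<Longrightarrow> \<phi> \<zeta> \<in> borel_measurable borel"
    and low: "0 < w_lower n s (\<phi> ` Z)" and lowup: "w_lower n s (\<phi> ` Z) \<le> w_upper n s (\<phi> ` Z)"
    and up: "w_upper n s (\<phi> ` Z) < \<infinity>"
    and W4: "entropy_condition Z"
    and L: "lipschitz_condition n s \<phi> Z"
    and s2: "s < 2" and z: "z \<ge> sqrt 37 / 2 * real n powr (1/2 - 1/s)" and \<epsilon>: "0 < \<epsilon>" "\<epsilon> \<le> 1"
  shows "excess_moment M X Xs n s q (4 * u_eps \<epsilon> * (1 + z) * real n powr (1/s)) (\<phi> ` Z)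
      \<le> ennreal (T3 n s q \<phi> Z \<epsilon> * real n powr (q/s) * exp (- (2 * z\<^sup>2 / 37) * real n powr (2/s - 1)))"
proof -
  interpret prob_space M by (rule M)
  define \<nu> where "\<nu> = distr M borel X"
  interpret D: prob_space \<nu> unfolding \<nu>_def by (rule prob_space_distr) (rule X)
  interpret T: translation_law \<nu> by unfold_locales (simp add: \<nu>_def)
  have nq: "real n powr (q / p) \<ge> 1" if "p > 0" for p
    using n q that by (intro ge_one_powr_ge_zero) auto
  define W where "W = enn2real (w_upper n s (\<phi> ` Z))"
  have W: "W \<ge> 0" by (simp add: W_def)
  define \<tau> where "\<tau> = 2 / 37 * real n powr (2/s - 1)"
  define G where "G = 4 * (1 + 4 * real n powr (1/2 - 1/s))"
  have G: "G \<ge> 0" by (simp add: G_def)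
  have z0: "z \<ge> 0" by (rule order_trans[OF _ z]) simp
  have z\<tau>: "z\<^sup>2 * \<tau> \<ge> 1/2"
  proof -
    \<comment> \<open>Origin of \<open>sqrt 37 / 2\<close>: its square 37/4 times the factor 2/37 of
      \<open>\<tau>\<close> is 1/2.\<close>
    have "1/2 = (sqrt 37 / 2 * real n powr (1/2 - 1/s))\<^sup>2 * \<tau>"
    proof -
      have "real n powr (1/2 - 1/s) * real n powr (1/2 - 1/s) * real n powr (2/s - 1) = 1"
        using n by (simp add: powr_add[symmetric])
      then show ?thesis by (simp add: \<tau>_def power2_eq_square mult_ac)
    qed
    also have "\<dots> \<le> z\<^sup>2 * \<tau>" using z by (intro mult_right_mono power_mono) (auto simp: \<tau>_def)
    finally show ?thesis .
  qed
  have lip: "lipschitz_slices n s \<phi> Z" using L s s2 by (simp add: lipschitz_condition_def)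
  have "excess_moment M X Xs n s q (4 * u_eps \<epsilon> * (1 + z) * real n powr (1/s)) (\<phi> ` Z)
    \<le> ennreal (T_common q Z \<epsilon> * (enn2real (w_upper n s (\<phi> ` Z)) * G) powr q * exp (- z\<^sup>2 * \<tau>))"
  proof (rule excess_dominated[where \<alpha> = 4 and \<beta> = 4 and \<gamma> = 0 and z = z,
        OF M X indep same n s q Z m low lowup up W4 lip _ _ _ z0 \<epsilon> G z\<tau>])
    fix v :: "real ^ 'd \<Rightarrow> real" and b y :: real
    assume b: "b > 0" and v: "lp_le lborel s v (b / real n powr (1 / s))" and y: "z \<le> y"
    show "(\<integral>\<^sup>+x. ennreal (max 0 (translation_law.sum_norm (distr M borel X) s v {1..n} x - (4 + 4 * y + 0 * y\<^sup>2) * b) powr q) \<partial>PiM {1..n} (\<lambda>_. distr M borel X))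
      \<le> ennreal (b powr q * Gamma (q + 1) * G powr q * exp (- 2 * y\<^sup>2 * \<tau>))"
      unfolding \<nu>_def[symmetric] G_def \<tau>_def
      by (rule T.moment_type_s) (use n s q s2 b v y z in auto)
  next
    show "4 * u_eps \<epsilon> * (1 + z) * real n powr (1/s) = u_eps \<epsilon> * (4 + 4 * z + 0 * z\<^sup>2) * real n powr (1 / s)"
      by (simp add: algebra_simps)
  next
    show "excess_moment M X Xs n s q (4 * u_eps \<epsilon> * (1 + z) * real n powr (1/s)) (\<phi> ` Z)
      \<le> ennreal (T_common q Z \<epsilon> * (enn2real (w_upper n s (\<phi> ` Z)) * G) powr q * exp (- z\<^sup>2 * \<tau>))"
      if "\<And>\<omega> w. w \<in> \<phi> ` Z \<Longrightarrow> epowr (Lp_norm s (xi M X Xs n w \<omega>)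
          - ennreal (4 * u_eps \<epsilon> * (1 + z) * real n powr (1/s)) * Lp_norm s w) q \<le> H \<omega>"
        and "(\<integral>\<^sup>+\<omega>. H \<omega> \<partial>M)
          \<le> ennreal (T_common q Z \<epsilon> * (enn2real (w_upper n s (\<phi> ` Z)) * G) powr q * exp (- z\<^sup>2 * \<tau>))" for H
      using that by (rule excess_moment_leI)
  qed simp_all
  also have "\<dots> \<le> ennreal (T3 n s q \<phi> Z \<epsilon> * real n powr (q/s) * exp (- (2 * z\<^sup>2 / 37) * real n powr (2/s - 1)))"
  proof (rule ennreal_leI)
    have "T_common q Z \<epsilon> * (W * G) powr q * exp (- z\<^sup>2 * \<tau>) * 1
      \<le> T_common q Z \<epsilon> * (W * G) powr q * exp (- z\<^sup>2 * \<tau>) * real n powr (q/s)"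
      using T_common_nonneg[OF q \<epsilon>(1), of Z] nq[of s] s by (intro mult_left_mono) auto
    moreover have "T3 n s q \<phi> Z \<epsilon> = T_common q Z \<epsilon> * (W * G) powr q"
    proof -
      have "4 * enn2real (w_upper n s (\<phi> ` Z)) * (1 + 4 * real n powr (1/2 - 1/s)) = W * G"
        by (simp add: W_def G_def)
      then show ?thesis by (simp only: T3_def)
    qed
    moreover have "- (2 * z\<^sup>2 / 37) * real n powr (2/s - 1) = - z\<^sup>2 * \<tau>" by (simp add: \<tau>_def)
    ultimately show "T_common q Z \<epsilon> * (enn2real (w_upper n s (\<phi> ` Z)) * G) powr q * exp (- z\<^sup>2 * \<tau>)
      \<le> T3 n s q \<phi> Z \<epsilon> * real n powr (q/s) * exp (- (2 * z\<^sup>2 / 37) * real n powr (2/s - 1))"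
      by (simp only: W_def mult_ac mult_1_right)
  qed
  finally show ?thesis .
qed

lemma excess_moment_hilbert:
  fixes M :: "'o measure" and X :: "'o \<Rightarrow> real ^ 'd" and Z :: "'z::metric_space set"
    and \<phi> :: "'z \<Rightarrow> real ^ 'd \<Rightarrow> real" and n :: nat and s q finf z \<epsilon> :: real
  assumes finf: "finf \<ge> 1" and law: "distr M borel X = density lborel (\<lambda>x. ennreal (f x))" and M: "prob_space M" and X: "X \<in> borel_measurable M"
    and indep: "prob_space.indep_vars M (\<lambda>_. borel) Xs {1..n}"
    and same: "\<And>i. i \<in> {1..n} \<Longrightarrow> distr M borel (Xs i) = distr M borel X"
    and n: "n \<ge> 1" and s: "s \<ge> 1" and q: "q \<ge> 1"
    and Z: "totally_bounded Z" and m: "\<And>\<zeta>. \<zeta> \<in> Z \<Longrightarrow> \<phi> \<zeta> \<in> borel_measurable borel"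
    and low: "0 < w_lower n s (\<phi> ` Z)" and lowup: "w_lower n s (\<phi> ` Z) \<le> w_upper n s (\<phi> ` Z)"
    and up: "w_upper n s (\<phi> ` Z) < \<infinity>"
    and W1: "mu_star (\<phi> ` Z) < \<infinity>"
    and W4: "entropy_condition Z"
    and L: "lipschitz_condition n s \<phi> Z"
    and s2: "s = 2" and f: "f \<in> bounded_densities finf"
    and z': "z \<ge> sqrt (8 * (enn2real (mu_star (\<phi> ` Z)) * finf\<^sup>2 + 4 * real n powr (-1/2)))"
    and \<epsilon>: "0 < \<epsilon>" "\<epsilon> \<le> 1"
  shows "excess_moment M X Xs n 2 q (u_eps \<epsilon> * (1 + z + z\<^sup>2 / 12) * sqrt (real n)) (\<phi> ` Z)
      \<le> ennreal (T4 n finf q \<phi> Z \<epsilon> * real n powr (q/2)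
                 * exp (- z\<^sup>2 / (16 * (finf\<^sup>2 * enn2real (mu_star (\<phi> ` Z)) + 4 * real n powr (-1/2)))))"
proof -
  interpret prob_space M by (rule M)
  define \<nu> where "\<nu> = distr M borel X"
  interpret D: prob_space \<nu> unfolding \<nu>_def by (rule prob_space_distr) (rule X)
  interpret T: translation_law \<nu> by unfold_locales (simp add: \<nu>_def)
  have nq: "real n powr (q / p) \<ge> 1" if "p > 0" for p
    using n q that by (intro ge_one_powr_ge_zero) auto
  define W where "W = enn2real (w_upper n s (\<phi> ` Z))"
  have W: "W \<ge> 0" by (simp add: W_def)
  define \<mu> where "\<mu> = enn2real (mu_star (\<phi> ` Z))"
  have \<mu>: "\<mu> \<ge> 0" "mu_star (\<phi> ` Z) = ennreal \<mu>" using W1 by (auto simp: \<mu>_def)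
  define A where "A = finf\<^sup>2 * \<mu> + 4 * real n powr (-1/2)"
  have A: "A > 0" using \<mu> n by (simp add: A_def add_nonneg_pos)
  have z: "z \<ge> sqrt (8 * A)" using z' by (simp add: A_def \<mu>_def mult.commute)
  have z0: "z \<ge> 0" by (rule order_trans[OF _ z]) (use A in simp)
  have z2: "z\<^sup>2 \<ge> 8 * A" using z A by (simp add: sqrt_le_D)
  define \<tau> where "\<tau> = 1 / (16 * A)"
  \<comment> \<open>The 8 in the threshold and the 16 in the exponent combine to 1/2.\<close>
  have z\<tau>: "z\<^sup>2 * \<tau> \<ge> 1/2" using z2 A by (simp add: \<tau>_def field_simps)
  define G where "G = 1 + 2 * sqrt (2 * A)"
  have G: "G \<ge> 0" using A by (simp add: G_def)
  have fb: "f \<in> borel_measurable borel" "\<And>x. 0 \<le> f x" "\<And>x. f x \<le> finf"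
    using f by (auto simp: bounded_densities_def)
  have nu: "\<nu> = density lborel (\<lambda>x. ennreal (f x))" using law by (simp add: \<nu>_def)
  have lip: "lipschitz_slices n 2 \<phi> Z" using L s2 by (simp add: lipschitz_condition_def)
  have "excess_moment M X Xs n 2 q (u_eps \<epsilon> * (1 + z + z\<^sup>2 / 12) * sqrt (real n)) (\<phi> ` Z)
    \<le> ennreal (T_common q Z \<epsilon> * (enn2real (w_upper n 2 (\<phi> ` Z)) * G) powr q * exp (- z\<^sup>2 * \<tau>))"
  proof (rule excess_dominated[where \<alpha> = 1 and \<beta> = 1 and \<gamma> = "1/12" and z = z,
        OF M X indep same n s[unfolded s2] q Z m low[unfolded s2] lowup[unfolded s2] up[unfolded s2]
          W4 lip _ _ _ z0 \<epsilon> G z\<tau>])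
    show "u_eps \<epsilon> * (1 + z + z\<^sup>2 / 12) * sqrt (real n) = u_eps \<epsilon> * (1 + 1 * z + 1/12 * z\<^sup>2) * real n powr (1 / 2)"
      by (simp add: powr_half_sqrt)
    fix v :: "real ^ 'd \<Rightarrow> real" and b y :: real
    assume b: "b > 0" and v: "lp_le lborel 2 v (b / real n powr (1 / 2))" and y: "z \<le> y"
      and "\<exists>\<zeta>1\<in>Z. \<exists>\<zeta>2\<in>Z. v = \<phi> \<zeta>1 \<or> v = (\<lambda>t. \<phi> \<zeta>1 t - \<phi> \<zeta>2 t)"
    then obtain \<zeta>1 \<zeta>2 where \<zeta>: "\<zeta>1 \<in> Z" "\<zeta>2 \<in> Z" "v = \<phi> \<zeta>1 \<or> v = (\<lambda>t. \<phi> \<zeta>1 t - \<phi> \<zeta>2 t)" by blast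
    have [measurable]: "\<phi> \<zeta>1 \<in> borel_measurable borel" "\<phi> \<zeta>2 \<in> borel_measurable borel"
      using \<zeta> m by auto
    have supp: "emeasure lborel {t. v t \<noteq> 0} \<le> ennreal (2 * \<mu>)"
    proof -
      \<comment> \<open>A difference vanishes outside the union of the two supports, which is the
        reason for the factor 2.\<close>
      have "emeasure lborel {t. v t \<noteq> 0} \<le> emeasure lborel ({t. \<phi> \<zeta>1 t \<noteq> 0} \<union> {t. \<phi> \<zeta>2 t \<noteq> 0})"
        using \<zeta>(3) by (intro emeasure_mono) auto
      also have "\<dots> \<le> emeasure lborel {t. \<phi> \<zeta>1 t \<noteq> 0} + emeasure lborel {t. \<phi> \<zeta>2 t \<noteq> 0}"
        by (intro emeasure_subadditive) simp_all
      also have "\<dots> \<le> ennreal \<mu> + ennreal \<mu>"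
        unfolding \<mu>(2)[symmetric] using \<zeta> by (intro add_mono emeasure_nonzero_le_mu_star) auto
      finally show ?thesis using \<mu> by (simp add: ennreal_plus[symmetric] del: ennreal_plus)
    qed
    show "(\<integral>\<^sup>+x. ennreal (max 0 (translation_law.sum_norm (distr M borel X) 2 v {1..n} x - (1 + 1 * y + 1/12 * y\<^sup>2) * b) powr q) \<partial>PiM {1..n} (\<lambda>_. distr M borel X))
      \<le> ennreal (b powr q * Gamma (q + 1) * G powr q * exp (- 2 * y\<^sup>2 * \<tau>))"
      unfolding \<nu>_def[symmetric] G_def \<tau>_def
      by (rule T.moment_hilbert[OF _ b _ _ _ v fb nu finf supp \<mu>(1) A_def]) (use n q y z in auto)
  next
    show "excess_moment M X Xs n 2 q (u_eps \<epsilon> * (1 + z + z\<^sup>2 / 12) * sqrt (real n)) (\<phi> ` Z)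
      \<le> ennreal (T_common q Z \<epsilon> * (enn2real (w_upper n 2 (\<phi> ` Z)) * G) powr q * exp (- z\<^sup>2 * \<tau>))"
      if "\<And>\<omega> w. w \<in> \<phi> ` Z \<Longrightarrow> epowr (Lp_norm 2 (xi M X Xs n w \<omega>)
          - ennreal (u_eps \<epsilon> * (1 + z + z\<^sup>2 / 12) * sqrt (real n)) * Lp_norm 2 w) q \<le> H \<omega>"
        and "(\<integral>\<^sup>+\<omega>. H \<omega> \<partial>M)
          \<le> ennreal (T_common q Z \<epsilon> * (enn2real (w_upper n 2 (\<phi> ` Z)) * G) powr q * exp (- z\<^sup>2 * \<tau>))" for H
      using that by (rule excess_moment_leI)
  qed simp_all
  also have "\<dots> \<le> ennreal (T4 n finf q \<phi> Z \<epsilon> * real n powr (q/2)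
               * exp (- z\<^sup>2 / (16 * (finf\<^sup>2 * enn2real (mu_star (\<phi> ` Z)) + 4 * real n powr (-1/2)))))"
  proof (rule ennreal_leI)
    \<comment> \<open>The constant of \<open>T4\<close> has one more nonnegative summand than G, so
      enlarging G suffices.\<close>
    define G' where "G' = 1 + 2 * sqrt (2 * \<mu> * finf\<^sup>2 + 8 * real n powr (-1/2)) + (8/3) * real n powr (-1/2)"
    have "2 * A = 2 * \<mu> * finf\<^sup>2 + 8 * real n powr (-1/2)" by (simp add: A_def mult_ac)
    then have GG: "G \<le> G'" by (simp add: G_def G'_def)
    have "T_common q Z \<epsilon> * (W * G) powr q * exp (- z\<^sup>2 * \<tau>) * 1
      \<le> T_common q Z \<epsilon> * (W * G') powr q * exp (- z\<^sup>2 * \<tau>) * real n powr (q/2)"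
      using T_common_nonneg[OF q \<epsilon>(1), of Z] nq[of 2] GG G W q
      by (intro mult_mono powr_mono2 mult_left_mono order_refl) (auto intro!: mult_nonneg_nonneg)
    also have "(W * G') powr q = W powr q * G' powr q" using W GG G by (simp add: powr_mult)
    finally show "T_common q Z \<epsilon> * (enn2real (w_upper n 2 (\<phi> ` Z)) * G) powr q * exp (- z\<^sup>2 * \<tau>)
      \<le> T4 n finf q \<phi> Z \<epsilon> * real n powr (q/2)
               * exp (- z\<^sup>2 / (16 * (finf\<^sup>2 * enn2real (mu_star (\<phi> ` Z)) + 4 * real n powr (-1/2))))"
      using s2 by (simp add: T4_def W_def G'_def \<tau>_def A_def \<mu>_def mult_ac)
  qed
  finally show ?thesis .
qed

theorem theorem4:
  fixes M :: "'o measure"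
    and X :: "'o \<Rightarrow> real ^ 'd"
    and Xs :: "nat \<Rightarrow> 'o \<Rightarrow> real ^ 'd"
    and f :: "real ^ 'd \<Rightarrow> real"
    and Z :: "'z::metric_space set"
    and \<phi> :: "'z \<Rightarrow> real ^ 'd \<Rightarrow> real"
    and n :: nat and s q finf :: real
  assumes "prob_space M"
    and "\<And>x. 0 \<le> f x"
    and "distributed M lborel X (\<lambda>x. ennreal (f x))"
    and "prob_space.indep_vars M (\<lambda>_. borel) Xs {1..n}"
    and "\<And>i. i \<in> {1..n} \<Longrightarrow> distr M borel (Xs i) = distr M borel X"
    and "n \<ge> 1" and "s \<ge> 1" and "q \<ge> 1" and "finf \<ge> 1"
    and "totally_bounded Z"
    and "\<And>\<zeta>. \<zeta> \<in> Z \<Longrightarrow> \<phi> \<zeta> \<in> borel_measurable borel"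
    and "0 < w_lower n s (\<phi> ` Z)"
    and "w_lower n s (\<phi> ` Z) \<le> w_upper n s (\<phi> ` Z)"
    and "w_upper n s (\<phi> ` Z) < \<infinity>"
    and A1: "translation_separable s (\<phi> ` Z)"
    and W1: "mu_star (\<phi> ` Z) < \<infinity>"
    and W4: "entropy_condition Z"
    and L: "lipschitz_condition n s \<phi> Z"
  shows
    "(s < 2 \<longrightarrow>
       (\<forall>z \<epsilon>. z \<ge> sqrt 37 / 2 * real n powr (1/2 - 1/s) \<and> 0 < \<epsilon> \<and> \<epsilon> \<le> 1 \<longrightarrow>
          excess_moment M X Xs n s q
              (4 * u_eps \<epsilon> * (1 + z) * real n powr (1/s)) (\<phi> ` Z)
            \<le> ennreal (T3 n s q \<phi> Z \<epsilon> * real n powr (q/s)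
                 * exp (- (2 * z\<^sup>2 / 37) * real n powr (2/s - 1)))))
     \<and>
     (s = 2 \<and> f \<in> bounded_densities finf \<longrightarrow>
       (\<forall>z \<epsilon>. z \<ge> sqrt (8 * (enn2real (mu_star (\<phi> ` Z)) * finf\<^sup>2 + 4 * real n powr (-1/2)))
              \<and> 0 < \<epsilon> \<and> \<epsilon> \<le> 1 \<longrightarrow>
          excess_moment M X Xs n 2 q
              (u_eps \<epsilon> * (1 + z + z\<^sup>2 / 12) * sqrt (real n)) (\<phi> ` Z)
            \<le> ennreal (T4 n finf q \<phi> Z \<epsilon> * real n powr (q/2)
                 * exp (- z\<^sup>2 / (16 * (finf\<^sup>2 * enn2real (mu_star (\<phi> ` Z)) + 4 * real n powr (-1/2)))))))"
proof -
  have X: "X \<in> borel_measurable M" using distributed_measurable[OF assms(3)] by simp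
  \<comment> \<open>The law depends on the target only through its measurable sets, which agree for
    the two measures.\<close>
  have "distr M borel X = distr M lborel X" by (intro distr_cong) auto
  then have law: "distr M borel X = density lborel (\<lambda>x. ennreal (f x))"
    using distributed_distr_eq_density[OF assms(3)] by simp
  show ?thesis
    using excess_moment_type_s[OF assms(1) X assms(4-8) assms(10-14) W4 L]
      excess_moment_hilbert[OF assms(9) law assms(1) X assms(4-8) assms(10-14) W1 W4 L] by blast
qed

end
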